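(* Let $1<p<\infty$, $1/p+1/q=1$, and let $F$ and $G$ be mutually Young conjugate Orlicz functions. Suppose $L_F$ is $(p-DH)$. Then the following are equivalent: (i) $L_G$ is $(q-DH)$; (ii) $L_G$ is $DC$; (iii) $L_F$ is uniformly $(p-DH)$; (iv) $E_F^\infty\equiv\{t^p\}$.
   Context: An Orlicz function is an increasing convex function on $[0,\infty)$ vanishing at $0$ and tending to $\infty$; the Young conjugate of $F$ is $G(u)=\sup_{t>0}(ut-F(t))$. $L_F$ is the Orlicz space on $[0,1]$ with Luxemburg norm. For $A>0$, $E_{F,A}^\infty$ is the closure in $C[0,1]$ of $\{x\mapsto F(xy)/F(y):y>A\}$, $E_F^\infty=\bigcap_{A>0}E_{F,A}^\infty$; $E_F^\infty\equiv\{t^p\}$ means there is $C>0$ with $C^{-1}t^p\le H(t)\le Ct^p$ for all $0<t\le1$ and all $H\in E_F^\infty$. A Banach lattice is $(r-DH)$ if every sequence of pairwise disjoint norm-one elements has a subsequence equivalent to the unit vector basis of $\ell_r$, and uniformly $(r-DH)$ if the equivalence constant can be chosen independent of the sequence. A symmetric space is $DC$ (disjointly complemented) if every sequence of pairwise disjoint elements has a subsequence whose closed linear span is complemented. *)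

theory Defs
  imports "HOL-Analysis.Analysis"
begin

definition orlicz_function :: "(real \<Rightarrow> real) \<Rightarrow> bool" where
  "orlicz_function F \<longleftrightarrow>
     F 0 = 0 \<and> mono_on {0..} F \<and> convex_on {0..} F \<and> filterlim F at_top at_top"

definition young_conjugate :: "(real \<Rightarrow> real) \<Rightarrow> (real \<Rightarrow> real) \<Rightarrow> bool" where
  "young_conjugate F G \<longleftrightarrow>
     (\<forall>u\<ge>0. bdd_above {u * t - F t | t. t > 0} \<and> G u = Sup {u * t - F t | t. t > 0})"

abbreviation I01 :: "real measure" where
  "I01 \<equiv> lebesgue_on {0..1}"

definition modular :: "(real \<Rightarrow> real) \<Rightarrow> (real \<Rightarrow> real) \<Rightarrow> real \<Rightarrow> ennreal" where
  "modular F f c = (\<integral>\<^sup>+ t. ennreal (F (\<bar>f t\<bar> / c)) \<partial>I01)"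

definition orlicz_space :: "(real \<Rightarrow> real) \<Rightarrow> (real \<Rightarrow> real) set" where
  "orlicz_space F = {f \<in> borel_measurable I01. \<exists>c>0. modular F f c < \<infinity>}"

definition lux_norm :: "(real \<Rightarrow> real) \<Rightarrow> (real \<Rightarrow> real) \<Rightarrow> real" where
  "lux_norm F f = Inf {c. c > 0 \<and> modular F f c \<le> 1}"

definition disjoint_seq :: "(nat \<Rightarrow> real \<Rightarrow> real) \<Rightarrow> bool" where
  "disjoint_seq x \<longleftrightarrow> (\<forall>i j. i \<noteq> j \<longrightarrow> (AE t in I01. x i t = 0 \<or> x j t = 0))"

definition lr_norm :: "real \<Rightarrow> (nat \<Rightarrow> real) \<Rightarrow> nat \<Rightarrow> real" where
  "lr_norm r a n = (\<Sum>i<n. \<bar>a i\<bar> powr r) powr (1 / r)"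

definition equiv_lr :: "(real \<Rightarrow> real) \<Rightarrow> real \<Rightarrow> real \<Rightarrow> (nat \<Rightarrow> real \<Rightarrow> real) \<Rightarrow> bool" where
  "equiv_lr F r C y \<longleftrightarrow> C > 0 \<and>
     (\<forall>n a. lr_norm r a n / C \<le> lux_norm F (\<lambda>t. \<Sum>i<n. a i * y i t)
          \<and> lux_norm F (\<lambda>t. \<Sum>i<n. a i * y i t) \<le> C * lr_norm r a n)"

definition normed_disjoint_seq :: "(real \<Rightarrow> real) \<Rightarrow> (nat \<Rightarrow> real \<Rightarrow> real) \<Rightarrow> bool" where
  "normed_disjoint_seq F x \<longleftrightarrow>
     (\<forall>n. x n \<in> orlicz_space F \<and> lux_norm F (x n) = 1) \<and> disjoint_seq x"

definition DH :: "(real \<Rightarrow> real) \<Rightarrow> real \<Rightarrow> bool" where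
  "DH F r \<longleftrightarrow> (\<forall>x. normed_disjoint_seq F x \<longrightarrow>
      (\<exists>\<phi> C. strict_mono \<phi> \<and> equiv_lr F r C (x \<circ> \<phi>)))"

definition uniform_DH :: "(real \<Rightarrow> real) \<Rightarrow> real \<Rightarrow> bool" where
  "uniform_DH F r \<longleftrightarrow> (\<exists>C. \<forall>x. normed_disjoint_seq F x \<longrightarrow>
      (\<exists>\<phi>. strict_mono \<phi> \<and> equiv_lr F r C (x \<circ> \<phi>)))"

definition closed_span :: "(real \<Rightarrow> real) \<Rightarrow> (nat \<Rightarrow> real \<Rightarrow> real) \<Rightarrow> (real \<Rightarrow> real) set" where
  "closed_span F y = {f \<in> orlicz_space F. \<forall>\<epsilon>>0. \<exists>n a.
      lux_norm F (\<lambda>t. f t - (\<Sum>i<n. a i * y i t)) < \<epsilon>}"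

text \<open>S is complemented in L_F: there is a bounded linear projection of L_F onto S
  (identities understood modulo null functions, i.e. up to norm zero).\<close>
definition complemented :: "(real \<Rightarrow> real) \<Rightarrow> (real \<Rightarrow> real) set \<Rightarrow> bool" where
  "complemented F S \<longleftrightarrow> (\<exists>P K. K \<ge> 0 \<and>
      (\<forall>f \<in> orlicz_space F. P f \<in> S \<and> lux_norm F (P f) \<le> K * lux_norm F f) \<and>
      (\<forall>f \<in> orlicz_space F. \<forall>g \<in> orlicz_space F. \<forall>a b::real.
         lux_norm F (\<lambda>t. P (\<lambda>s. a * f s + b * g s) t - (a * P f t + b * P g t)) = 0) \<and>
      (\<forall>f \<in> S. lux_norm F (\<lambda>t. P f t - f t) = 0))"

definition DC :: "(real \<Rightarrow> real) \<Rightarrow> bool" where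
  "DC F \<longleftrightarrow> (\<forall>x. (\<forall>n. x n \<in> orlicz_space F) \<and> disjoint_seq x \<longrightarrow>
      (\<exists>\<phi>. strict_mono \<phi> \<and> complemented F (closed_span F (x \<circ> \<phi>))))"

text \<open>H belongs to E_{F,A}^\<infinity> (closure in C[0,1]) for every A > 0.\<close>
definition E_inf :: "(real \<Rightarrow> real) \<Rightarrow> (real \<Rightarrow> real) set" where
  "E_inf F = {H. continuous_on {0..1} H \<and>
      (\<forall>A>0. \<forall>\<epsilon>>0. \<exists>y>A. \<forall>t\<in>{0..1}. \<bar>H t - F (t * y) / F y\<bar> < \<epsilon>)}"

definition E_inf_equiv_power :: "(real \<Rightarrow> real) \<Rightarrow> real \<Rightarrow> bool" where
  "E_inf_equiv_power F p \<longleftrightarrow> (\<exists>C>0. \<forall>H\<in>E_inf F. \<forall>t\<in>{0<..1}.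
      t powr p / C \<le> H t \<and> H t \<le> C * t powr p)"

end

theory Submission
  imports Defs "HOL-Complex_Analysis.Great_Picard"
begin

text \<open>Let \<open>R\<close> be the property that, for every \<open>t \<in> (0,1]\<close>, the quotient \<open>F(ty)/F(y)\<close> lies
  between \<open>t\<^sup>p/K\<close> and \<open>K t\<^sup>p\<close> for all large \<open>y\<close>, with one constant \<open>K\<close>. Conjugation exchanges the
  upper bound for \<open>F\<close> with the lower bound for \<open>G\<close> (and \<open>p\<close> with \<open>q\<close>), and disjoint functions only
  see \<open>F\<close> near infinity, so \<open>R\<close> gives uniform power estimates for disjoint sequences in both spaces
  and a bounded projection built from biorthogonal sequences. Conversely, disjoint homogeneity already
  forces the upper bound: a sequence mixing peaks of all levels at which the bound fails is as bad as
  all of them. The upper bound for \<open>F\<close> is therefore free, and each condition only has to yield the lower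
  bound for \<open>F\<close>, that is, the upper bound for \<open>G\<close>. For \<open>DC G\<close> this uses the same mixed sequence in the
  space of \<open>G\<close>: a projection onto its span produces a dual sequence in the space of \<open>F\<close>, to which
  disjoint homogeneity of \<open>F\<close> applies.\<close>

section \<open>Orlicz functions, the modular and the Luxemburg norm\<close>

text \<open>The two bounds behave differently under mixing, and this shapes the proof. Modulars add
  up, so a peak at which \<open>F (t * y)\<close> is too large stays visible inside a function that
  gives it a small weight: constants \<open>4 ^ n\<close> against weights near
  \<open>(1/2) ^ n\<close> still leave a factor \<open>2 ^ n\<close>, and one sequence defeats every
  equivalence constant. A peak at which \<open>F (t * y)\<close> is too small is hidden by the rest
  of the function. A missing lower bound therefore has to be exposed in another way: by a constant
  known before the sequence is built, by a limit in C[0,1], or in the dual space, where it turns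
  into a missing upper bound. A second obstacle is that the thresholds for \<open>y\<close> depend
  on \<open>t\<close>, so no power inequality uniform near \<open>t = 0\<close> is available. On
  [0,1] it is recovered only up to an additive error \<delta>. Passing to a subsequence makes the
  i-th error at most \<open>(1/2) ^ (i + 1)\<close>, and the total error, at most 1, is absorbed by
  the constants.\<close>

lemma orlicz_zero: "orlicz_function F \<Longrightarrow> F 0 = 0"
  by (simp add: orlicz_function_def)

lemma orlicz_mono: "orlicz_function F \<Longrightarrow> 0 \<le> x \<Longrightarrow> x \<le> y \<Longrightarrow> F x \<le> F y"
  unfolding orlicz_function_def mono_on_def by auto

lemma orlicz_nonneg: "orlicz_function F \<Longrightarrow> 0 \<le> x \<Longrightarrow> 0 \<le> F x"
  using orlicz_mono[of F 0 x] orlicz_zero[of F] by simp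

lemma orlicz_convex:
  assumes "orlicz_function F" "0 \<le> x" "0 \<le> y" "0 \<le> u" "u \<le> 1"
  shows "F ((1 - u) * x + u * y) \<le> (1 - u) * F x + u * F y"
  using convex_onD[of "{0..}" F u x y] assms unfolding orlicz_function_def by auto

lemma orlicz_contract:
  assumes "orlicz_function F" "0 \<le> x" "0 \<le> u" "u \<le> 1"
  shows "F (u * x) \<le> u * F x"
  using orlicz_convex[of F 0 x u] orlicz_zero[of F] assms by simp

lemma orlicz_expand:
  assumes "orlicz_function F" "0 \<le> x" "1 \<le> u"
  shows "u * F x \<le> F (u * x)"
  using orlicz_contract[of F "u * x" "1 / u"] assms by (simp add: field_simps)

lemma orlicz_eventually_gt:
  assumes "orlicz_function F"
  shows "\<exists>Y. \<forall>y\<ge>Y. F y > B"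
  using assms filterlim_at_top_dense[of F at_top]
  unfolding orlicz_function_def eventually_at_top_linorder by auto

lemma orlicz_continuous:
  assumes "orlicz_function F"
  shows "continuous_on {0..} F"
proof -
  have conv: "convex_on {0<..} F"
    using assms convex_on_subset[of "{0..}" F "{0<..}"] unfolding orlicz_function_def
    by (simp add: Ioi_le_Ico)
  have pos: "isCont F x" if "x > 0" for x
    using convex_on_continuous[OF _ conv] that
    by (simp add: continuous_on_eq_continuous_at)
  \<comment> \<open>Convexity gives continuity only at interior points; at the endpoint the chord
    bound \<open>F x \<le> x * F 1\<close> squeezes \<open>F\<close> to 0.\<close>
  have zero: "(F \<longlongrightarrow> F 0) (at 0 within {0..})"
  proof -
    have "((\<lambda>x. x * F 1) \<longlongrightarrow> 0 * F 1) (at 0 within {0..})"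
      by (intro tendsto_intros)
    moreover have "\<forall>\<^sub>F x in at 0 within {0..}. 0 \<le> F x"
      using orlicz_nonneg[OF assms] by (auto simp: eventually_at_filter)
    moreover have "\<forall>\<^sub>F x in at 0 within {0..}. F x \<le> x * F 1"
      unfolding eventually_at
      using orlicz_contract[OF assms, of 1] by (intro exI[of _ 1]) auto
    ultimately have "(F \<longlongrightarrow> 0) (at 0 within {0..})"
      using tendsto_sandwich[of "\<lambda>_. 0" F "at 0 within {0..}" "\<lambda>x. x * F 1" 0] by simp
    then show ?thesis using orlicz_zero[OF assms] by simp
  qed
  show ?thesis
    unfolding continuous_on_eq_continuous_within continuous_within
  proof
    fix x :: real assume "x \<in> {0..}"
    show "(F \<longlongrightarrow> F x) (at x within {0..})"
    proof (cases "x = 0")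
      case False
      then have "x > 0" using \<open>x \<in> {0..}\<close> by auto
      from pos[OF this] show ?thesis by (auto simp: isCont_def intro: tendsto_within_subset)
    qed (use zero in simp)
  qed
qed

lemma orlicz_continuous_abs:
  assumes "orlicz_function F"
  shows "continuous_on UNIV (\<lambda>x. F \<bar>x\<bar>)"
  by (rule continuous_on_compose2[OF orlicz_continuous[OF assms]]) (auto intro!: continuous_intros)

lemma orlicz_measurable:
  assumes "orlicz_function F" "f \<in> borel_measurable M"
  shows "(\<lambda>t. F \<bar>f t\<bar>) \<in> borel_measurable M"
  using measurable_compose[OF assms(2) borel_measurable_continuous_onI[OF orlicz_continuous_abs[OF assms(1)]]]
  by simp

lemma orlicz_measurable_scaled:
  assumes "orlicz_function F" "f \<in> borel_measurable M" "0 \<le> s"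
  shows "(\<lambda>t. F (s * \<bar>f t\<bar>)) \<in> borel_measurable M"
proof -
  have "(\<lambda>t. F \<bar>s * f t\<bar>) \<in> borel_measurable M"
    using assms by (intro orlicz_measurable) auto
  then show ?thesis using assms by (simp add: abs_mult)
qed

text \<open>The modular in the variable \<open>s = 1 / c\<close>. In this form \<open>s = 0\<close>
  is allowed, convexity becomes a bound linear in the contraction factor, and power estimates in
  \<open>s\<close> can be stated on all of [0,1].\<close>

definition dilated :: "(real \<Rightarrow> real) \<Rightarrow> (real \<Rightarrow> real) \<Rightarrow> real \<Rightarrow> ennreal" where
  "dilated F f s = (\<integral>\<^sup>+ t. ennreal (F (s * \<bar>f t\<bar>)) \<partial>I01)"

lemma modular_eq_dilated: "modular F f c = dilated F f (1 / c)"
  by (simp add: modular_def dilated_def)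

lemma dilated_mono:
  assumes F: "orlicz_function F" and "0 \<le> s" "s \<le> s'"
  shows "dilated F f s \<le> dilated F f s'"
  unfolding dilated_def
  using assms by (intro nn_integral_mono ennreal_leI orlicz_mono[OF F] mult_right_mono) auto

lemma dilated_zero: "orlicz_function F \<Longrightarrow> dilated F f 0 = 0"
  by (simp add: dilated_def orlicz_zero)

lemma dilated_contract:
  assumes F: "orlicz_function F" and f: "f \<in> borel_measurable I01"
    and "0 \<le> u" "u \<le> 1" "0 \<le> s"
  shows "dilated F f (u * s) \<le> ennreal u * dilated F f s"
proof -
  have "dilated F f (u * s) \<le> (\<integral>\<^sup>+ t. ennreal u * ennreal (F (s * \<bar>f t\<bar>)) \<partial>I01)"
    unfolding dilated_def
  proof (rule nn_integral_mono)
    fix t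
    have "F (u * s * \<bar>f t\<bar>) \<le> u * F (s * \<bar>f t\<bar>)"
      using orlicz_contract[OF F, of "s * \<bar>f t\<bar>" u] assms by (simp add: mult.assoc)
    then have "ennreal (F (u * s * \<bar>f t\<bar>)) \<le> ennreal (u * F (s * \<bar>f t\<bar>))"
      by (rule ennreal_leI)
    also have "\<dots> = ennreal u * ennreal (F (s * \<bar>f t\<bar>))"
      using assms by (intro ennreal_mult orlicz_nonneg[OF F]) auto
    finally show "ennreal (F (u * s * \<bar>f t\<bar>)) \<le> ennreal u * ennreal (F (s * \<bar>f t\<bar>))" .
  qed
  also have "\<dots> = ennreal u * dilated F f s"
    unfolding dilated_def
    using orlicz_measurable_scaled[OF F f \<open>0 \<le> s\<close>] by (simp add: nn_integral_cmult)
  finally show ?thesis .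
qed

lemma modular_antimono:
  assumes "orlicz_function F" "0 < c" "c \<le> d"
  shows "modular F f d \<le> modular F f c"
  unfolding modular_eq_dilated using assms by (intro dilated_mono) (auto simp: frac_le)

text \<open>Contracting by \<open>1 / D\<close> divides the modular by at least \<open>D\<close>, by
  convexity and \<open>F 0 = 0\<close>. This is how a constant bound on a modular becomes a norm
  bound.\<close>

lemma modular_shrink:
  assumes F: "orlicz_function F" and f: "f \<in> borel_measurable I01"
    and "0 < c" "1 \<le> D" "modular F f c \<le> ennreal D"
  shows "modular F f (D * c) \<le> 1"
proof -
  have "modular F f (D * c) = dilated F f ((1/D) * (1/c))"
    using assms by (simp add: modular_eq_dilated)
  also have "\<dots> \<le> ennreal (1/D) * dilated F f (1/c)"
    using assms by (intro dilated_contract) auto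
  also have "\<dots> \<le> ennreal (1/D) * ennreal D"
    using assms by (intro mult_left_mono) (auto simp: modular_eq_dilated)
  also have "\<dots> = 1" using assms by (simp flip: ennreal_mult)
  finally show ?thesis .
qed

section \<open>The Orlicz space and its norm\<close>

lemma orlicz_space_measurable: "f \<in> orlicz_space F \<Longrightarrow> f \<in> borel_measurable I01"
  by (simp add: orlicz_space_def)

lemma orlicz_spaceI:
  "f \<in> borel_measurable I01 \<Longrightarrow> c > 0 \<Longrightarrow> modular F f c \<le> 1 \<Longrightarrow> f \<in> orlicz_space F"
  unfolding orlicz_space_def
  by (auto intro!: exI[of _ c] le_less_trans[of "modular F f c" 1])

lemma orlicz_spaceE:
  assumes "orlicz_function F" "f \<in> orlicz_space F"
  obtains c where "c > 0" "modular F f c \<le> 1"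
proof -
  obtain c where c: "c > 0" "modular F f c < \<infinity>"
    using assms by (auto simp: orlicz_space_def)
  then obtain r where r: "r \<ge> 0" "modular F f c = ennreal r"
    by (metis ennreal_cases infinity_ennreal_def less_irrefl)
  have "modular F f (max 1 r * c) \<le> 1"
    using c r assms by (intro modular_shrink) (auto simp: orlicz_space_measurable intro!: ennreal_leI)
  then show ?thesis using c by (intro that[of "max 1 r * c"]) auto
qed

lemma lux_norm_le: "c > 0 \<Longrightarrow> modular F f c \<le> 1 \<Longrightarrow> lux_norm F f \<le> c"
  unfolding lux_norm_def by (rule cInf_lower) (auto intro!: bdd_belowI[of _ 0])

lemma lux_norm_ge:
  assumes "orlicz_function F" "f \<in> orlicz_space F"
    and "\<And>c. c > 0 \<Longrightarrow> modular F f c \<le> 1 \<Longrightarrow> b \<le> c"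
  shows "b \<le> lux_norm F f"
  unfolding lux_norm_def
  by (rule cInf_greatest) (use assms orlicz_spaceE[OF assms(1,2)] in auto)

lemma lux_norm_nonneg: "orlicz_function F \<Longrightarrow> f \<in> orlicz_space F \<Longrightarrow> 0 \<le> lux_norm F f"
  by (rule lux_norm_ge) auto

text \<open>The strict inequality leaves room for a witness below \<open>c\<close>, so it does not
  matter whether the infimum is attained.\<close>

lemma modular_le_one:
  assumes "orlicz_function F" "f \<in> orlicz_space F" "lux_norm F f < c"
  shows "modular F f c \<le> 1"
proof -
  have "{c. c > 0 \<and> modular F f c \<le> 1} \<noteq> {}"
    using orlicz_spaceE[OF assms(1,2)] by auto
  from cInf_lessD[OF this] assms(3) obtain d where "d > 0" "modular F f d \<le> 1" "d < c"
    unfolding lux_norm_def by auto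
  then show ?thesis using modular_antimono[OF assms(1), of d c f] by auto
qed

lemma modular_cong_AE:
  assumes "AE t in I01. f t = g t" shows "modular F f c = modular F g c"
  unfolding modular_def by (rule nn_integral_cong_AE) (use assms in auto)

lemma lux_norm_cong_AE:
  assumes "AE t in I01. f t = g t" shows "lux_norm F f = lux_norm F g"
  unfolding lux_norm_def using modular_cong_AE[OF assms] by simp

lemma modular_zero: "orlicz_function F \<Longrightarrow> modular F (\<lambda>_. 0) c = 0"
  by (simp add: modular_def orlicz_zero)

lemma zero_in_orlicz_space: "orlicz_function F \<Longrightarrow> (\<lambda>_. 0) \<in> orlicz_space F"
  by (intro orlicz_spaceI[of _ 1]) (auto simp: modular_zero)

lemma lux_norm_zero: 
  assumes "orlicz_function F" shows "lux_norm F (\<lambda>_. 0) = 0"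
proof (rule antisym)
  show "lux_norm F (\<lambda>_. 0) \<le> 0"
    by (rule field_le_epsilon) (auto intro!: lux_norm_le simp: modular_zero assms)
qed (simp add: lux_norm_nonneg assms zero_in_orlicz_space)

lemma modular_scale_mult:
  assumes "c > 0" "a \<noteq> 0" shows "modular F (\<lambda>t. a * f t) (\<bar>a\<bar> * c) = modular F f c"
  using assms by (simp add: modular_def abs_mult)

lemma orlicz_space_scale:
  assumes "orlicz_function F" "f \<in> orlicz_space F"
  shows "(\<lambda>t. a * f t) \<in> orlicz_space F"
proof (cases "a = 0")
  case False
  obtain c where "c > 0" "modular F f c \<le> 1" using orlicz_spaceE[OF assms] .
  then show ?thesis
    using False assms modular_scale_mult[of c a F f]
    by (intro orlicz_spaceI[of _ "\<bar>a\<bar> * c"] borel_measurable_times)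
       (auto simp: orlicz_space_measurable)
qed (use assms zero_in_orlicz_space in auto)

lemma lux_norm_scale:
  assumes F: "orlicz_function F" and f: "f \<in> orlicz_space F"
  shows "lux_norm F (\<lambda>t. a * f t) = \<bar>a\<bar> * lux_norm F f"
proof -
  have le: "lux_norm F (\<lambda>t. b * g t) \<le> \<bar>b\<bar> * lux_norm F g" if g: "g \<in> orlicz_space F" and b: "b \<noteq> 0" for b g
  proof -
    have "lux_norm F (\<lambda>t. b * g t) / \<bar>b\<bar> \<le> lux_norm F g"
    proof (rule lux_norm_ge[OF F g])
      fix c :: real assume "c > 0" "modular F g c \<le> 1"
      then have "lux_norm F (\<lambda>t. b * g t) \<le> \<bar>b\<bar> * c"
        using b modular_scale_mult[of c b F g] by (intro lux_norm_le) auto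
      then show "lux_norm F (\<lambda>t. b * g t) / \<bar>b\<bar> \<le> c" using b by (simp add: field_simps)
    qed
    then show ?thesis using b by (simp add: field_simps)
  qed
  show ?thesis
  proof (cases "a = 0")
    case False
    have "lux_norm F f = lux_norm F (\<lambda>t. (1/a) * (a * f t))" using False by simp
    also have "\<dots> \<le> \<bar>1/a\<bar> * lux_norm F (\<lambda>t. a * f t)"
      using False orlicz_space_scale[OF F f] by (intro le) auto
    finally have "\<bar>a\<bar> * lux_norm F f \<le> lux_norm F (\<lambda>t. a * f t)"
      using False by (simp add: field_simps)
    then show ?thesis using le[OF f False] by simp
  qed (use lux_norm_zero[OF F] in simp)
qed

lemma modular_add:
  assumes F: "orlicz_function F" and f: "f \<in> borel_measurable I01" and g: "g \<in> borel_measurable I01"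
    and c: "c > 0" "d > 0" "modular F f c \<le> 1" "modular F g d \<le> 1"
  shows "modular F (\<lambda>t. f t + g t) (c + d) \<le> 1"
proof -
  \<comment> \<open>With this weight \<open>\<bar>f t + g t\<bar> / (c + d)\<close> is at most the
    convex combination of \<open>\<bar>f t\<bar> / c\<close> and \<open>\<bar>g t\<bar> / d\<close>,
    and convexity of \<open>F\<close> applies.\<close>
  define u where "u = d / (c + d)"
  have u: "0 \<le> u" "u \<le> 1" "1 - u = c / (c + d)" using c by (auto simp: u_def field_simps)
  have pt: "F (\<bar>f t + g t\<bar> / (c + d)) \<le> (1 - u) * F (\<bar>f t\<bar> / c) + u * F (\<bar>g t\<bar> / d)" for t
  proof -
    have "F (\<bar>f t + g t\<bar> / (c + d)) \<le> F ((1 - u) * (\<bar>f t\<bar> / c) + u * (\<bar>g t\<bar> / d))"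
    proof (rule orlicz_mono[OF F])
      have "(1 - u) * (\<bar>f t\<bar> / c) + u * (\<bar>g t\<bar> / d) = (\<bar>f t\<bar> + \<bar>g t\<bar>) / (c + d)"
        unfolding u(3) using c by (simp add: u_def add_divide_distrib)
      then show "\<bar>f t + g t\<bar> / (c + d) \<le> (1 - u) * (\<bar>f t\<bar> / c) + u * (\<bar>g t\<bar> / d)"
        using c by (simp add: divide_right_mono abs_triangle_ineq)
    qed (use c in auto)
    also have "\<dots> \<le> (1 - u) * F (\<bar>f t\<bar> / c) + u * F (\<bar>g t\<bar> / d)"
      using u c by (intro orlicz_convex[OF F]) auto
    finally show ?thesis .
  qed
  have meas: "(\<lambda>t. ennreal (F (\<bar>h t\<bar> / e))) \<in> borel_measurable I01"
    if "h \<in> borel_measurable I01" "e > 0" for h e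
    using orlicz_measurable_scaled[OF F that(1), of "1/e"] that(2) by simp
  have "modular F (\<lambda>t. f t + g t) (c + d) \<le>
      (\<integral>\<^sup>+ t. ennreal (1 - u) * ennreal (F (\<bar>f t\<bar> / c)) + ennreal u * ennreal (F (\<bar>g t\<bar> / d)) \<partial>I01)"
    unfolding modular_def
  proof (rule nn_integral_mono)
    fix t
    have "ennreal (1 - u) * ennreal (F (\<bar>f t\<bar> / c)) + ennreal u * ennreal (F (\<bar>g t\<bar> / d))
      = ennreal ((1 - u) * F (\<bar>f t\<bar> / c) + u * F (\<bar>g t\<bar> / d))"
    proof -
      have "0 \<le> F (\<bar>f t\<bar> / c)" "0 \<le> F (\<bar>g t\<bar> / d)"
        using c by (auto intro!: orlicz_nonneg[OF F])
      moreover have "0 \<le> 1 - u" using u by simp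
      ultimately show ?thesis using u(1)
        by (simp only: ennreal_mult[symmetric] ennreal_plus[symmetric] mult_nonneg_nonneg)
    qed
    then show "ennreal (F (\<bar>f t + g t\<bar> / (c + d))) \<le>
        ennreal (1 - u) * ennreal (F (\<bar>f t\<bar> / c)) + ennreal u * ennreal (F (\<bar>g t\<bar> / d))"
      using pt[of t] by (simp add: ennreal_leI)
  qed
  also have "\<dots> = ennreal (1 - u) * modular F f c + ennreal u * modular F g d"
    unfolding modular_def using meas[OF f c(1)] meas[OF g c(2)]
    by (simp add: nn_integral_add nn_integral_cmult)
  also have "\<dots> \<le> ennreal (1 - u) * 1 + ennreal u * 1"
    using c by (intro add_mono mult_left_mono) auto
  also have "\<dots> = 1" using u by (simp flip: ennreal_plus)
  finally show ?thesis .
qed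

lemma orlicz_space_add:
  assumes "orlicz_function F" "f \<in> orlicz_space F" "g \<in> orlicz_space F"
  shows "(\<lambda>t. f t + g t) \<in> orlicz_space F"
proof -
  obtain c d where "c > 0" "modular F f c \<le> 1" "d > 0" "modular F g d \<le> 1"
    using orlicz_spaceE[OF assms(1,2)] orlicz_spaceE[OF assms(1,3)] by metis
  then show ?thesis
    using assms modular_add[OF assms(1), of f g c d]
    by (intro orlicz_spaceI[of _ "c + d"] borel_measurable_add) (auto simp: orlicz_space_measurable)
qed

lemma lux_norm_triangle:
  assumes F: "orlicz_function F" and f: "f \<in> orlicz_space F" and g: "g \<in> orlicz_space F"
  shows "lux_norm F (\<lambda>t. f t + g t) \<le> lux_norm F f + lux_norm F g"
proof (rule field_le_epsilon)
  fix e :: real assume "e > 0"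
  then have "modular F f (lux_norm F f + e/2) \<le> 1" "modular F g (lux_norm F g + e/2) \<le> 1"
    by (auto intro!: modular_le_one assms)
  then have "modular F (\<lambda>t. f t + g t) ((lux_norm F f + e/2) + (lux_norm F g + e/2)) \<le> 1"
    using lux_norm_nonneg[OF F f] lux_norm_nonneg[OF F g] \<open>e > 0\<close> f g
    by (intro modular_add[OF F]) (auto simp: orlicz_space_measurable)
  then have "lux_norm F (\<lambda>t. f t + g t) \<le> (lux_norm F f + e/2) + (lux_norm F g + e/2)"
    using lux_norm_nonneg[OF F f] lux_norm_nonneg[OF F g] \<open>e > 0\<close> by (intro lux_norm_le) auto
  then show "lux_norm F (\<lambda>t. f t + g t) \<le> lux_norm F f + lux_norm F g + e" by simp
qed

lemma orlicz_space_diff: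
  assumes "orlicz_function F" "f \<in> orlicz_space F" "g \<in> orlicz_space F"
  shows "(\<lambda>t. f t - g t) \<in> orlicz_space F"
  using orlicz_space_add[OF assms(1,2) orlicz_space_scale[OF assms(1,3), of "-1"]] by simp

lemma orlicz_space_sum:
  assumes F: "orlicz_function F" and "finite T" "\<And>i. i \<in> T \<Longrightarrow> f i \<in> orlicz_space F"
  shows "(\<lambda>t. \<Sum>i\<in>T. a i * f i t) \<in> orlicz_space F"
  using assms(2,3)
proof (induction T)
  case (insert i T)
  then show ?case
    using orlicz_space_add[OF F orlicz_space_scale[OF F, of "f i" "a i"], of "\<lambda>t. \<Sum>i\<in>T. a i * f i t"]
    by simp
qed (simp add: zero_in_orlicz_space[OF F])

text \<open>\<open>F\<close> may vanish near 0, so a single vanishing modular does not force the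
  function to vanish. Norm zero makes the modular at most \<open>u\<close> at every scale and for
  every small \<open>u\<close>, hence zero at all integer scales; large scales carry any nonzero
  value into the region where \<open>F\<close> is positive.\<close>

lemma lux_norm_eq_0_AE:
  assumes F: "orlicz_function F" and f: "f \<in> orlicz_space F" and z: "lux_norm F f = 0"
  shows "AE t in I01. f t = 0"
proof -
  note fm = orlicz_space_measurable[OF f]
  have small: "dilated F f s \<le> ennreal u" if "s > 0" "0 < u" "u \<le> 1" for s u
  proof -
    have "modular F f (u / s) \<le> 1" using that z by (intro modular_le_one[OF F f]) auto
    then have "dilated F f (s / u) \<le> 1" by (simp add: modular_eq_dilated)
    moreover have "dilated F f (u * (s / u)) \<le> ennreal u * dilated F f (s / u)"
      using that by (intro dilated_contract[OF F fm]) auto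
    moreover have "ennreal u * dilated F f (s / u) \<le> ennreal u * 1"
      using calculation(1) by (intro mult_left_mono) auto
    ultimately show ?thesis using that by (simp add: order_trans)
  qed
  have "dilated F f (real n + 1) = 0" for n
  proof (rule ccontr)
    assume ne: "dilated F f (real n + 1) \<noteq> 0"
    have "dilated F f (real n + 1) \<le> ennreal 1" by (rule small) auto
    then obtain r where r: "r \<ge> 0" "dilated F f (real n + 1) = ennreal r"
      by (cases "dilated F f (real n + 1)") (auto simp: top_unique)
    then have "r > 0" using ne by (cases "r = 0") auto
    then have "dilated F f (real n + 1) \<le> ennreal (min 1 (r / 2))" by (intro small) auto
    then have "r \<le> min 1 (r / 2)" using r \<open>r > 0\<close> by (simp add: ennreal_le_iff)
    then show False using \<open>r > 0\<close> by simp
  qed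
  then have zero: "(\<integral>\<^sup>+ t. ennreal (F ((real n + 1) * \<bar>f t\<bar>)) \<partial>I01) = 0" for n
    unfolding dilated_def .
  have "AE t in I01. ennreal (F ((real n + 1) * \<bar>f t\<bar>)) = 0" for n
    using orlicz_measurable_scaled[OF F fm, of "real n + 1"] zero[of n]
    by (subst nn_integral_0_iff_AE[symmetric]) auto
  then have "AE t in I01. \<forall>n. ennreal (F ((real n + 1) * \<bar>f t\<bar>)) = 0"
    unfolding AE_all_countable by blast
  then show ?thesis
  proof eventually_elim
    fix t assume t: "\<forall>n. ennreal (F ((real n + 1) * \<bar>f t\<bar>)) = 0"
    show "f t = 0"
    proof (rule ccontr)
      assume ne: "f t \<noteq> 0"
      obtain Y where Y: "\<And>y. y \<ge> Y \<Longrightarrow> F y > 0" using orlicz_eventually_gt[OF F, of 0] by blast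
      obtain n :: nat where n: "Y / \<bar>f t\<bar> < real n" using reals_Archimedean2 by blast
      then have "Y \<le> (real n + 1) * \<bar>f t\<bar>" using ne by (simp add: field_simps)
      then have "F ((real n + 1) * \<bar>f t\<bar>) > 0" by (rule Y)
      then show False using t by (metis ennreal_eq_0_iff leD)
    qed
  qed
qed

section \<open>Young conjugation\<close>

lemma young_ineq:
  assumes "orlicz_function F" "orlicz_function G" "young_conjugate F G" "0 \<le> t" "0 \<le> u"
  shows "t * u \<le> F t + G u"
proof (cases "t = 0")
  case True
  then show ?thesis using assms by (simp add: orlicz_zero orlicz_nonneg)
next
  case False
  then have "u * t - F t \<le> Sup {u * t - F t | t. t > 0}"
    using assms unfolding young_conjugate_def by (intro cSup_upper) auto
  also have "\<dots> = G u" using assms by (auto simp: young_conjugate_def)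
  finally show ?thesis by (simp add: mult.commute)
qed

lemma young_least:
  assumes "young_conjugate F G" "0 \<le> u" "\<And>t. t > 0 \<Longrightarrow> u * t - F t \<le> b"
  shows "G u \<le> b"
proof -
  have "{u * t - F t | t. t > 0} \<noteq> {}" using zero_less_one by blast
  then have "Sup {u * t - F t | t. t > 0} \<le> b" by (rule cSup_least) (use assms in auto)
  then show ?thesis using assms by (simp add: young_conjugate_def)
qed

text \<open>This replaces a measurable selection of subgradients: \<open>G u / u\<close> satisfies both halves of the
  equality case of Young's inequality up to the factor 2.\<close>

lemma conjugate_ratio_le:
  assumes G: "orlicz_function G" and GF: "young_conjugate G F" and u: "u > 0"
  shows "F (G u / u) \<le> G u"
proof (rule young_least[OF GF])
  show "0 \<le> G u / u" using orlicz_nonneg[OF G] u by simp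
  fix t :: real assume t: "t > 0"
  \<comment> \<open>For \<open>t \<le> u\<close> the linear term is at most \<open>G u\<close>; for
    \<open>t > u\<close> convexity gives \<open>G t \<ge> t / u * G u\<close>, so the difference is
    at most 0.\<close>
  show "G u / u * t - G t \<le> G u"
  proof (cases "t \<le> u")
    case True
    then have "G u * t \<le> G u * u" using orlicz_nonneg[OF G, of u] u by (intro mult_left_mono) auto
    moreover have "0 \<le> u * G t" using orlicz_nonneg[OF G, of t] t u by simp
    ultimately show ?thesis using u by (simp add: field_simps)
  next
    case False
    then have "t / u * G u \<le> G (t / u * u)" using u by (intro orlicz_expand[OF G]) auto
    moreover have "0 \<le> u * G u" using orlicz_nonneg[OF G, of u] u by simp
    ultimately show ?thesis using u by (simp add: field_simps)
  qed
qed

text \<open>Young's inequality is applied to \<open>w / c\<close> and \<open>u / d\<close> and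
  integrated; the 2 is the sum of two modulars at most 1. A bound in terms of witnesses
  \<open>c\<close>, \<open>d\<close> instead of norms avoids the question whether the infima are
  attained.\<close>

lemma orlicz_holder:
  assumes F: "orlicz_function F" and G: "orlicz_function G" and FG: "young_conjugate F G"
    and w: "w \<in> borel_measurable I01" and u: "u \<in> borel_measurable I01"
    and cd: "c > 0" "d > 0" "modular F w c \<le> 1" "modular G u d \<le> 1"
  shows "integrable I01 (\<lambda>t. w t * u t)" "\<bar>\<integral>t. w t * u t \<partial>I01\<bar> \<le> 2 * c * d"
proof -
  have meas: "(\<lambda>t. w t * u t) \<in> borel_measurable I01"
    using w u by simp
  have m1: "(\<lambda>t. ennreal (F (\<bar>w t\<bar> / c))) \<in> borel_measurable I01"
    using orlicz_measurable_scaled[OF F w, of "1/c"] cd by simp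
  have m2: "(\<lambda>t. ennreal (G (\<bar>u t\<bar> / d))) \<in> borel_measurable I01"
    using orlicz_measurable_scaled[OF G u, of "1/d"] cd by simp
  have "(\<integral>\<^sup>+ t. ennreal (norm (w t * u t)) \<partial>I01)
      \<le> (\<integral>\<^sup>+ t. ennreal (c * d) * (ennreal (F (\<bar>w t\<bar> / c)) + ennreal (G (\<bar>u t\<bar> / d))) \<partial>I01)"
  proof (rule nn_integral_mono)
    fix t
    have nn: "0 \<le> F (\<bar>w t\<bar> / c)" "0 \<le> G (\<bar>u t\<bar> / d)"
      using cd by (auto intro!: orlicz_nonneg[OF F] orlicz_nonneg[OF G])
    have "(\<bar>w t\<bar> / c) * (\<bar>u t\<bar> / d) \<le> F (\<bar>w t\<bar> / c) + G (\<bar>u t\<bar> / d)"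
      using cd by (intro young_ineq[OF F G FG]) auto
    then have "c * d * ((\<bar>w t\<bar> / c) * (\<bar>u t\<bar> / d)) \<le> c * d * (F (\<bar>w t\<bar> / c) + G (\<bar>u t\<bar> / d))"
      using cd by (intro mult_left_mono) auto
    then have "norm (w t * u t) \<le> c * d * (F (\<bar>w t\<bar> / c) + G (\<bar>u t\<bar> / d))"
      using cd by (simp add: abs_mult)
    then have "ennreal (norm (w t * u t)) \<le> ennreal (c * d * (F (\<bar>w t\<bar> / c) + G (\<bar>u t\<bar> / d)))"
      by (rule ennreal_leI)
    also have "\<dots> = ennreal (c * d) * (ennreal (F (\<bar>w t\<bar> / c)) + ennreal (G (\<bar>u t\<bar> / d)))"
      using nn cd by (simp only: ennreal_mult ennreal_plus add_nonneg_nonneg mult_nonneg_nonneg less_imp_le)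
    finally show "ennreal (norm (w t * u t)) \<le>
        ennreal (c * d) * (ennreal (F (\<bar>w t\<bar> / c)) + ennreal (G (\<bar>u t\<bar> / d)))" .
  qed
  also have "\<dots> = ennreal (c * d) * (modular F w c + modular G u d)"
    using m1 m2 by (simp add: modular_def nn_integral_cmult nn_integral_add)
  also have "\<dots> \<le> ennreal (c * d) * (1 + 1)"
    using cd by (intro mult_left_mono add_mono) auto
  also have "\<dots> = ennreal (c * d) * ennreal 2" by simp
  also have "\<dots> = ennreal (c * d * 2)" using cd by (intro ennreal_mult[symmetric]) auto
  also have "c * d * 2 = 2 * c * d" by simp
  finally have le: "(\<integral>\<^sup>+ t. ennreal (norm (w t * u t)) \<partial>I01) \<le> ennreal (2 * c * d)" .
  show int: "integrable I01 (\<lambda>t. w t * u t)"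
    using meas le by (intro integrableI_bounded) (auto intro: le_less_trans)
  have "ennreal (norm (\<integral>t. w t * u t \<partial>I01)) \<le> ennreal (2 * c * d)"
    using integral_norm_bound_ennreal[OF int] le by (rule order_trans)
  then show "\<bar>\<integral>t. w t * u t \<partial>I01\<bar> \<le> 2 * c * d"
    using cd by (simp add: ennreal_le_iff)
qed

lemma orlicz_product_integrable:
  assumes "orlicz_function F" "orlicz_function G" "young_conjugate F G"
    and "w \<in> orlicz_space F" "u \<in> orlicz_space G"
  shows "integrable I01 (\<lambda>t. w t * u t)"
proof -
  obtain c d where "c > 0" "modular F w c \<le> 1" "d > 0" "modular G u d \<le> 1"
    using orlicz_spaceE[OF assms(1,4)] orlicz_spaceE[OF assms(2,5)] by metis
  then show ?thesis using assms by (intro orlicz_holder(1)[OF assms(1-3)]) (auto simp: orlicz_space_measurable)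
qed

section \<open>Asymptotic comparison of dilations with a power\<close>

text \<open>The quantifier order is essential: the threshold \<open>Y\<close> may depend on
  \<open>t\<close>, the constant \<open>K\<close> may not. No uniformity in \<open>t\<close> near 0
  is claimed.\<close>

definition power_upper :: "(real \<Rightarrow> real) \<Rightarrow> real \<Rightarrow> real \<Rightarrow> bool" where
  "power_upper F p K \<longleftrightarrow> (\<forall>t\<in>{0<..1}. \<exists>Y. \<forall>y\<ge>Y. F (t * y) \<le> K * t powr p * F y)"

definition power_lower :: "(real \<Rightarrow> real) \<Rightarrow> real \<Rightarrow> real \<Rightarrow> bool" where
  "power_lower F p K \<longleftrightarrow> (\<forall>t\<in>{0<..1}. \<exists>Y. \<forall>y\<ge>Y. t powr p * F y \<le> K * F (t * y))"

lemma power_upper_mono: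
  assumes "orlicz_function F" "power_upper F p K" "K \<le> K'"
  shows "power_upper F p K'"
  unfolding power_upper_def
proof
  fix t :: real assume t: "t \<in> {0<..1}"
  then obtain Y where Y: "\<And>y. y \<ge> Y \<Longrightarrow> F (t * y) \<le> K * t powr p * F y"
    using assms unfolding power_upper_def by meson
  show "\<exists>Y. \<forall>y\<ge>Y. F (t * y) \<le> K' * t powr p * F y"
  proof (intro exI[of _ "max 0 Y"] allI impI)
    fix y assume y: "max 0 Y \<le> y"
    have "F (t * y) \<le> K * t powr p * F y" using Y y by auto
    also have "\<dots> \<le> K' * t powr p * F y"
      using assms orlicz_nonneg[OF assms(1), of y] y by (intro mult_right_mono) auto
    finally show "F (t * y) \<le> K' * t powr p * F y" .
  qed
qed

lemma power_lower_mono: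
  assumes "orlicz_function F" "power_lower F p K" "K \<le> K'"
  shows "power_lower F p K'"
  unfolding power_lower_def
proof
  fix t :: real assume t: "t \<in> {0<..1}"
  then obtain Y where Y: "\<And>y. y \<ge> Y \<Longrightarrow> t powr p * F y \<le> K * F (t * y)"
    using assms unfolding power_lower_def by meson
  show "\<exists>Y. \<forall>y\<ge>Y. t powr p * F y \<le> K' * F (t * y)"
  proof (intro exI[of _ "max 0 Y"] allI impI)
    fix y assume y: "max 0 Y \<le> y"
    have "t powr p * F y \<le> K * F (t * y)" using Y y by auto
    also have "\<dots> \<le> K' * F (t * y)"
      using assms orlicz_nonneg[OF assms(1), of "t * y"] y t by (intro mult_right_mono) auto
    finally show "t powr p * F y \<le> K' * F (t * y)" .
  qed
qed

section \<open>Conjugation of power bounds\<close>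

lemma conjugate_exponent:
  assumes "1 < p" "1 / p + 1 / q = (1::real)"
  shows "1 < q" "q = p / (p - 1)" "p = q / (q - 1)"
proof -
  have "q \<noteq> 0" using assms by auto
  then have eq: "q + p = p * q" using assms by (simp add: field_simps)
  then have e2: "q * (p - 1) = p" by (simp add: algebra_simps)
  then have q: "q = p / (p - 1)" using assms by (simp add: field_simps)
  then show "q = p / (p - 1)" by simp
  show "1 < q" unfolding q using assms by (simp add: field_simps)
  have "p * (q - 1) = q" using eq by (simp add: algebra_simps)
  then show "p = q / (q - 1)" using \<open>1 < q\<close> by (simp add: field_simps)
qed

text \<open>If \<open>F (t * y) \<le> c * F y\<close> and \<open>c = s * t\<close>, Young's
  inequality gives \<open>c * (v * y - F y) \<le> (t * y) * (s * v) - F (t * y) \<le> G (s *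
  v)\<close>, and the supremum over \<open>y\<close> gives \<open>c * G v \<le> G (s * v)\<close>.
  The remaining work concerns the \<open>y\<close> below the threshold.\<close>

lemma power_upper_imp_conjugate_lower:
  assumes F: "orlicz_function F" and G: "orlicz_function G" and FG: "young_conjugate F G"
    and pq: "1 < p" "1 / p + 1 / q = 1" and K: "1 \<le> K" and U: "power_upper F p K"
  shows "power_lower G q (K powr (q - 1))"
  unfolding power_lower_def
proof
  fix s :: real assume s: "s \<in> {0<..1}"
  note q = conjugate_exponent[OF pq]
  \<comment> \<open>\<open>t\<close> solves \<open>K * t powr p = s * t\<close>, so \<open>c\<close>
    below is both the factor in the bound for \<open>F\<close> and the product \<open>s * t\<close>.
    Then \<open>c = K powr (1 - q) * s powr q\<close>, which explains the constant in the
    claim.\<close>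
  define t where "t = (s / K) powr (1 / (p - 1))"
  have t0: "0 < t" using s K by (simp add: t_def)
  have t1: "t \<le> 1"
    using s K pq powr_mono2[of "1 / (p - 1)" "s / K" 1] by (simp add: t_def)
  have tp: "t powr (p - 1) = s / K" using s K pq by (simp add: t_def powr_powr)
  have tq: "t powr p = (s / K) powr q" using q(2) by (simp add: t_def powr_powr)
  define c where "c = K * t powr p"
  have c0: "c > 0" using K t0 by (simp add: c_def)
  have "t powr p = t powr (p - 1) * t"
    using t0 powr_add[of t "p - 1" 1] by simp
  then have cs: "c = s * t" using K by (simp add: c_def tp)
  have "t \<in> {0<..1}" using t0 t1 by simp
  then obtain Y' where Y': "\<And>y. y \<ge> Y' \<Longrightarrow> F (t * y) \<le> K * t powr p * F y"
    using U unfolding power_upper_def by blast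
  define Y where "Y = max 1 Y'"
  define z where "z = 2 * c * Y / s"
  have z: "z > 0" "Y > 0" using c0 s by (auto simp: z_def Y_def)
  have main: "c * G v \<le> G (s * v)" if v: "v \<ge> F z / (c * Y)" "v \<ge> 0" for v
  proof -
    have "G v \<le> G (s * v) / c"
    proof (rule young_least[OF FG v(2)])
      fix y :: real assume y: "y > 0"
      have "c * (v * y - F y) \<le> G (s * v)"
      proof (cases "y \<ge> Y")
        case True
        have "(t * y) * (s * v) \<le> F (t * y) + G (s * v)"
          using t0 y s v by (intro young_ineq[OF F G FG]) auto
        moreover have "F (t * y) \<le> c * F y" using Y'[of y] True by (simp add: Y_def c_def)
        ultimately show ?thesis by (simp add: cs algebra_simps)
      next
        case False
        have "z * (s * v) \<le> F z + G (s * v)"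
          using z s v by (intro young_ineq[OF F G FG]) auto
        moreover have "z * (s * v) = 2 * (c * (v * Y))" using s by (simp add: z_def)
        moreover have "F z \<le> c * (v * Y)" using v c0 z by (simp add: field_simps)
        moreover have "c * (v * y) \<le> c * (v * Y)" using False v c0 by (intro mult_left_mono) auto
        moreover have "0 \<le> c * F y" using orlicz_nonneg[OF F, of y] y c0 by simp
        ultimately have "c * (v * y) - c * F y \<le> G (s * v)" by linarith
        then show ?thesis by (simp add: right_diff_distrib)
      qed
      then show "v * y - F y \<le> G (s * v) / c" using c0 by (simp add: field_simps)
    qed
    then show ?thesis using c0 by (simp add: field_simps)
  qed
  show "\<exists>Y. \<forall>y\<ge>Y. s powr q * G y \<le> K powr (q - 1) * G (s * y)"
  proof (intro exI[of _ "max 0 (F z / (c * Y))"] allI impI)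
    fix v assume "max 0 (F z / (c * Y)) \<le> v"
    then have "c * G v \<le> G (s * v)" by (intro main) auto
    then have "K powr (q - 1) * (c * G v) \<le> K powr (q - 1) * G (s * v)"
      by (intro mult_left_mono) auto
    moreover have "K powr (q - 1) * c = s powr q"
      using s K by (simp add: c_def tq powr_divide powr_diff field_simps)
    ultimately show "s powr q * G v \<le> K powr (q - 1) * G (s * v)"
      by (metis mult.assoc)
  qed
qed

text \<open>Substituting \<open>z = t * y\<close> in the supremum for \<open>G (s * v)\<close>, with
  \<open>c = s * t\<close> and \<open>c * F y \<le> F (t * y)\<close>, compares it with
  \<open>c * G v\<close>.\<close>

lemma power_lower_imp_conjugate_upper:
  assumes F: "orlicz_function F" and G: "orlicz_function G" and FG: "young_conjugate F G"
    and pq: "1 < p" "1 / p + 1 / q = 1" and K: "1 \<le> K" and L: "power_lower F p K"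
  shows "power_upper G q (K powr q)"
  unfolding power_upper_def
proof
  fix s :: real assume s: "s \<in> {0<..1}"
  note q = conjugate_exponent[OF pq]
  show "\<exists>Y. \<forall>y\<ge>Y. G (s * y) \<le> K powr q * s powr q * G y"
  \<comment> \<open>The \<open>t\<close> chosen below is at most 1 only if
    \<open>K * s \<le> 1\<close>; otherwise \<open>(K * s) powr q \<ge> 1\<close> and monotonicity
    suffices.\<close>
  proof (cases "K * s \<le> 1")
    case False
    show ?thesis
    proof (intro exI[of _ 0] allI impI)
      fix v :: real assume v: "0 \<le> v"
      have "G (s * v) \<le> G v" using s v by (intro orlicz_mono[OF G]) (auto simp: mult_left_le_one_le)
      moreover have "1 \<le> (K * s) powr q" using False q(1) by (intro ge_one_powr_ge_zero) auto
      then have "1 * G v \<le> (K * s) powr q * G v"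
        using orlicz_nonneg[OF G v] by (intro mult_right_mono) auto
      ultimately show "G (s * v) \<le> K powr q * s powr q * G v"
        using s K by (simp add: powr_mult)
    qed
  next
    case Ks: True
    \<comment> \<open>Solves \<open>t powr p / K = s * t\<close>. At the end \<open>c\<close> is
      replaced by the larger \<open>t powr p = (K * s) powr q\<close>, a simpler constant at the
      cost of a factor \<open>K\<close>.\<close>
    define t where "t = (K * s) powr (1 / (p - 1))"
    have t0: "0 < t" using s K by (simp add: t_def)
    have t1: "t \<le> 1"
      using s K Ks pq powr_mono2[of "1 / (p - 1)" "K * s" 1] by (simp add: t_def)
    have tp: "t powr (p - 1) = K * s" using s K pq by (simp add: t_def powr_powr)
    have tq: "t powr p = (K * s) powr q" using q(2) by (simp add: t_def powr_powr)
    define c where "c = t powr p / K"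
    have c0: "c > 0" using K t0 by (simp add: c_def)
    have "t powr p = t powr (p - 1) * t"
      using t0 powr_add[of t "p - 1" 1] by simp
    then have cs: "c = s * t" using K by (simp add: c_def tp)
    have "t \<in> {0<..1}" using t0 t1 by simp
    then obtain Y' where Y': "\<And>y. y \<ge> Y' \<Longrightarrow> t powr p * F y \<le> K * F (t * y)"
      using L unfolding power_lower_def by blast
    define Y where "Y = max 1 Y'"
    have Y: "Y > 0" by (simp add: Y_def)
    have main: "G (s * v) \<le> c * G v" if v: "v \<ge> F (2 * Y) / Y" "v \<ge> 0" for v
    proof (rule young_least[OF FG])
      show "0 \<le> s * v" using s v by simp
      fix z :: real assume z: "z > 0"
      define y where "y = z / t"
      have y: "y > 0" "z = t * y" using z t0 by (auto simp: y_def)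
      show "s * v * z - F z \<le> c * G v"
      proof (cases "y \<ge> Y")
        case True
        have "y * v \<le> F y + G v"
          using y v by (intro young_ineq[OF F G FG]) auto
        then have "c * (y * v) \<le> c * (F y + G v)" using c0 by (intro mult_left_mono) auto
        moreover have "c * F y \<le> F (t * y)" using Y'[of y] True K by (simp add: Y_def c_def field_simps)
        ultimately have "c * (y * v) - F (t * y) \<le> c * G v"
          by (simp add: distrib_left)
        moreover have "s * v * (t * y) = c * (y * v)" by (simp add: cs)
        ultimately show ?thesis unfolding y(2) by linarith
      next
        case False
        \<comment> \<open>Below the threshold \<open>v * y\<close> is dominated by
          \<open>G v\<close> itself: Young's inequality at \<open>2 * Y\<close> gives twice what is
          wanted, and for large \<open>v\<close> the excess pays for
          \<open>F (2 * Y)\<close>.\<close>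
        have "(2 * Y) * v \<le> F (2 * Y) + G v"
          using Y v by (intro young_ineq[OF F G FG]) auto
        moreover have "F (2 * Y) \<le> Y * v" using v Y by (simp add: field_simps)
        ultimately have "Y * v \<le> G v" by simp
        moreover have "y * v \<le> Y * v" using False v by (intro mult_right_mono) auto
        ultimately have "c * (y * v) \<le> c * G v" using c0 by (intro mult_left_mono) auto
        moreover have "0 \<le> F z" using orlicz_nonneg[OF F, of z] z by simp
        moreover have "s * v * z = c * (y * v)" by (simp add: cs y(2))
        ultimately show ?thesis by linarith
      qed
    qed
    show ?thesis
    proof (intro exI[of _ "max 0 (F (2 * Y) / Y)"] allI impI)
      fix v assume v: "max 0 (F (2 * Y) / Y) \<le> v"
      then have "G (s * v) \<le> c * G v" by (intro main) auto
      also have "\<dots> \<le> t powr p * G v"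
      proof (rule mult_right_mono)
        show "c \<le> t powr p" using K divide_left_mono[of 1 K "t powr p"] by (simp add: c_def)
        show "0 \<le> G v" using orlicz_nonneg[OF G] v by simp
      qed
      also have "\<dots> = K powr q * s powr q * G v" using s K by (simp add: tq powr_mult)
      finally show "G (s * v) \<le> K powr q * s powr q * G v" .
    qed
  qed
qed

section \<open>Power bounds uniform on [0,1] up to an additive error\<close>

lemma power_constant_ge_one: "1 \<le> K \<Longrightarrow> 0 \<le> p \<Longrightarrow> 1 \<le> K * 2 powr (p::real)"
  using ge_one_powr_ge_zero[of 2 p] mult_mono[of 1 K 1 "2 powr p"] by simp

text \<open>Finitely many levels have a common threshold; the finite grid is the substitute for
  uniformity in \<open>t\<close>.\<close>

lemma eventually_on_grid:
  assumes "\<forall>t\<in>{0<..1::real}. \<exists>Y::real. \<forall>y\<ge>Y. Q t y"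
  obtains Y where "Y \<ge> 1" "\<And>k y. k \<in> {1..N::nat} \<Longrightarrow> y \<ge> Y \<Longrightarrow> Q (real k / real N) y"
proof -
  have "\<forall>k\<in>{1..N}. \<exists>Y. \<forall>y\<ge>Y. Q (real k / real N) y" using assms by simp
  from bchoice[OF this] obtain Z where Z: "\<And>k y. k \<in> {1..N} \<Longrightarrow> y \<ge> Z k \<Longrightarrow> Q (real k / real N) y"
    by blast
  define Y where "Y = Max (insert 1 (Z ` {1..N}))"
  have "Y \<ge> 1" unfolding Y_def by (intro Max_ge) auto
  moreover have "Y \<ge> Z k" if "k \<in> {1..N}" for k unfolding Y_def using that by (intro Max_ge) auto
  ultimately show ?thesis using Z that by (meson order_trans)
qed

text \<open>Rounding \<open>t\<close> up to the grid at most doubles it when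
  \<open>t * N > 1\<close>, whence the factor \<open>2 powr p\<close>. For smaller \<open>t\<close>
  convexity alone gives \<open>F (t * y) \<le> t * F y\<close>, and
  \<open>t \<le> 1 / N < \<delta>\<close>.\<close>

lemma power_upper_uniform:
  assumes F: "orlicz_function F" and U: "power_upper F p K" and K: "0 \<le> K" and p: "0 \<le> p" and d: "\<delta> > 0"
  shows "\<exists>Y>0. \<forall>y\<ge>Y. \<forall>t\<in>{0..1}. F (t * y) \<le> (K * 2 powr p * t powr p + \<delta>) * F y"
proof -
  obtain N :: nat where N: "1 / \<delta> < real N" using reals_Archimedean2 by blast
  have Npos: "N > 0" using N d by (cases N) auto
  obtain Y where Y1: "Y \<ge> 1" and Yk: "\<And>k y. k \<in> {1..N} \<Longrightarrow> y \<ge> Y \<Longrightarrow>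
      F (real k / real N * y) \<le> K * (real k / real N) powr p * F y"
    using U unfolding power_upper_def by (rule eventually_on_grid[where N = N]) (rule that; assumption)
  show ?thesis
  proof (intro exI[of _ Y] conjI allI impI ballI)
    show "0 < Y" using Y1 by simp
    fix y t :: real assume y: "Y \<le> y" and t: "t \<in> {0..1}"
    have Fy: "0 \<le> F y" using y Y1 by (intro orlicz_nonneg[OF F]) auto
    show "F (t * y) \<le> (K * 2 powr p * t powr p + \<delta>) * F y"
    proof (cases "t * N \<le> 1")
      case True
      have "F (t * y) \<le> t * F y" using y Y1 t by (intro orlicz_contract[OF F]) auto
      also have "\<dots> \<le> (K * 2 powr p * t powr p + \<delta>) * F y"
      proof (rule mult_right_mono[OF _ Fy])
        have "t \<le> 1 / N" using True Npos by (simp add: field_simps)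
        also have "\<dots> < \<delta>" using N d Npos by (simp add: field_simps)
        also have "\<delta> \<le> K * 2 powr p * t powr p + \<delta>" using K by simp
        finally show "t \<le> K * 2 powr p * t powr p + \<delta>" by simp
      qed
      finally show ?thesis .
    next
      case False
      define k where "k = nat \<lceil>t * N\<rceil>"
      have "0 \<le> t * N" using t by simp
      then have k: "t * N \<le> real k" "real k < t * N + 1" unfolding k_def by linarith+
      have "t * N \<le> 1 * real N" using t by (intro mult_right_mono) auto
      then have "real k < real N + 1" using k by simp
      then have kN: "k \<in> {1..N}" using False k by (auto simp: Suc_le_eq intro!: Nat.gr0I)
      have kt: "t \<le> real k / real N" "real k / real N \<le> 2 * t"
        using k False Npos by (auto simp: field_simps)
      have "F (t * y) \<le> F (real k / real N * y)"
        using kt t y Y1 by (intro orlicz_mono[OF F] mult_right_mono) auto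
      also have "\<dots> \<le> K * (real k / real N) powr p * F y" using Yk[OF kN y] .
      also have "\<dots> \<le> (K * 2 powr p * t powr p + \<delta>) * F y"
      proof (rule mult_right_mono[OF _ Fy])
        have "(real k / real N) powr p \<le> (2 * t) powr p" using kt p by (intro powr_mono2) auto
        also have "\<dots> = 2 powr p * t powr p" using t by (simp add: powr_mult)
        finally have "K * (real k / real N) powr p \<le> K * (2 powr p * t powr p)"
          using K by (intro mult_left_mono) auto
        then show "K * (real k / real N) powr p \<le> K * 2 powr p * t powr p + \<delta>" using d by simp
      qed
      finally show ?thesis .
    qed
  qed
qed

text \<open>Here \<open>t\<close> is rounded down, losing at most a factor 2. For
  \<open>t * N \<le> 1\<close> the left side is nonpositive, because
  \<open>t powr p \<le> t < \<delta>\<close>.\<close>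

lemma power_lower_uniform:
  assumes F: "orlicz_function F" and L: "power_lower F p K" and K: "1 \<le> K" and p: "1 \<le> p" and d: "\<delta> > 0"
  shows "\<exists>Y>0. \<forall>y\<ge>Y. \<forall>t\<in>{0..1}. (t powr p / (K * 2 powr p) - \<delta>) * F y \<le> F (t * y)"
proof -
  obtain N :: nat where N: "1 / \<delta> < real N" using reals_Archimedean2 by blast
  have Npos: "N > 0" using N d by (cases N) auto
  obtain Y where Y1: "Y \<ge> 1" and Yk: "\<And>k y. k \<in> {1..N} \<Longrightarrow> y \<ge> Y \<Longrightarrow>
      (real k / real N) powr p * F y \<le> K * F (real k / real N * y)"
    using L unfolding power_lower_def by (rule eventually_on_grid[where N = N]) (rule that; assumption)
  show ?thesis
  proof (intro exI[of _ Y] conjI allI impI ballI)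
    show "0 < Y" using Y1 by simp
    fix y t :: real assume y: "Y \<le> y" and t: "t \<in> {0..1}"
    have Fy: "0 \<le> F y" using y Y1 by (intro orlicz_nonneg[OF F]) auto
    have Fty: "0 \<le> F (t * y)" using y Y1 t by (intro orlicz_nonneg[OF F]) auto
    show "(t powr p / (K * 2 powr p) - \<delta>) * F y \<le> F (t * y)"
    proof (cases "t * N \<le> 1")
      case True
      have "t powr p \<le> t"
        using t p powr_mono'[of 1 p t] by (cases "t = 0") auto
      moreover have "1 \<le> K * 2 powr p"
        using K p by (intro power_constant_ge_one) auto
      ultimately have "t powr p / (K * 2 powr p) \<le> t / 1"
        using t by (intro frac_le) auto
      also have "\<dots> \<le> 1 / N" using True Npos by (simp add: field_simps)
      also have "\<dots> < \<delta>" using N d Npos by (simp add: field_simps)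
      finally have "(t powr p / (K * 2 powr p) - \<delta>) * F y \<le> 0" using Fy by (simp add: mult_nonpos_nonneg)
      then show ?thesis using Fty by linarith
    next
      case False
      define k where "k = nat \<lfloor>t * N\<rfloor>"
      have k: "real k \<le> t * N" "t * N < real k + 1" using t by (auto simp: k_def)
      have "t * N \<le> 1 * real N" using t by (intro mult_right_mono) auto
      then have "real k \<le> real N" using k by simp
      then have kN: "k \<in> {1..N}" using False k by (auto simp: Suc_le_eq intro!: Nat.gr0I)
      have "1 \<le> real k" using kN by simp
      then have kt: "real k / real N \<le> t" "t / 2 \<le> real k / real N"
        using k Npos by (auto simp: field_simps)
      have "(t / 2) powr p * F y \<le> (real k / real N) powr p * F y"
        using kt p t Fy by (intro mult_right_mono powr_mono2) auto
      also have "\<dots> \<le> K * F (real k / real N * y)" using Yk[OF kN y] .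
      also have "\<dots> \<le> K * F (t * y)"
        using kt t y Y1 K by (intro mult_left_mono orlicz_mono[OF F] mult_right_mono) auto
      finally have "t powr p / (K * 2 powr p) * F y \<le> F (t * y)"
        using K t by (simp add: powr_divide field_simps)
      moreover have "0 \<le> \<delta> * F y" using d Fy by simp
      ultimately show ?thesis by (simp add: algebra_simps)
    qed
  qed
qed

section \<open>Disjoint sequences\<close>

lemma disjoint_seq_AE:
  assumes "disjoint_seq y"
  shows "AE t in I01. \<forall>i j. i \<noteq> j \<longrightarrow> y i t = 0 \<or> y j t = 0"
proof -
  have "AE t in I01. i \<noteq> j \<longrightarrow> y i t = 0 \<or> y j t = 0" for i j
    using assms unfolding disjoint_seq_def by (cases "i = j") auto
  then show ?thesis unfolding AE_all_countable by simp
qed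

lemma disjoint_seq_subseq: "disjoint_seq y \<Longrightarrow> inj \<phi> \<Longrightarrow> disjoint_seq (y \<circ> \<phi>)"
  unfolding disjoint_seq_def by (auto dest: injD)

lemma disjoint_suminf_eq_single:
  assumes "\<forall>i j. i \<noteq> j \<longrightarrow> y i t = 0 \<or> y j t = (0::real)"
  shows "\<exists>k. (\<forall>i. i \<noteq> k \<longrightarrow> y i t = 0) \<and> (\<forall>\<beta>. (\<Sum>i. \<beta> i * y i t) = \<beta> k * y k t)"
proof -
  obtain k where k: "\<And>i. i \<noteq> k \<Longrightarrow> y i t = 0"
    using assms by (metis (full_types))
  have "(\<Sum>i. \<beta> i * y i t) = \<beta> k * y k t" for \<beta>
    using k suminf_finite[of "{k}" "\<lambda>i. \<beta> i * y i t"] by simp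
  then show ?thesis using k by blast
qed

lemma modular_disjoint_suminf:
  assumes F: "orlicz_function F" and y: "\<And>i. y i \<in> borel_measurable I01"
    and d: "disjoint_seq y" and c: "c > 0"
  shows "modular F (\<lambda>t. \<Sum>i. a i * y i t) c = (\<Sum>i. dilated F (y i) (\<bar>a i\<bar> / c))"
proof -
  have "modular F (\<lambda>t. \<Sum>i. a i * y i t) c =
      (\<integral>\<^sup>+ t. (\<Sum>i. ennreal (F (\<bar>a i\<bar> / c * \<bar>y i t\<bar>))) \<partial>I01)"
    unfolding modular_def
  proof (rule nn_integral_cong_AE)
    show "AE t in I01. ennreal (F (\<bar>\<Sum>i. a i * y i t\<bar> / c)) =
        (\<Sum>i. ennreal (F (\<bar>a i\<bar> / c * \<bar>y i t\<bar>)))"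
      using disjoint_seq_AE[OF d]
    proof eventually_elim
      fix t assume t: "\<forall>i j. i \<noteq> j \<longrightarrow> y i t = 0 \<or> y j t = 0"
      obtain k where k: "\<And>i. i \<noteq> k \<Longrightarrow> y i t = 0" "(\<Sum>i. a i * y i t) = a k * y k t"
        using disjoint_suminf_eq_single[of y t, OF t] by blast
      have "(\<Sum>i. ennreal (F (\<bar>a i\<bar> / c * \<bar>y i t\<bar>))) = (\<Sum>i\<in>{k}. ennreal (F (\<bar>a i\<bar> / c * \<bar>y i t\<bar>)))"
        using k(1) by (intro suminf_finite) (auto simp: orlicz_zero[OF F])
      then show "ennreal (F (\<bar>\<Sum>i. a i * y i t\<bar> / c)) = (\<Sum>i. ennreal (F (\<bar>a i\<bar> / c * \<bar>y i t\<bar>)))"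
        using k(2) by (simp add: abs_mult)
    qed
  qed
  also have "\<dots> = (\<Sum>i. dilated F (y i) (\<bar>a i\<bar> / c))"
    unfolding dilated_def
  proof (rule nn_integral_suminf)
    fix i
    show "(\<lambda>t. ennreal (F (\<bar>a i\<bar> / c * \<bar>y i t\<bar>))) \<in> borel_measurable I01"
      using orlicz_measurable_scaled[OF F y, of "\<bar>a i\<bar> / c" i] c by simp
  qed
  finally show ?thesis .
qed

lemma modular_disjoint_sum:
  assumes F: "orlicz_function F" and y: "\<And>i. y i \<in> borel_measurable I01"
    and T: "finite T" and d: "disjoint_seq y" and c: "c > 0"
  shows "modular F (\<lambda>t. \<Sum>i\<in>T. a i * y i t) c = (\<Sum>i\<in>T. dilated F (y i) (\<bar>a i\<bar> / c))"
proof -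
  define b where "b i = (if i \<in> T then a i else 0)" for i
  have "(\<Sum>i\<in>T. a i * y i t) = (\<Sum>i. b i * y i t)" for t
    using suminf_finite[OF T, of "\<lambda>i. b i * y i t"] by (simp add: b_def)
  then have "modular F (\<lambda>t. \<Sum>i\<in>T. a i * y i t) c = (\<Sum>i. dilated F (y i) (\<bar>b i\<bar> / c))"
    using modular_disjoint_suminf[OF F y d c] by simp
  also have "\<dots> = (\<Sum>i\<in>T. dilated F (y i) (\<bar>b i\<bar> / c))"
    using T by (intro suminf_finite) (auto simp: b_def dilated_zero[OF F])
  finally show ?thesis by (simp add: b_def)
qed

section \<open>Supports of disjoint functions\<close>

lemma emeasure_I01: "emeasure I01 A = ennreal (measure I01 A)"
  by (intro finite_measure.emeasure_eq_measure finite_measure_lebesgue_on) simp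

text \<open>Almost disjoint subsets of a space of measure 1 have summable measures.\<close>

lemma support_measure_tendsto_zero:
  assumes y: "\<And>i. y i \<in> borel_measurable I01" and d: "disjoint_seq y"
  shows "(\<lambda>i. measure I01 {t \<in> space I01. y i t \<noteq> 0}) \<longlonglongrightarrow> 0"
proof (rule summable_LIMSEQ_zero, rule summableI_nonneg_bounded)
  fix n
  define D where "D i = {t \<in> space I01. y i t \<noteq> 0}" for i
  have D: "D i \<in> sets I01" for i
    unfolding D_def using y[of i] by measurable
  have "ennreal (\<Sum>i<n. measure I01 (D i)) = (\<Sum>i<n. emeasure I01 (D i))"
    unfolding emeasure_I01 by (intro sum_ennreal[symmetric]) simp
  also have "\<dots> = (\<integral>\<^sup>+ t. (\<Sum>i<n. indicator (D i) t) \<partial>I01)"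
    using D by (simp add: nn_integral_sum)
  also have "\<dots> \<le> (\<integral>\<^sup>+ t. 1 \<partial>I01)"
  proof (rule nn_integral_mono_AE)
    show "AE t in I01. (\<Sum>i<n. indicator (D i) t) \<le> (1::ennreal)"
      using disjoint_seq_AE[OF d]
    proof eventually_elim
      fix t assume t: "\<forall>i j. i \<noteq> j \<longrightarrow> y i t = 0 \<or> y j t = 0"
      show "(\<Sum>i<n. indicator (D i) t) \<le> (1::ennreal)"
      proof (cases "\<exists>k<n. t \<in> D k")
        case True
        then obtain k where k: "k < n" "t \<in> D k" by blast
        have "(\<Sum>i<n. indicator (D i) t) = (\<Sum>i\<in>{k}. indicator (D i) t :: ennreal)"
          using k t by (intro sum.mono_neutral_right) (auto simp: D_def indicator_def)
        also have "\<dots> = 1" using k by simp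
        finally show ?thesis by simp
      next
        case False
        then show ?thesis by (simp add: indicator_def)
      qed
    qed
  qed
  also have "\<dots> = ennreal 1" by (simp add: emeasure_restrict_space)
  finally show "(\<Sum>i<n. measure I01 {t \<in> space I01. y i t \<noteq> 0}) \<le> 1"
    unfolding D_def by (simp add: ennreal_le_iff)
qed simp

text \<open>Disjoint functions concentrate their modular where they are large, so the pointwise
  asymptotics of \<open>F\<close> pass to their dilated modulars.\<close>

lemma nn_integral_le_small_support:
  fixes f g y :: "real \<Rightarrow> real"
  assumes y: "y \<in> borel_measurable I01" and gm: "(\<lambda>t. g \<bar>y t\<bar>) \<in> borel_measurable I01"
    and B: "B \<ge> 0" "B * measure I01 {t \<in> space I01. y t \<noteq> 0} \<le> \<delta>"
    and g: "\<And>x. 0 \<le> x \<Longrightarrow> 0 \<le> g x" and z: "f 0 \<le> g 0" and le: "\<And>x. 0 < x \<Longrightarrow> f x \<le> g x + B"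
  shows "(\<integral>\<^sup>+ t. ennreal (f \<bar>y t\<bar>) \<partial>I01) \<le> (\<integral>\<^sup>+ t. ennreal (g \<bar>y t\<bar>) \<partial>I01) + ennreal \<delta>"
proof -
  define D where "D = {t \<in> space I01. y t \<noteq> 0}"
  have D: "D \<in> sets I01" unfolding D_def using y by measurable
  have "(\<integral>\<^sup>+ t. ennreal (f \<bar>y t\<bar>) \<partial>I01) \<le>
      (\<integral>\<^sup>+ t. ennreal (g \<bar>y t\<bar>) + ennreal B * indicator D t \<partial>I01)"
  proof (rule nn_integral_mono)
    fix t assume t: "t \<in> space I01"
    have g0: "0 \<le> g \<bar>y t\<bar>" using g by simp
    have "ennreal (f \<bar>y t\<bar>) \<le> ennreal (g \<bar>y t\<bar> + B * indicator D t)"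
      using t z le by (intro ennreal_leI) (auto simp: D_def indicator_def)
    then show "ennreal (f \<bar>y t\<bar>) \<le> ennreal (g \<bar>y t\<bar>) + ennreal B * indicator D t"
      using g0 B by (cases "t \<in> D") simp_all
  qed
  also have "\<dots> = (\<integral>\<^sup>+ t. ennreal (g \<bar>y t\<bar>) \<partial>I01) + ennreal (B * measure I01 D)"
    using D gm B by (simp add: nn_integral_add nn_integral_cmult emeasure_I01 ennreal_mult)
  also have "\<dots> \<le> (\<integral>\<^sup>+ t. ennreal (g \<bar>y t\<bar>) \<partial>I01) + ennreal \<delta>"
    using B(2) by (intro add_left_mono ennreal_leI) (simp add: D_def)
  finally show ?thesis .
qed

lemma eventually_small_support:
  assumes y: "\<And>i. y i \<in> borel_measurable I01" and d: "disjoint_seq y" and \<delta>: "\<delta> > 0"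
  shows "\<forall>\<^sub>F i in sequentially. B * measure I01 {t \<in> space I01. y i t \<noteq> 0} \<le> \<delta>"
proof -
  have "(\<lambda>i. B * measure I01 {t \<in> space I01. y i t \<noteq> 0}) \<longlonglongrightarrow> B * 0"
    by (intro tendsto_mult tendsto_const support_measure_tendsto_zero[OF y d])
  then have "\<forall>\<^sub>F i in sequentially. B * measure I01 {t \<in> space I01. y i t \<noteq> 0} < \<delta>"
    using \<delta> by (intro order_tendstoD) auto
  then show ?thesis by eventually_elim simp
qed

lemma nn_integral_orlicz_cmult:
  assumes "orlicz_function F" "y \<in> borel_measurable I01" "0 \<le> c"
  shows "(\<integral>\<^sup>+ t. ennreal (c * F \<bar>y t\<bar>) \<partial>I01) = ennreal c * modular F y 1"
  using assms orlicz_measurable[OF assms(1,2)]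
  by (simp add: modular_def nn_integral_cmult ennreal_mult orlicz_nonneg[OF assms(1)])

text \<open>One half of \<delta> pays for the uniform power estimate where the function is at least
  \<open>Y\<close>, the other half for the smaller values, which contribute at most
  \<open>F Y\<close> times the measure of the support. The set of good indices does not depend on
  \<open>s\<close>.\<close>

lemma eventually_dilated_le:
  assumes F: "orlicz_function F" and U: "power_upper F p K" and K: "0 \<le> K" and p: "0 \<le> p"
    and y: "\<And>i. y i \<in> borel_measurable I01" and d: "disjoint_seq y"
    and mod: "\<And>i. modular F (y i) 1 \<le> 1" and \<delta>: "\<delta> > 0"
  shows "\<forall>\<^sub>F i in sequentially. \<forall>s\<in>{0..1}. dilated F (y i) s \<le> ennreal (K * 2 powr p * s powr p + \<delta>)"
proof -
  obtain Y where Y: "Y > 0" "\<And>x t. x \<ge> Y \<Longrightarrow> t \<in> {0..1} \<Longrightarrow>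
      F (t * x) \<le> (K * 2 powr p * t powr p + \<delta>/2) * F x"
    using power_upper_uniform[OF F U K p, of "\<delta>/2"] \<delta> by auto
  have FY: "0 \<le> F Y" using Y by (intro orlicz_nonneg[OF F]) auto
  have "\<delta>/2 > 0" using \<delta> by simp
  from eventually_small_support[OF y d this, of "F Y"] show ?thesis
  proof (eventually_elim, intro ballI)
    fix i and s :: real
    assume i: "F Y * measure I01 {t \<in> space I01. y i t \<noteq> 0} \<le> \<delta>/2" and s: "s \<in> {0..1}"
    define c where "c = K * 2 powr p * s powr p + \<delta>/2"
    have c: "c \<ge> 0" using K \<delta> by (simp add: c_def)
    have "dilated F (y i) s \<le> (\<integral>\<^sup>+ t. ennreal (c * F \<bar>y i t\<bar>) \<partial>I01) + ennreal (\<delta>/2)"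
      unfolding dilated_def
    proof (rule nn_integral_le_small_support[OF y _ FY i, where f = "\<lambda>x. F (s * x)" and g = "\<lambda>x. c * F x"])
      show "(\<lambda>t. c * F \<bar>y i t\<bar>) \<in> borel_measurable I01" using orlicz_measurable[OF F y] by simp
      show "0 \<le> c * F x" if "0 \<le> x" for x using c orlicz_nonneg[OF F that] by simp
      show "F (s * 0) \<le> c * F 0" by (simp add: orlicz_zero[OF F])
      fix x :: real assume x: "0 < x"
      show "F (s * x) \<le> c * F x + F Y"
      proof (cases "x \<ge> Y")
        case True
        then show ?thesis using Y(2)[OF True s] FY by (simp add: c_def)
      next
        case False
        have "s * x \<le> 1 * x" using s x by (intro mult_right_mono) auto
        then have "s * x \<le> Y" using False by simp
        then have "F (s * x) \<le> F Y" using s x by (intro orlicz_mono[OF F]) auto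
        moreover have "0 \<le> c * F x" using c orlicz_nonneg[OF F, of x] x by simp
        ultimately show ?thesis by simp
      qed
    qed
    also have "\<dots> \<le> ennreal c * 1 + ennreal (\<delta>/2)"
      unfolding nn_integral_orlicz_cmult[OF F y c] by (intro add_right_mono mult_left_mono mod) simp
    also have "\<dots> = ennreal (K * 2 powr p * s powr p + \<delta>)"
      using c \<delta> by (simp add: c_def flip: ennreal_plus)
    finally show "dilated F (y i) s \<le> ennreal (K * 2 powr p * s powr p + \<delta>)" .
  qed
qed

text \<open>The same splitting of \<delta>, now with modular exactly 1, since the lower estimate is
  a multiple of the modular.\<close>

lemma eventually_dilated_ge:
  assumes F: "orlicz_function F" and L: "power_lower F p K" and K: "1 \<le> K" and p: "1 \<le> p"
    and y: "\<And>i. y i \<in> borel_measurable I01" and d: "disjoint_seq y"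
    and mod: "\<And>i. modular F (y i) 1 = 1" and \<delta>: "\<delta> > 0"
  shows "\<forall>\<^sub>F i in sequentially. \<forall>s\<in>{0..1}. ennreal (s powr p / (K * 2 powr p) - \<delta>) \<le> dilated F (y i) s"
proof -
  obtain Y where Y: "Y > 0" "\<And>x t. x \<ge> Y \<Longrightarrow> t \<in> {0..1} \<Longrightarrow>
      (t powr p / (K * 2 powr p) - \<delta>/2) * F x \<le> F (t * x)"
    using power_lower_uniform[OF F L K p, of "\<delta>/2"] \<delta> by auto
  have FY: "0 \<le> F Y" using Y by (intro orlicz_nonneg[OF F]) auto
  have "\<delta>/2 > 0" using \<delta> by simp
  from eventually_small_support[OF y d this, of "F Y"] show ?thesis
  proof (eventually_elim, intro ballI)
    fix i and s :: real
    assume i: "F Y * measure I01 {t \<in> space I01. y i t \<noteq> 0} \<le> \<delta>/2" and s: "s \<in> {0..1}"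
    define c where "c = s powr p / (K * 2 powr p) - \<delta>/2"
    show "ennreal (s powr p / (K * 2 powr p) - \<delta>) \<le> dilated F (y i) s"
    \<comment> \<open>For \<open>c \<le> 0\<close> the claimed bound is negative and
      \<open>ennreal\<close> truncates it to 0.\<close>
    proof (cases "c \<le> 0")
      case True
      then have "ennreal (s powr p / (K * 2 powr p) - \<delta>) = 0" using \<delta> unfolding c_def by (intro ennreal_neg) linarith
      then show ?thesis by simp
    next
      case False
      then have c: "0 \<le> c" by simp
      have "s powr p \<le> 1" using s p powr_mono2[of p s 1] by simp
      then have "s powr p / (K * 2 powr p) \<le> 1" using power_constant_ge_one[of K p] K p by simp
      \<comment> \<open>This lets \<open>F Y\<close> pay for \<open>c * F x\<close> at the values
        \<open>x < Y\<close>.\<close>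
      then have c1: "c \<le> 1" using \<delta> by (simp add: c_def)
      have "ennreal c = (\<integral>\<^sup>+ t. ennreal (c * F \<bar>y i t\<bar>) \<partial>I01)"
        unfolding nn_integral_orlicz_cmult[OF F y c] by (simp add: mod)
      also have "\<dots> \<le> (\<integral>\<^sup>+ t. ennreal (F (s * \<bar>y i t\<bar>)) \<partial>I01) + ennreal (\<delta>/2)"
      proof (rule nn_integral_le_small_support[OF y _ FY i, where f = "\<lambda>x. c * F x" and g = "\<lambda>x. F (s * x)"])
        show "(\<lambda>t. F (s * \<bar>y i t\<bar>)) \<in> borel_measurable I01" using orlicz_measurable_scaled[OF F y] s by simp
        show "0 \<le> F (s * x)" if "0 \<le> x" for x using s that by (intro orlicz_nonneg[OF F]) auto
        show "c * F 0 \<le> F (s * 0)" by (simp add: orlicz_zero[OF F])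
        fix x :: real assume x: "0 < x"
        show "c * F x \<le> F (s * x) + F Y"
        proof (cases "x \<ge> Y")
          case True
          then show ?thesis using Y(2)[OF True s] FY by (simp add: c_def)
        next
          case False
          have "c * F x \<le> 1 * F x" using c1 orlicz_nonneg[OF F, of x] x by (intro mult_right_mono) auto
          moreover have "F x \<le> F Y" using x False by (intro orlicz_mono[OF F]) auto
          moreover have "0 \<le> F (s * x)" using s x by (intro orlicz_nonneg[OF F]) auto
          ultimately show ?thesis by simp
        qed
      qed
      finally have "ennreal c - ennreal (\<delta>/2) \<le> dilated F (y i) s"
        by (simp add: dilated_def ennreal_minus_le_iff add.commute)
      then show ?thesis using c \<delta> by (simp add: ennreal_minus c_def)
    qed
  qed
qed

text \<open>Each \<open>Q k\<close> concerns a single index, so it suffices that the k-th term lies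
  beyond the k-th threshold.\<close>

lemma eventually_diagonal_subseq:
  assumes "\<And>k. \<forall>\<^sub>F n in sequentially. Q k n"
  shows "\<exists>\<phi>::nat \<Rightarrow> nat. strict_mono \<phi> \<and> (\<forall>k. Q k (\<phi> k))"
proof -
  have "\<forall>k. \<exists>N. \<forall>n\<ge>N. Q k n" using assms by (simp add: eventually_sequentially)
  from choice[OF this] obtain N where N: "\<And>k n. n \<ge> N k \<Longrightarrow> Q k n" by blast
  \<comment> \<open>The sum is at least \<open>N k\<close>, and the summand \<open>k\<close> makes
    the sequence strictly increasing.\<close>
  define \<phi> where "\<phi> k = (\<Sum>j\<le>k. N j) + k" for k
  have "strict_mono \<phi>" unfolding strict_mono_Suc_iff by (simp add: \<phi>_def)
  moreover have "N k \<le> \<phi> k" for k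
    using member_le_sum[of k "{..k}" N] by (simp add: \<phi>_def)
  ultimately show ?thesis using N by blast
qed

section \<open>Norm-one functions have modular one under the doubling condition\<close>

text \<open>The case \<open>t = 1/2\<close> at the argument \<open>2 * y\<close> is the doubling
  condition at infinity.\<close>

lemma power_lower_doubling:
  assumes F: "orlicz_function F" and L: "power_lower F p K"
  shows "\<exists>B. \<exists>Y>0. \<forall>y\<ge>Y. F (2 * y) \<le> B * F y"
proof -
  have "(1/2::real) \<in> {0<..1}" by simp
  then obtain Y where Y: "\<And>y. y \<ge> Y \<Longrightarrow> (1/2) powr p * F y \<le> K * F (1/2 * y)"
    using L unfolding power_lower_def by blast
  show ?thesis
  proof (rule exI[of _ "K / (1/2) powr p"], rule exI[of _ "max 1 Y"], intro conjI allI impI)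
    fix y assume "max 1 Y \<le> y"
    then have "(1/2) powr p * F (2 * y) \<le> K * F (1/2 * (2 * y))" by (intro Y) auto
    then show "F (2 * y) \<le> K / (1/2) powr p * F y" by (simp add: field_simps)
  qed simp
qed

text \<open>The scales \<open>1 / c n\<close> lie above the norm and decrease to 1; continuity of
  \<open>F\<close> and monotone convergence carry the bound to the limit.\<close>

lemma modular_lux_norm_le:
  assumes F: "orlicz_function F" and f: "f \<in> orlicz_space F" and n: "lux_norm F f = 1"
  shows "modular F f 1 \<le> 1"
proof -
  define c where "c n = 1 - 1 / real (n + 2)" for n
  have c01: "0 < c n" "c n < 1" for n by (auto simp: c_def field_simps)
  have cmono: "c n \<le> c (Suc n)" for n by (simp add: c_def field_simps)
  have clim: "c \<longlonglongrightarrow> 1"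
  proof -
    have "(\<lambda>n. 1 - 1 / real (n + 2)) \<longlonglongrightarrow> 1 - 0"
      by (intro tendsto_intros LIMSEQ_ignore_initial_segment lim_1_over_n)
    then show ?thesis unfolding c_def by simp
  qed
  have meas: "(\<lambda>t. ennreal (F (c n * \<bar>f t\<bar>))) \<in> borel_measurable I01" for n
    using orlicz_measurable_scaled[OF F orlicz_space_measurable[OF f], of "c n"] c01(1)[of n] by simp
  have lim: "(\<lambda>n. ennreal (F (c n * \<bar>f t\<bar>))) \<longlonglongrightarrow> ennreal (F \<bar>f t\<bar>)" for t
  proof (rule tendsto_ennrealI)
    have "(\<lambda>n. F \<bar>c n * \<bar>f t\<bar>\<bar>) \<longlonglongrightarrow> F \<bar>1 * \<bar>f t\<bar>\<bar>"
      using orlicz_continuous_abs[OF F] clim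
      by (intro isCont_tendsto_compose[of _ "\<lambda>x. F \<bar>x\<bar>"] tendsto_intros)
         (auto simp: continuous_on_eq_continuous_at)
    then show "(\<lambda>n. F (c n * \<bar>f t\<bar>)) \<longlonglongrightarrow> F \<bar>f t\<bar>"
      using c01(1) by (simp add: abs_mult less_imp_le)
  qed
  have "(\<lambda>n. dilated F f (c n)) \<longlonglongrightarrow> modular F f 1"
    unfolding dilated_def modular_def
  proof (rule nn_integral_LIMSEQ)
    show "incseq (\<lambda>n t. ennreal (F (c n * \<bar>f t\<bar>)))"
    proof (rule incseq_SucI, rule le_funI, rule ennreal_leI, rule orlicz_mono[OF F])
      fix n t
      show "0 \<le> c n * \<bar>f t\<bar>" using c01(1)[of n] by simp
      show "c n * \<bar>f t\<bar> \<le> c (Suc n) * \<bar>f t\<bar>" using cmono by (intro mult_right_mono) auto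
    qed
  qed (use meas lim in auto)
  moreover have "dilated F f (c n) \<le> 1" for n
  proof -
    have "modular F f (1 / c n) \<le> 1"
      using c01[of n] n by (intro modular_le_one[OF F f]) (simp add: field_simps)
    then show ?thesis by (simp add: modular_eq_dilated)
  qed
  ultimately show ?thesis by (intro LIMSEQ_le_const2) auto
qed

text \<open>If the modular were \<open>m < 1\<close>, doubling would make the modular of
  \<open>2 * f\<close> finite, and convexity between the scales 1 and 2 would keep the modular at
  most 1 at some scale above 1, so the norm would be below 1.\<close>

lemma modular_eq_one:
  assumes F: "orlicz_function F" and f: "f \<in> orlicz_space F" and n: "lux_norm F f = 1"
    and dbl: "Y > 0" "\<And>y. y \<ge> Y \<Longrightarrow> F (2 * y) \<le> B * F y"
  shows "modular F f 1 = 1"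
proof (rule antisym[OF modular_lux_norm_le[OF F f n]], rule ccontr)
  assume "\<not> 1 \<le> modular F f 1"
  then have lt: "modular F f 1 < 1" by simp
  define m where "m = enn2real (modular F f 1)"
  have "modular F f 1 < top" using lt by (rule less_trans) simp
  then have mm: "modular F f 1 = ennreal m" by (simp add: m_def)
  then have m: "m \<ge> 0" "modular F f 1 = ennreal m" "m < 1"
    using lt unfolding mm by (auto simp: m_def)
  have fm: "f \<in> borel_measurable I01" using f by (rule orlicz_space_measurable)
  have F2Y: "0 \<le> F (2 * Y)" using dbl by (intro orlicz_nonneg[OF F]) auto
  have "dilated F f 2 \<le> (\<integral>\<^sup>+ t. ennreal (max 0 B) * ennreal (F \<bar>f t\<bar>) + ennreal (F (2 * Y)) \<partial>I01)"
    unfolding dilated_def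
  proof (rule nn_integral_mono)
    fix t
    have nn: "0 \<le> F \<bar>f t\<bar>" by (intro orlicz_nonneg[OF F]) auto
    have "F (2 * \<bar>f t\<bar>) \<le> max 0 B * F \<bar>f t\<bar> + F (2 * Y)"
    proof (cases "\<bar>f t\<bar> \<ge> Y")
      case True
      then have "F (2 * \<bar>f t\<bar>) \<le> B * F \<bar>f t\<bar>" by (rule dbl)
      also have "\<dots> \<le> max 0 B * F \<bar>f t\<bar>" using nn by (intro mult_right_mono) auto
      finally show ?thesis using F2Y by simp
    next
      case False
      then have "F (2 * \<bar>f t\<bar>) \<le> F (2 * Y)" by (intro orlicz_mono[OF F]) auto
      moreover have "0 \<le> max 0 B * F \<bar>f t\<bar>" using nn by simp
      ultimately show ?thesis by simp
    qed
    then have "ennreal (F (2 * \<bar>f t\<bar>)) \<le> ennreal (max 0 B * F \<bar>f t\<bar> + F (2 * Y))" by (rule ennreal_leI)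
    then show "ennreal (F (2 * \<bar>f t\<bar>)) \<le> ennreal (max 0 B) * ennreal (F \<bar>f t\<bar>) + ennreal (F (2 * Y))"
      using nn F2Y by (simp add: ennreal_mult)
  qed
  also have "\<dots> = ennreal (max 0 B) * ennreal m + ennreal (F (2 * Y))"
    using orlicz_measurable[OF F fm] m
    by (simp add: nn_integral_add nn_integral_cmult modular_def emeasure_restrict_space)
  also have "\<dots> = ennreal (max 0 B * m + F (2 * Y))" using m F2Y by (simp add: ennreal_mult)
  finally have d2: "dilated F f 2 \<le> ennreal (max 0 B * m + F (2 * Y))" .
  define M where "M = max 0 B * m + F (2 * Y)"
  have M: "M \<ge> 0" using m F2Y by (simp add: M_def)
  \<comment> \<open>Small enough that \<open>u * M\<close> fits into the gap
    \<open>1 - m\<close>.\<close>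
  define u where "u = min 1 ((1 - m) / (M + 1))"
  have u: "0 < u" "u \<le> 1" using m M by (auto simp: u_def)
  have uM: "u * M \<le> 1 - m"
  proof -
    have "u * M \<le> u * (M + 1)" using u by simp
    also have "\<dots> \<le> (1 - m) / (M + 1) * (M + 1)" using M by (intro mult_right_mono) (auto simp: u_def)
    also have "\<dots> = 1 - m" using M by simp
    finally show ?thesis .
  qed
  have "dilated F f (1 + u) \<le>
      (\<integral>\<^sup>+ t. ennreal (1 - u) * ennreal (F \<bar>f t\<bar>) + ennreal u * ennreal (F (2 * \<bar>f t\<bar>)) \<partial>I01)"
    unfolding dilated_def
  proof (rule nn_integral_mono)
    fix t
    have nn: "0 \<le> F \<bar>f t\<bar>" "0 \<le> F (2 * \<bar>f t\<bar>)" by (auto intro!: orlicz_nonneg[OF F])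
    have "F ((1 - u) * \<bar>f t\<bar> + u * (2 * \<bar>f t\<bar>)) \<le> (1 - u) * F \<bar>f t\<bar> + u * F (2 * \<bar>f t\<bar>)"
      using u by (intro orlicz_convex[OF F]) auto
    also have "(1 - u) * \<bar>f t\<bar> + u * (2 * \<bar>f t\<bar>) = (1 + u) * \<bar>f t\<bar>" by (simp add: algebra_simps)
    finally have "ennreal (F ((1 + u) * \<bar>f t\<bar>)) \<le> ennreal ((1 - u) * F \<bar>f t\<bar> + u * F (2 * \<bar>f t\<bar>))"
      by (rule ennreal_leI)
    then show "ennreal (F ((1 + u) * \<bar>f t\<bar>)) \<le>
        ennreal (1 - u) * ennreal (F \<bar>f t\<bar>) + ennreal u * ennreal (F (2 * \<bar>f t\<bar>))"
      using nn u by (simp add: ennreal_mult)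
  qed
  also have "\<dots> = ennreal (1 - u) * modular F f 1 + ennreal u * dilated F f 2"
    using orlicz_measurable[OF F fm] orlicz_measurable_scaled[OF F fm, of 2]
    by (simp add: nn_integral_add nn_integral_cmult modular_def dilated_def)
  also have "\<dots> \<le> ennreal (1 - u) * ennreal m + ennreal u * ennreal M"
    using d2 m by (intro add_mono mult_left_mono) (auto simp: M_def)
  also have "\<dots> = ennreal ((1 - u) * m + u * M)" using u m M by (simp add: ennreal_mult)
  also have "\<dots> \<le> ennreal 1"
  proof (rule ennreal_leI)
    have "(1 - u) * m \<le> 1 * m" using u m by (intro mult_right_mono) auto
    then show "(1 - u) * m + u * M \<le> 1" using uM by simp
  qed
  finally have "modular F f (1 / (1 + u)) \<le> 1" using u by (simp add: modular_eq_dilated)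
  then have "lux_norm F f \<le> 1 / (1 + u)" using u by (intro lux_norm_le) auto
  moreover have "1 / (1 + u) < 1" using u by simp
  ultimately show False using n by simp
qed

section \<open>Power asymptotics imply uniform disjoint homogeneity\<close>

lemma sum_half_powers_le: "(\<Sum>i<n. (1/2) ^ (i + 1)) \<le> (1::real)"
proof -
  have "(\<Sum>i<n. (1/2) ^ (i + 1)) = 1 - (1/2::real) ^ n" by (induction n) auto
  then show ?thesis by simp
qed

lemma lr_norm_nonneg: "0 \<le> lr_norm r a n"
  by (simp add: lr_norm_def)

lemma lr_norm_powr:
  assumes "r > 0" shows "lr_norm r a n powr r = (\<Sum>i<n. \<bar>a i\<bar> powr r)"
proof -
  have "0 \<le> (\<Sum>i<n. \<bar>a i\<bar> powr r)" by (intro sum_nonneg) auto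
  then show ?thesis using assms by (simp add: lr_norm_def powr_powr)
qed

lemma powr_le_oneD:
  fixes x :: real assumes "x powr r \<le> 1" "0 < r" shows "x \<le> 1"
proof (rule ccontr)
  assume "\<not> x \<le> 1"
  then have "1 powr r < x powr r" using assms by (intro powr_less_mono2) auto
  then show False using assms by simp
qed

lemma lr_norm_eq_0D:
  assumes "r > 0" "lr_norm r a n = 0" "i < n" shows "a i = 0"
proof -
  have "(\<Sum>i<n. \<bar>a i\<bar> powr r) = 0" using lr_norm_powr[OF assms(1), of a n] assms by simp
  then have "\<bar>a i\<bar> powr r = 0" using assms(3) by (subst (asm) sum_nonneg_eq_0_iff) auto
  then show ?thesis by simp
qed

lemma sum_dilated_le:
  assumes C: "0 \<le> C" and s: "\<And>i. i < n \<Longrightarrow> s i \<in> {0..1}"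
    and le: "\<And>i t. t \<in> {0..1} \<Longrightarrow> dilated F (y i) t \<le> ennreal (C * t powr p + (1/2) ^ (i + 1))"
  shows "(\<Sum>i<n. dilated F (y i) (s i)) \<le> ennreal (C * (\<Sum>i<n. s i powr p) + 1)"
proof -
  have "(\<Sum>i<n. dilated F (y i) (s i)) \<le> (\<Sum>i<n. ennreal (C * s i powr p + (1/2) ^ (i + 1)))"
    using s le by (intro sum_mono) auto
  also have "\<dots> = ennreal (\<Sum>i<n. C * s i powr p + (1/2) ^ (i + 1))"
    using C by (intro sum_ennreal) auto
  also have "\<dots> = ennreal (C * (\<Sum>i<n. s i powr p) + (\<Sum>i<n. (1/2) ^ (i + 1)))"
    by (simp add: sum.distrib sum_distrib_left)
  also have "\<dots> \<le> ennreal (C * (\<Sum>i<n. s i powr p) + 1)"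
    using sum_half_powers_le[of n] by (intro ennreal_leI) simp
  finally show ?thesis .
qed

lemma sum_le_one_of_ennreal:
  fixes r :: "'a \<Rightarrow> real"
  assumes "\<And>i. i \<in> T \<Longrightarrow> ennreal (r i) \<le> e i" "(\<Sum>i\<in>T. e i) \<le> 1"
  shows "(\<Sum>i\<in>T. r i) \<le> 1"
proof -
  have "ennreal (\<Sum>i\<in>T. max 0 (r i)) = (\<Sum>i\<in>T. ennreal (r i))"
    by (subst sum_ennreal[symmetric]) (auto simp: ennreal_max_0)
  also have "\<dots> \<le> (\<Sum>i\<in>T. e i)" using assms by (intro sum_mono) auto
  also have "\<dots> \<le> ennreal 1" using assms by simp
  finally have "(\<Sum>i\<in>T. max 0 (r i)) \<le> 1" by (subst (asm) ennreal_le_iff) auto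
  moreover have "(\<Sum>i\<in>T. r i) \<le> (\<Sum>i\<in>T. max 0 (r i))" by (intro sum_mono) auto
  ultimately show ?thesis by simp
qed

text \<open>The errors sum to at most 1. At scale \<open>l\<close> the modular is therefore at most
  \<open>C + 1\<close>; conversely a modular at most 1 at scale \<open>c\<close> bounds the sum of
  \<open>(\<bar>a i\<bar> / c) powr p\<close> by \<open>2 * C\<close>.\<close>

lemma equiv_lr_of_dilated_bounds:
  assumes F: "orlicz_function F" and p: "1 \<le> p" and C: "1 \<le> C"
    and y: "\<And>i. y i \<in> orlicz_space F" and d: "disjoint_seq y" and one: "\<And>i. modular F (y i) 1 = 1"
    and up: "\<And>i s. s \<in> {0..1} \<Longrightarrow> dilated F (y i) s \<le> ennreal (C * s powr p + (1/2) ^ (i + 1))"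
    and lo: "\<And>i s. s \<in> {0..1} \<Longrightarrow> ennreal (s powr p / C - (1/2) ^ (i + 1)) \<le> dilated F (y i) s"
  shows "equiv_lr F p (2 * C + 1) y"
  unfolding equiv_lr_def
proof (intro conjI allI)
  show "0 < 2 * C + 1" using C by simp
  fix n a
  define l where "l = lr_norm p a n"
  define S where "S = (\<lambda>t. \<Sum>i<n. a i * y i t)"
  have ym: "y i \<in> borel_measurable I01" for i using y by (rule orlicz_space_measurable)
  have S: "S \<in> orlicz_space F" unfolding S_def using y by (intro orlicz_space_sum[OF F]) auto
  have modS: "modular F S c = (\<Sum>i<n. dilated F (y i) (\<bar>a i\<bar> / c))" if "c > 0" for c
    unfolding S_def using ym that by (intro modular_disjoint_sum[OF F _ _ d]) auto
  have lp: "l powr p = (\<Sum>i<n. \<bar>a i\<bar> powr p)" unfolding l_def using p by (intro lr_norm_powr) auto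
  have l0: "l \<ge> 0" by (simp add: l_def lr_norm_nonneg)
  have "lux_norm F S \<le> (2 * C + 1) * l \<and> l / (2 * C + 1) \<le> lux_norm F S"
  proof (cases "l = 0")
    case True
    then have "a i = 0" if "i < n" for i
      using lr_norm_eq_0D[of p a n i] that p by (simp add: l_def)
    then have "S = (\<lambda>_. 0)" by (simp add: S_def)
    then show ?thesis using True lux_norm_zero[OF F] by simp
  next
    case False
    then have lpos: "l > 0" using l0 by simp
    have sum1: "(\<Sum>i<n. (\<bar>a i\<bar> / l) powr p) = 1"
      using lpos lp[symmetric] by (simp add: powr_divide sum_divide_distrib[symmetric])
    have in01: "\<bar>a i\<bar> / l \<in> {0..1}" if "i < n" for i
    proof -
      have "(\<bar>a i\<bar> / l) powr p \<le> 1"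
        unfolding sum1[symmetric] using that by (intro member_le_sum) auto
      then have "\<bar>a i\<bar> / l \<le> 1" by (rule powr_le_oneD) (use p in simp)
      then show ?thesis using lpos by auto
    qed
    have "modular F S l \<le> ennreal (C * (\<Sum>i<n. (\<bar>a i\<bar> / l) powr p) + 1)"
      unfolding modS[OF lpos] using C in01 up by (intro sum_dilated_le) auto
    then have "modular F S l \<le> ennreal (C + 1)" using sum1 by simp
    then have "modular F S ((C + 1) * l) \<le> 1"
      using C lpos S by (intro modular_shrink[OF F]) (auto simp: orlicz_space_measurable)
    then have "lux_norm F S \<le> (C + 1) * l" using C lpos by (intro lux_norm_le) auto
    also have "\<dots> \<le> (2 * C + 1) * l" using C lpos by (intro mult_right_mono) auto
    finally have upper: "lux_norm F S \<le> (2 * C + 1) * l" .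
    have "l / (2 * C + 1) \<le> lux_norm F S"
    proof (rule lux_norm_ge[OF F S])
      fix c :: real assume c: "c > 0" "modular F S c \<le> 1"
      define s where "s i = \<bar>a i\<bar> / c" for i
      have s0: "s i \<ge> 0" for i using c by (simp add: s_def)
      have sum_le: "(\<Sum>i<n. dilated F (y i) (s i)) \<le> 1" using c modS[OF c(1)] by (simp add: s_def)
      \<comment> \<open>The two-sided bounds only cover scales in [0,1]. Since \<open>y i\<close>
        has modular exactly 1, a scale \<open>s i > 1\<close> would already give it a modular above
        1.\<close>
      have s1: "s i \<le> 1" if "i < n" for i
      proof (rule ccontr)
        assume "\<not> s i \<le> 1"
        then have gt: "s i > 1" by simp
        have di: "dilated F (y i) (s i) \<le> 1"
          using that sum_le member_le_sum[of i "{..<n}" "\<lambda>i. dilated F (y i) (s i)"] by auto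
        have "1 = dilated F (y i) (1 / s i * s i)"
          using one[of i] gt by (simp add: modular_eq_dilated)
        also have "\<dots> \<le> ennreal (1 / s i) * dilated F (y i) (s i)"
          using gt by (intro dilated_contract[OF F ym]) auto
        also have "\<dots> \<le> ennreal (1 / s i) * 1" using di by (intro mult_left_mono) auto
        also have "\<dots> < 1" using gt by simp
        finally show False by simp
      qed
      have "(\<Sum>i<n. s i powr p / C - (1/2) ^ (i + 1)) \<le> 1"
      proof (rule sum_le_one_of_ennreal)
        fix i assume "i \<in> {..<n}"
        then show "ennreal (s i powr p / C - (1/2) ^ (i + 1)) \<le> dilated F (y i) (s i)"
          using s0 s1 by (intro lo) auto
      qed (rule sum_le)
      then have "(\<Sum>i<n. s i powr p) / C \<le> 2"
        using sum_half_powers_le[of n] by (simp add: sum_subtractf sum_divide_distrib)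
      then have "(\<Sum>i<n. s i powr p) \<le> 2 * C" using C by (simp add: field_simps)
      moreover have "(\<Sum>i<n. s i powr p) = (l / c) powr p"
        using c lpos lp by (simp add: s_def powr_divide sum_divide_distrib[symmetric])
      ultimately have "(l / c) powr p \<le> 2 * C" by simp
      \<comment> \<open>Instead of the p-th root of \<open>2 * C\<close> the coarser
        \<open>2 * C + 1\<close> is used, which is at least 1 and hence at most its own p-th
        power.\<close>
      also have "2 * C \<le> (2 * C + 1) powr 1" using C by simp
      also have "\<dots> \<le> (2 * C + 1) powr p" using C p by (intro powr_mono) auto
      finally have "\<not> l / c > 2 * C + 1"
        using powr_less_mono2[of p "2 * C + 1" "l / c"] p C by auto
      then show "l / (2 * C + 1) \<le> c" using c C by (simp add: field_simps)
    qed
    then show ?thesis using upper by simp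
  qed
  then show "lr_norm p a n / (2 * C + 1) \<le> lux_norm F (\<lambda>t. \<Sum>i<n. a i * y i t)"
    "lux_norm F (\<lambda>t. \<Sum>i<n. a i * y i t) \<le> (2 * C + 1) * lr_norm p a n"
    by (simp_all add: S_def l_def)
qed

text \<open>Only the subsequence depends on \<open>x\<close>; the constant comes from
  \<open>K\<close> and \<open>p\<close> alone, which is the uniformity claimed. The lower bound also
  supplies doubling, hence modular exactly 1 for normalized functions.\<close>

theorem power_bounds_imp_uniform_DH:
  assumes F: "orlicz_function F" and U: "power_upper F p K" and L: "power_lower F p K"
    and K: "1 \<le> K" and p: "1 \<le> p"
  shows "uniform_DH F p"
  unfolding uniform_DH_def
proof (intro exI[of _ "2 * (K * 2 powr p) + 1"] allI impI)
  fix x assume x: "normed_disjoint_seq F x"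
  then have xs: "\<And>n. x n \<in> orlicz_space F" "\<And>n. lux_norm F (x n) = 1" and d: "disjoint_seq x"
    by (auto simp: normed_disjoint_seq_def)
  note xm = orlicz_space_measurable[OF xs(1)]
  obtain B Y where dbl: "Y > 0" "\<And>y. y \<ge> Y \<Longrightarrow> F (2 * y) \<le> B * F y"
    using power_lower_doubling[OF F L] by blast
  have one: "modular F (x n) 1 = 1" for n
    using modular_eq_one[OF F xs(1) xs(2) dbl] .
  define Q where "Q k n \<longleftrightarrow> (\<forall>s\<in>{0..1}. dilated F (x n) s \<le> ennreal (K * 2 powr p * s powr p + (1/2) ^ (k + 1)))
      \<and> (\<forall>s\<in>{0..1}. ennreal (s powr p / (K * 2 powr p) - (1/2) ^ (k + 1)) \<le> dilated F (x n) s)" for k n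
  have "\<forall>\<^sub>F n in sequentially. Q k n" for k
    unfolding Q_def
    using K p one by (intro eventually_conj eventually_dilated_le[OF F U _ _ xm d]
        eventually_dilated_ge[OF F L _ _ xm d]) auto
  from eventually_diagonal_subseq[of Q, OF this] obtain \<phi> where \<phi>: "strict_mono \<phi>" "\<And>k. Q k (\<phi> k)"
    by blast
  have "equiv_lr F p (2 * (K * 2 powr p) + 1) (x \<circ> \<phi>)"
  proof (rule equiv_lr_of_dilated_bounds[OF F p])
    show "disjoint_seq (x \<circ> \<phi>)"
      using disjoint_seq_subseq[OF d strict_mono_imp_inj_on[OF \<phi>(1)]] .
  qed (use \<phi>(2) xs one K p power_constant_ge_one[of K p] in \<open>auto simp: Q_def\<close>)
  then show "\<exists>\<phi>. strict_mono \<phi> \<and> equiv_lr F p (2 * (K * 2 powr p) + 1) (x \<circ> \<phi>)"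
    using \<phi>(1) by blast
qed

section \<open>Power asymptotics imply that the dual space is disjointly complemented\<close>

text \<open>For a normalized disjoint sequence \<open>g\<^sub>n\<close> in the space of \<open>G\<close>, the functions
  \<open>f\<^sub>n = G(|g\<^sub>n|)/g\<^sub>n\<close> are biorthogonal to \<open>g\<^sub>n\<close> and have modular at most one in the space of \<open>F\<close>.
  Along a subsequence both satisfy upper power estimates, hence
  \<open>h \<mapsto> \<Sum>n. (\<integral> f\<^sub>n h) g\<^sub>n\<close> is a bounded projection.\<close>

lemma dual_coefficients_bound:
  assumes F: "orlicz_function F" and G: "orlicz_function G" and FG: "young_conjugate F G"
    and pq: "1 < p" "1 / p + 1 / q = 1" and C: "0 \<le> C"
    and y: "\<And>i. y i \<in> borel_measurable I01" and d: "disjoint_seq y"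
    and up: "\<And>i s. s \<in> {0..1} \<Longrightarrow> dilated F (y i) s \<le> ennreal (C * s powr p + (1/2) ^ (i + 1))"
    and h: "h \<in> borel_measurable I01" and c: "c > 0" "modular G h c \<le> 1"
    and int: "\<And>i. integrable I01 (\<lambda>t. y i t * h t)"
  shows "(\<Sum>i<n. \<bar>\<integral>t. y i t * h t \<partial>I01\<bar> powr q) \<le> (2 * (C + 1) * c) powr q"
proof -
  define b where "b i = (\<integral>t. y i t * h t \<partial>I01)" for i
  define \<sigma> where "\<sigma> = (\<Sum>i<n. \<bar>b i\<bar> powr q)"
  note q = conjugate_exponent[OF pq]
  have \<sigma>0: "\<sigma> \<ge> 0" unfolding \<sigma>_def by (intro sum_nonneg) auto
  have "\<sigma> \<le> (2 * (C + 1) * c) powr q"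
  proof (cases "\<sigma> = 0")
    case False
    then have \<sigma>: "\<sigma> > 0" using \<sigma>0 by simp
    \<comment> \<open>The extremal vector of Hoelder's inequality: it has unit p-norm and its
      pairing with \<open>b\<close> is the q-norm of \<open>b\<close>, so that q-norm is tested by
      the single function \<open>w\<close>.\<close>
    define a where "a i = sgn (b i) * \<bar>b i\<bar> powr (q - 1) / \<sigma> powr (1 / p)" for i
    have abs_a: "\<bar>a i\<bar> = \<bar>b i\<bar> powr (q - 1) / \<sigma> powr (1 / p)" for i
      by (cases "b i = 0") (auto simp: a_def abs_mult)
    have qp: "(q - 1) * p = q" using q(1) by (subst q(3)) simp
    have ap: "\<bar>a i\<bar> powr p = \<bar>b i\<bar> powr q / \<sigma>" for i
      unfolding abs_a using pq(1) \<sigma> by (simp add: powr_divide powr_powr qp)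
    have sum_ap: "(\<Sum>i<n. \<bar>a i\<bar> powr p) = 1"
      unfolding ap using \<sigma> by (simp add: sum_divide_distrib[symmetric] \<sigma>_def[symmetric])
    have a01: "\<bar>a i\<bar> \<in> {0..1}" if "i < n" for i
    proof -
      have "\<bar>a i\<bar> powr p \<le> 1"
        unfolding sum_ap[symmetric] using that by (intro member_le_sum) auto
      then show ?thesis using powr_le_oneD[of "\<bar>a i\<bar>" p] pq(1) by auto
    qed
    have bb: "a i * b i = \<bar>b i\<bar> powr q / \<sigma> powr (1 / p)" for i
    proof (cases "b i = 0")
      case False
      have "sgn (b i) * b i = \<bar>b i\<bar>" by (cases "b i > 0") (auto simp: sgn_if)
      then have "sgn (b i) * \<bar>b i\<bar> powr (q - 1) * b i = \<bar>b i\<bar> * \<bar>b i\<bar> powr (q - 1)"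
        by (metis mult.assoc mult.commute)
      also have "\<dots> = \<bar>b i\<bar> powr q" using powr_mult_base[of "\<bar>b i\<bar>" "q - 1"] by simp
      finally show ?thesis by (simp add: a_def)
    qed (simp add: a_def)
    have "(\<Sum>i<n. a i * b i) = \<sigma> / \<sigma> powr (1 / p)"
      unfolding bb by (simp add: sum_divide_distrib[symmetric] \<sigma>_def)
    also have "\<dots> = \<sigma> powr (1 - 1 / p)" using \<sigma> by (simp add: powr_diff)
    also have "1 - 1 / p = 1 / q" using pq by simp
    finally have ab: "(\<Sum>i<n. a i * b i) = \<sigma> powr (1 / q)" .
    define w where "w = (\<lambda>t. \<Sum>i<n. a i * y i t)"
    have wm: "w \<in> borel_measurable I01" unfolding w_def using y by measurable
    have "modular F w 1 = (\<Sum>i<n. dilated F (y i) \<bar>a i\<bar>)"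
      unfolding w_def using modular_disjoint_sum[OF F y, where T = "{..<n}" and c = 1 and a = a] d by simp
    also have "\<dots> \<le> ennreal (C * (\<Sum>i<n. \<bar>a i\<bar> powr p) + 1)"
      using a01 C up by (intro sum_dilated_le) auto
    finally have "modular F w 1 \<le> ennreal (C + 1)" using sum_ap by simp
    then have "modular F w ((C + 1) * 1) \<le> 1"
      using C by (intro modular_shrink[OF F wm]) auto
    then have "\<bar>\<integral>t. w t * h t \<partial>I01\<bar> \<le> 2 * (C + 1) * c"
      using C c by (intro orlicz_holder(2)[OF F G FG wm h]) auto
    moreover have "(\<integral>t. w t * h t \<partial>I01) = (\<Sum>i<n. a i * b i)"
    proof -
      have "(\<integral>t. w t * h t \<partial>I01) = (\<integral>t. (\<Sum>i<n. a i * (y i t * h t)) \<partial>I01)"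
        by (simp add: w_def sum_distrib_right mult.assoc)
      also have "\<dots> = (\<Sum>i<n. a i * b i)"
        unfolding b_def using int by (subst Bochner_Integration.integral_sum) auto
      finally show ?thesis .
    qed
    ultimately have "\<sigma> powr (1 / q) \<le> 2 * (C + 1) * c" using ab by simp
    then have "(\<sigma> powr (1 / q)) powr q \<le> (2 * (C + 1) * c) powr q"
      using q(1) by (intro powr_mono2) auto
    then show ?thesis using \<sigma> q(1) by (simp add: powr_powr)
  qed simp
  then show ?thesis by (simp add: \<sigma>_def b_def)
qed

lemma modular_suminf_le:
  assumes F: "orlicz_function F" and y: "\<And>i. y i \<in> borel_measurable I01" and d: "disjoint_seq y"
    and c: "c > 0" and s: "\<And>i. \<bar>a i\<bar> / c \<in> {0..1}"
    and up: "\<And>i s. s \<in> {0..1} \<Longrightarrow> dilated F (y i) s \<le> ennreal (u i s)" "\<And>i s. 0 \<le> u i s"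
    and le: "\<And>n. (\<Sum>i<n. u i (\<bar>a i\<bar> / c)) \<le> D"
  shows "modular F (\<lambda>t. \<Sum>i. a i * y i t) c \<le> ennreal D"
proof -
  have "(\<Sum>i. dilated F (y i) (\<bar>a i\<bar> / c)) + 0 \<le> ennreal D"
  proof (rule ennreal_suminf_bound_add)
    fix n
    have "(\<Sum>i<n. dilated F (y i) (\<bar>a i\<bar> / c)) \<le> (\<Sum>i<n. ennreal (u i (\<bar>a i\<bar> / c)))"
      using s by (intro sum_mono up) auto
    also have "\<dots> = ennreal (\<Sum>i<n. u i (\<bar>a i\<bar> / c))" using up(2) by (intro sum_ennreal) auto
    also have "\<dots> \<le> ennreal D" using le by (intro ennreal_leI)
    finally show "(\<Sum>i<n. dilated F (y i) (\<bar>a i\<bar> / c)) + 0 \<le> ennreal D" by simp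
  qed
  then show ?thesis using modular_disjoint_suminf[OF F y d c] by simp
qed

text \<open>In the application \<open>x i\<close> may have norm zero, since the definition of
  \<open>DC\<close> admits zero functions. Then \<open>\<nu> i = 0\<close> and division by zero
  makes \<open>z i\<close> the zero function. This is why the pairing may fail to be 1 when
  \<open>z i\<close> is zero, and why \<open>x\<close> and \<open>z\<close> are related by an exact
  quotient and by an almost everywhere product.\<close>

lemma complemented_of_biorthogonal:
  fixes y z :: "nat \<Rightarrow> real \<Rightarrow> real"
  assumes F: "orlicz_function F" and G: "orlicz_function G" and FG: "young_conjugate F G"
    and pq: "1 < p" "1 / p + 1 / q = 1" and C: "1 \<le> C"
    and y: "\<And>i. y i \<in> borel_measurable I01" "disjoint_seq y" "\<And>i. modular F (y i) 1 \<le> 1"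
    and z: "\<And>i. z i \<in> orlicz_space G" "disjoint_seq z"
    and up: "\<And>i s. s \<in> {0..1} \<Longrightarrow> dilated F (y i) s \<le> ennreal (C * s powr p + (1/2) ^ (i + 1))"
      "\<And>i s. s \<in> {0..1} \<Longrightarrow> dilated G (z i) s \<le> ennreal (C * s powr q + (1/2) ^ (i + 1))"
    and cross: "\<And>i j. i \<noteq> j \<Longrightarrow> AE t in I01. y i t * z j t = 0"
    and bi: "\<And>i. (\<integral>t. y i t * z i t \<partial>I01) = 1 \<or> z i = (\<lambda>_. 0)"
    and x: "\<And>i. x i \<in> orlicz_space G" "\<And>i t. z i t = x i t / \<nu> i" "\<And>i. AE t in I01. x i t = \<nu> i * z i t"
  shows "complemented G (closed_span G x)"
proof -
  note q = conjugate_exponent[OF pq]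
  note zm = orlicz_space_measurable[OF z(1)]
  define b where "b h i = (\<integral>t. y i t * h t \<partial>I01)" for h i
  define P where "P h = (\<lambda>t. \<Sum>i. b h i * z i t)" for h
  \<comment> \<open>Hoelder's factor 2 times the constant \<open>C + 1\<close> that bounds
    combinations of the \<open>y i\<close> with unit p-norm.\<close>
  define D where "D = 2 * (C + 1)"
  have D: "D > 0" using C by (simp add: D_def)
  have int: "integrable I01 (\<lambda>t. y i t * h t)" if "h \<in> orlicz_space G" for h i
    using orlicz_product_integrable[OF F G FG orlicz_spaceI[OF y(1) zero_less_one y(3)] that] .
  have bsum: "(\<Sum>i<n. \<bar>b h i\<bar> powr q) \<le> (D * c) powr q"
    if "h \<in> orlicz_space G" "c > 0" "modular G h c \<le> 1" for h c n
    unfolding b_def D_def using that C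
    by (intro dual_coefficients_bound[OF F G FG pq _ y(1) y(2) up(1)] int) (auto simp: orlicz_space_measurable)
  have Pm: "P h \<in> borel_measurable I01" for h
    unfolding P_def using zm by measurable
  have Pmod: "modular G (P h) ((C + 1) * (D * c)) \<le> 1"
    if h: "h \<in> orlicz_space G" "c > 0" "modular G h c \<le> 1" for h c
  proof -
    define B where "B = D * c"
    have B: "B > 0" using D h by (simp add: B_def)
    have sle: "(\<Sum>i<n. (\<bar>b h i\<bar> / B) powr q) \<le> 1" for n
    proof -
      have "(\<Sum>i<n. \<bar>b h i\<bar> powr q) \<le> 1 * B powr q" using bsum[OF h, of n] by (simp add: B_def)
      moreover have "0 < B powr q" using B by simp
      ultimately have "(\<Sum>i<n. \<bar>b h i\<bar> powr q) / B powr q \<le> 1" by (simp only: pos_divide_le_eq)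
      then show ?thesis using B by (simp add: powr_divide sum_divide_distrib[symmetric])
    qed
    have in01: "\<bar>b h i\<bar> / B \<in> {0..1}" for i
    proof -
      have "(\<bar>b h i\<bar> / B) powr q \<le> (\<Sum>i<Suc i. (\<bar>b h i\<bar> / B) powr q)"
        by (intro member_le_sum) auto
      also have "\<dots> \<le> 1" by (rule sle)
      finally show ?thesis using powr_le_oneD[of "\<bar>b h i\<bar> / B" q] q(1) B by auto
    qed
    have "modular G (P h) B \<le> ennreal (C + 1)"
      unfolding P_def
    proof (rule modular_suminf_le[OF G zm z(2) B in01 up(2)])
      fix n
      have "(\<Sum>i<n. C * (\<bar>b h i\<bar> / B) powr q + (1/2) ^ (i + 1))
          = C * (\<Sum>i<n. (\<bar>b h i\<bar> / B) powr q) + (\<Sum>i<n. (1/2) ^ (i + 1))"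
        by (simp add: sum.distrib sum_distrib_left)
      also have "\<dots> \<le> C * 1 + 1"
        using C sle[of n] sum_half_powers_le[of n] by (intro add_mono mult_left_mono) auto
      finally show "(\<Sum>i<n. C * (\<bar>b h i\<bar> / B) powr q + (1/2) ^ (i + 1)) \<le> C + 1" by simp
    qed (use C in auto)
    then show ?thesis unfolding B_def[symmetric]
      using C B by (intro modular_shrink[OF G Pm]) auto
  qed
  have Pspace: "P h \<in> orlicz_space G" if h: "h \<in> orlicz_space G" for h
  proof -
    obtain c where "c > 0" "modular G h c \<le> 1" using orlicz_spaceE[OF G h] .
    then show ?thesis using Pmod[OF h] D C by (intro orlicz_spaceI[OF Pm, of "(C + 1) * (D * c)"]) auto
  qed
  have Pbound: "lux_norm G (P h) \<le> (C + 1) * D * lux_norm G h" if h: "h \<in> orlicz_space G" for h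
  proof -
    have "lux_norm G (P h) / ((C + 1) * D) \<le> lux_norm G h"
    proof (rule lux_norm_ge[OF G h])
      fix c :: real assume c: "c > 0" "modular G h c \<le> 1"
      then have "lux_norm G (P h) \<le> (C + 1) * (D * c)"
        using Pmod[OF h c] C D by (intro lux_norm_le) auto
      then have "lux_norm G (P h) \<le> c * ((C + 1) * D)" by (simp add: ac_simps)
      moreover have "0 < (C + 1) * D" using C D by simp
      ultimately show "lux_norm G (P h) / ((C + 1) * D) \<le> c" by (simp only: pos_divide_le_eq)
    qed
    moreover have "0 < (C + 1) * D" using C D by simp
    ultimately have "lux_norm G (P h) \<le> lux_norm G h * ((C + 1) * D)" by (simp only: pos_divide_le_eq)
    then show ?thesis by (simp only: ac_simps)
  qed
  have Pspan: "P h \<in> closed_span G x" if h: "h \<in> orlicz_space G" for h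
    unfolding closed_span_def
  proof (intro CollectI conjI allI impI Pspace[OF h])
    fix e :: real assume e: "e > 0"
    obtain c where c: "c > 0" "modular G h c \<le> 1" using orlicz_spaceE[OF G h] .
    \<comment> \<open>Bounds for the modulars of the single terms at scale \<open>e/2\<close>. They
      are summable, so the tail from some \<open>N\<close> on is at most 1, and the tail of
      \<open>P h\<close> has norm at most \<open>e/2\<close>.\<close>
    define u where "u i = C * (\<bar>b h i\<bar> / (e/2)) powr q + (1/2) ^ (i + 1)" for i
    have u0: "u i \<ge> 0" for i using C by (simp add: u_def)
    have "summable u"
    proof (rule summableI_nonneg_bounded[OF u0])
      fix n
      have "(\<Sum>i<n. u i) = C * ((\<Sum>i<n. \<bar>b h i\<bar> powr q) / (e/2) powr q) + (\<Sum>i<n. (1/2) ^ (i + 1))"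
      proof -
        have "(\<Sum>i<n. (\<bar>b h i\<bar> / E) powr q) = (\<Sum>i<n. \<bar>b h i\<bar> powr q) / E powr q" if "E > 0" for E
          using that by (simp add: powr_divide sum_divide_distrib)
        then show ?thesis using e by (simp only: u_def sum.distrib sum_distrib_left[symmetric] half_gt_zero_iff)
      qed
      also have "\<dots> \<le> C * ((D * c) powr q / (e/2) powr q) + 1"
        using C bsum[OF h c, of n] sum_half_powers_le[of n]
        by (intro add_mono mult_left_mono divide_right_mono) auto
      finally show "(\<Sum>i<n. u i) \<le> C * ((D * c) powr q / (e/2) powr q) + 1" .
    qed
    from suminf_exist_split[OF zero_less_one this] obtain N where
      N: "\<And>n. n \<ge> N \<Longrightarrow> norm (\<Sum>i. u (i + n)) < 1" by blast
    have tail: "(\<Sum>i<n. u (i + N)) \<le> 1" for n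
    proof -
      have "(\<Sum>i<n. u (i + N)) \<le> (\<Sum>i. u (i + N))"
        using u0 \<open>summable u\<close> by (intro sum_le_suminf) (auto simp: summable_iff_shift)
      also have "\<dots> \<le> 1" using N[of N] by simp
      finally show ?thesis .
    qed
    define \<beta> where "\<beta> i = (if i < N then 0 else b h i)" for i
    \<comment> \<open>The coefficients below \<open>N\<close> are zero, but the estimate
      \<open>up\<close> leaves the error \<open>(1/2) ^ (i + 1)\<close> even at
      \<open>s = 0\<close>. Setting \<open>v i 0 = 0\<close> for these indices removes errors that
      the tail bound does not cover.\<close>
    define v where "v i s = (if i < N then (if s = 0 then 0 else C * s powr q + (1/2) ^ (i + 1))
      else C * s powr q + (1/2) ^ (i + 1))" for i and s :: real
    have vsum: "(\<Sum>i<n. v i (\<bar>\<beta> i\<bar> / (e/2))) \<le> 1" for n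
    proof -
      have "(\<Sum>i<n. v i (\<bar>\<beta> i\<bar> / (e/2))) \<le> (\<Sum>i<n + N. v i (\<bar>\<beta> i\<bar> / (e/2)))"
        using C by (intro sum_mono2) (auto simp: v_def)
      also have "\<dots> = (\<Sum>i=N..<n + N. u i)"
      proof (rule sum.mono_neutral_cong_right)
        show "\<forall>i\<in>{..<n + N} - {N..<n + N}. v i (\<bar>\<beta> i\<bar> / (e/2)) = 0"
          by (auto simp: v_def \<beta>_def)
      qed (auto simp: v_def \<beta>_def u_def)
      also have "\<dots> = (\<Sum>i<n. u (i + N))"
        using sum.shift_bounds_nat_ivl[of u 0 N n] by (simp add: atLeast0LessThan)
      also have "\<dots> \<le> 1" by (rule tail)
      finally show ?thesis .
    qed
    have in01: "\<bar>\<beta> i\<bar> / (e/2) \<in> {0..1}" for i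
    proof (cases "i < N")
      case False
      have "u i \<le> (\<Sum>j<Suc (i - N). u (j + N))"
        using False u0 member_le_sum[of "i - N" "{..<Suc (i - N)}" "\<lambda>j. u (j + N)"] by simp
      also have "\<dots> \<le> 1" by (rule tail)
      finally have "C * (\<bar>b h i\<bar> / (e/2)) powr q + (1/2) ^ (i + 1) \<le> 1" by (simp only: u_def)
      moreover have "1 * (\<bar>b h i\<bar> / (e/2)) powr q \<le> C * (\<bar>b h i\<bar> / (e/2)) powr q"
        using C by (intro mult_right_mono) auto
      moreover have "0 \<le> (1/2 :: real) ^ (i + 1)" by simp
      ultimately have "(\<bar>b h i\<bar> / (e/2)) powr q \<le> 1" by linarith
      then have "\<bar>b h i\<bar> / (e/2) \<le> 1" by (rule powr_le_oneD) (use q(1) in simp)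
      then show ?thesis using False e by (simp add: \<beta>_def)
    qed (simp add: \<beta>_def)
    have "modular G (\<lambda>t. \<Sum>i. \<beta> i * z i t) (e/2) \<le> ennreal 1"
    proof (rule modular_suminf_le[where a = \<beta> and u = v and c = "e/2" and D = 1, OF G zm z(2) _ in01 _ _ vsum])
      fix i and s :: real assume s: "s \<in> {0..1}"
      show "dilated G (z i) s \<le> ennreal (v i s)"
        using up(2)[OF s, of i] dilated_zero[OF G] by (auto simp: v_def)
    qed (use e C in \<open>auto simp: v_def\<close>)
    then have "lux_norm G (\<lambda>t. \<Sum>i. \<beta> i * z i t) \<le> e/2"
      using e by (intro lux_norm_le) auto
    moreover have "AE t in I01. P h t - (\<Sum>i<N. b h i / \<nu> i * x i t) = (\<Sum>i. \<beta> i * z i t)"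
      using disjoint_seq_AE[OF z(2)]
    proof eventually_elim
      fix t assume t: "\<forall>i j. i \<noteq> j \<longrightarrow> z i t = 0 \<or> z j t = 0"
      obtain k where k: "\<And>i. i \<noteq> k \<Longrightarrow> z i t = 0" "\<And>\<beta>. (\<Sum>i. \<beta> i * z i t) = \<beta> k * z k t"
        using disjoint_suminf_eq_single[of z t, OF t] by blast
      have "(\<Sum>i<N. b h i / \<nu> i * x i t) = (\<Sum>i<N. b h i * z i t)" by (simp add: x(2))
      also have "\<dots> = (\<Sum>i<N. if i = k then b h i * z i t else 0)"
        using k(1) by (intro sum.cong) auto
      also have "\<dots> = (if k < N then b h k * z k t else 0)" by (subst sum.delta) auto
      finally show "P h t - (\<Sum>i<N. b h i / \<nu> i * x i t) = (\<Sum>i. \<beta> i * z i t)"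
        unfolding P_def k(2) by (simp add: \<beta>_def)
    qed
    then have "lux_norm G (\<lambda>t. P h t - (\<Sum>i<N. b h i / \<nu> i * x i t)) = lux_norm G (\<lambda>t. \<Sum>i. \<beta> i * z i t)"
      by (rule lux_norm_cong_AE)
    ultimately show "\<exists>n a. lux_norm G (\<lambda>t. P h t - (\<Sum>i<n. a i * x i t)) < e"
      using e by (intro exI[of _ N] exI[of _ "\<lambda>i. b h i / \<nu> i"]) simp
  qed
  have blin: "b (\<lambda>s. \<alpha> * f s + \<beta> * g s) i = \<alpha> * b f i + \<beta> * b g i"
    if "f \<in> orlicz_space G" "g \<in> orlicz_space G" for f g \<alpha> \<beta> i
  proof -
    have "b (\<lambda>s. \<alpha> * f s + \<beta> * g s) i = (\<integral>t. \<alpha> * (y i t * f t) + \<beta> * (y i t * g t) \<partial>I01)"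
      by (simp add: b_def algebra_simps)
    then show ?thesis using int[OF that(1), of i] int[OF that(2), of i] by (simp add: b_def)
  qed
  have Plin: "AE t in I01. P (\<lambda>s. \<alpha> * f s + \<beta> * g s) t = \<alpha> * P f t + \<beta> * P g t"
    if fg: "f \<in> orlicz_space G" "g \<in> orlicz_space G" for f g \<alpha> \<beta>
    using disjoint_seq_AE[OF z(2)]
  proof eventually_elim
    fix t assume t: "\<forall>i j. i \<noteq> j \<longrightarrow> z i t = 0 \<or> z j t = 0"
    obtain k where k: "\<And>\<beta>. (\<Sum>i. \<beta> i * z i t) = \<beta> k * z k t"
      using disjoint_suminf_eq_single[of z t, OF t] by blast
    show "P (\<lambda>s. \<alpha> * f s + \<beta> * g s) t = \<alpha> * P f t + \<beta> * P g t"
      unfolding P_def k blin[OF fg] by (simp add: algebra_simps)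
  qed
  have Psum: "AE t in I01. P (\<lambda>t. \<Sum>i<n. a i * x i t) t = (\<Sum>i<n. a i * x i t)" for n a
  proof -
    have "AE t in I01. \<forall>i. x i t = \<nu> i * z i t" using x(3) by (simp add: AE_all_countable)
    moreover note disjoint_seq_AE[OF z(2)]
    ultimately show ?thesis
    proof eventually_elim
      fix t assume xz: "\<forall>i. x i t = \<nu> i * z i t" and t: "\<forall>i j. i \<noteq> j \<longrightarrow> z i t = 0 \<or> z j t = 0"
      obtain k where k: "\<And>i. i \<noteq> k \<Longrightarrow> z i t = 0" "\<And>\<beta>. (\<Sum>i. \<beta> i * z i t) = \<beta> k * z k t"
        using disjoint_suminf_eq_single[of z t, OF t] by blast
      have bx: "b (x j) i = \<nu> j * b (z j) i" for i j
      proof -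
        have "b (x j) i = (\<integral>s. \<nu> j * (y i s * z j s) \<partial>I01)"
          unfolding b_def
        proof (rule integral_cong_AE)
          show "AE s in I01. y i s * x j s = \<nu> j * (y i s * z j s)"
            using x(3)[of j] by eventually_elim simp
        qed (use orlicz_space_measurable[OF x(1)] zm y(1) in auto)
        then show ?thesis by (simp add: b_def)
      qed
      have bz: "b (z j) k = 0" if "j \<noteq> k" for j
      proof -
        have "b (z j) k = (\<integral>s. 0 \<partial>I01)"
          unfolding b_def using cross[of k j] that zm y(1)
          by (intro integral_cong_AE) auto
        then show ?thesis by simp
      qed
      have "b (\<lambda>t. \<Sum>i<n. a i * x i t) k = (\<Sum>i<n. a i * b (x i) k)"
      proof -
        have "b (\<lambda>t. \<Sum>i<n. a i * x i t) k = (\<integral>s. (\<Sum>i<n. a i * (y k s * x i s)) \<partial>I01)"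
          by (simp add: b_def sum_distrib_left algebra_simps)
        also have "\<dots> = (\<Sum>i<n. a i * b (x i) k)"
          unfolding b_def using int[OF x(1), of k] by (subst Bochner_Integration.integral_sum) auto
        finally show ?thesis .
      qed
      also have "\<dots> = (\<Sum>i<n. if i = k then a i * \<nu> i * b (z i) k else 0)"
        using bz by (intro sum.cong) (auto simp: bx)
      also have "\<dots> = (if k < n then a k * \<nu> k * b (z k) k else 0)" by (subst sum.delta) auto
      finally have lhs: "b (\<lambda>t. \<Sum>i<n. a i * x i t) k = (if k < n then a k * \<nu> k * b (z k) k else 0)" .
      have "(\<Sum>i<n. a i * x i t) = (\<Sum>i<n. if i = k then a i * \<nu> i * z i t else 0)"
        using k(1) xz by (intro sum.cong) auto
      also have "\<dots> = (if k < n then a k * \<nu> k * z k t else 0)" by (subst sum.delta) auto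
      finally have rhs: "(\<Sum>i<n. a i * x i t) = (if k < n then a k * \<nu> k * z k t else 0)" .
      \<comment> \<open>Either the pairing is 1 or both sides vanish.\<close>
      have "b (z k) k * z k t = z k t" using bi[of k] by (auto simp: b_def)
      then have "a k * \<nu> k * b (z k) k * z k t = a k * \<nu> k * z k t" by (simp only: mult.assoc)
      then show "P (\<lambda>t. \<Sum>i<n. a i * x i t) t = (\<Sum>i<n. a i * x i t)"
        unfolding P_def k(2) lhs rhs by (cases "k < n") simp_all
    qed
  qed
  have Pid: "lux_norm G (\<lambda>t. P f t - f t) = 0" if f: "f \<in> closed_span G x" for f
  proof (rule antisym)
    have fs: "f \<in> orlicz_space G" using f by (simp add: closed_span_def)
    show "0 \<le> lux_norm G (\<lambda>t. P f t - f t)"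
      by (intro lux_norm_nonneg[OF G] orlicz_space_diff[OF G] Pspace fs)
    show "lux_norm G (\<lambda>t. P f t - f t) \<le> 0"
    proof (rule field_le_epsilon)
      fix e :: real assume e: "e > 0"
      \<comment> \<open>The bound of \<open>P\<close> plus 1 for the identity:
        \<open>P f - f = P r - r\<close>, where \<open>r\<close> is the error in approximating
        \<open>f\<close> by a finite combination, which \<open>P\<close> fixes.\<close>
      define K where "K = (C + 1) * D + 1"
      have K: "K > 0" using C D by (simp add: K_def add_pos_pos)
      then have "e / K > 0" using e by simp
      then obtain n a where na: "lux_norm G (\<lambda>t. f t - (\<Sum>i<n. a i * x i t)) < e / K"
        using f unfolding closed_span_def by blast
      define s where "s = (\<lambda>t. \<Sum>i<n. a i * x i t)"
      define r where "r = (\<lambda>t. f t - s t)"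
      have ss: "s \<in> orlicz_space G" unfolding s_def using x(1) by (intro orlicz_space_sum[OF G]) auto
      have rs: "r \<in> orlicz_space G" unfolding r_def by (intro orlicz_space_diff[OF G] fs ss)
      have "AE t in I01. P f t - f t = P r t + (-1) * r t"
        using Psum[where n = n and a = a] Plin[OF fs ss, where \<alpha> = 1 and \<beta> = "-1"]
      proof eventually_elim
        fix t assume "P (\<lambda>t. \<Sum>i<n. a i * x i t) t = (\<Sum>i<n. a i * x i t)"
          and "P (\<lambda>u. 1 * f u + -1 * s u) t = 1 * P f t + -1 * P s t"
        then have "P s t = s t" "P r t = P f t - P s t"
          by (simp_all add: s_def r_def)
        then show "P f t - f t = P r t + (-1) * r t" by (simp add: r_def)
      qed
      then have "lux_norm G (\<lambda>t. P f t - f t) = lux_norm G (\<lambda>t. P r t + (-1) * r t)"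
        by (rule lux_norm_cong_AE)
      also have "\<dots> \<le> lux_norm G (P r) + lux_norm G (\<lambda>t. (-1) * r t)"
        by (intro lux_norm_triangle[OF G] Pspace rs orlicz_space_scale[OF G])
      also have "\<dots> \<le> (C + 1) * D * lux_norm G r + lux_norm G r"
        using Pbound[OF rs] lux_norm_scale[OF G rs, of "-1"] by simp
      also have "\<dots> = K * lux_norm G r" by (simp add: K_def algebra_simps)
      also have "\<dots> \<le> K * (e / K)"
        using K na by (intro mult_left_mono) (auto simp: r_def s_def)
      also have "\<dots> = e" using K by simp
      finally show "lux_norm G (\<lambda>t. P f t - f t) \<le> 0 + e" by simp
    qed
  qed
  show ?thesis
    unfolding complemented_def
  proof (intro exI[of _ P] exI[of _ "(C + 1) * D"] conjI ballI allI)
    show "0 \<le> (C + 1) * D" using C D by simp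
    fix f g and \<alpha> \<beta> :: real assume "f \<in> orlicz_space G" "g \<in> orlicz_space G"
    then have "AE t in I01. P (\<lambda>s. \<alpha> * f s + \<beta> * g s) t - (\<alpha> * P f t + \<beta> * P g t) = 0"
      using Plin[of f g \<alpha> \<beta>] by simp
    from lux_norm_cong_AE[OF this]
    show "lux_norm G (\<lambda>t. P (\<lambda>s. \<alpha> * f s + \<beta> * g s) t - (\<alpha> * P f t + \<beta> * P g t)) = 0"
      using lux_norm_zero[OF G] by simp
  qed (use Pspan Pbound Pid in auto)
qed

text \<open>The lower bound for \<open>G\<close> enters through doubling: normalized functions
  \<open>z n\<close> get modular exactly 1, and this modular is the pairing of \<open>y n\<close>
  with \<open>z n\<close>. The two upper bounds control the coefficients and the series.\<close>

theorem power_bounds_imp_DC: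
  assumes F: "orlicz_function F" and G: "orlicz_function G"
    and FG: "young_conjugate F G" and GF: "young_conjugate G F"
    and pq: "1 < p" "1 / p + 1 / q = 1" and K: "1 \<le> K"
    and UF: "power_upper F p K" and UG: "power_upper G q K" and LG: "power_lower G q K"
  shows "DC G"
  unfolding DC_def
proof (intro allI impI)
  fix x assume "(\<forall>n. x n \<in> orlicz_space G) \<and> disjoint_seq x"
  then have x: "\<And>n. x n \<in> orlicz_space G" and dx: "disjoint_seq x" by auto
  note q = conjugate_exponent[OF pq]
  obtain B Y where dbl: "Y > 0" "\<And>y. y \<ge> Y \<Longrightarrow> G (2 * y) \<le> B * G y"
    using power_lower_doubling[OF G LG] by blast
  \<comment> \<open>A function of norm zero gets \<open>z n = 0\<close>, as division by zero yields
    0; the same convention makes \<open>y n\<close> vanish off the support of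
    \<open>z n\<close>.\<close>
  define \<nu> where "\<nu> n = lux_norm G (x n)" for n
  define z where "z n = (\<lambda>t. x n t / \<nu> n)" for n
  define y where "y n = (\<lambda>t. G \<bar>z n t\<bar> / z n t)" for n
  have zs: "z n \<in> orlicz_space G" for n
    using orlicz_space_scale[OF G x, of "1 / \<nu> n" n] by (simp add: z_def)
  note zm = orlicz_space_measurable[OF zs]
  have ym: "y n \<in> borel_measurable I01" for n
    unfolding y_def using orlicz_measurable[OF G zm, of n] zm by (intro borel_measurable_divide) auto
  have pair: "AE t in I01. x i t = 0 \<or> x j t = 0" if "i \<noteq> j" for i j
    using dx that by (simp add: disjoint_seq_def)
  have dz: "disjoint_seq z" unfolding disjoint_seq_def
  proof (intro allI impI)
    fix i j :: nat assume "i \<noteq> j"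
    from pair[OF this] show "AE t in I01. z i t = 0 \<or> z j t = 0"
      by eventually_elim (auto simp: z_def)
  qed
  have dy: "disjoint_seq y" unfolding disjoint_seq_def
  proof (intro allI impI)
    fix i j :: nat assume "i \<noteq> j"
    from pair[OF this] show "AE t in I01. y i t = 0 \<or> y j t = 0"
      by eventually_elim (auto simp: y_def z_def)
  qed
  have zone: "modular G (z n) 1 = 1" if "\<nu> n \<noteq> 0" for n
  proof (rule modular_eq_one[OF G zs _ dbl])
    have "lux_norm G (z n) = \<bar>1 / \<nu> n\<bar> * \<nu> n"
      using lux_norm_scale[OF G x, of "1 / \<nu> n" n] by (simp add: z_def \<nu>_def)
    then show "lux_norm G (z n) = 1"
      using that lux_norm_nonneg[OF G x, of n] by (simp add: \<nu>_def)
  qed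
  have zzero: "z n = (\<lambda>_. 0)" if "\<nu> n = 0" for n using that by (simp add: z_def)
  have zle: "modular G (z n) 1 \<le> 1" for n
    using zone[of n] zzero[of n] modular_zero[OF G, of 1] by (cases "\<nu> n = 0") auto
  have yle: "modular F (y n) 1 \<le> 1" for n
  proof -
    have "modular F (y n) 1 \<le> modular G (z n) 1"
      unfolding modular_def
    proof (intro nn_integral_mono ennreal_leI)
      fix t
      show "F (\<bar>y n t\<bar> / 1) \<le> G (\<bar>z n t\<bar> / 1)"
      proof (cases "z n t = 0")
        case False
        have "\<bar>y n t\<bar> = G \<bar>z n t\<bar> / \<bar>z n t\<bar>"
          using orlicz_nonneg[OF G, of "\<bar>z n t\<bar>"] by (simp add: y_def abs_divide)
        then show ?thesis using conjugate_ratio_le[OF G GF, of "\<bar>z n t\<bar>"] False by simp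
      qed (simp add: y_def orlicz_zero[OF F] orlicz_zero[OF G])
    qed
    then show ?thesis using zle by (rule order_trans)
  qed
  have bi: "(\<integral>t. y n t * z n t \<partial>I01) = 1 \<or> z n = (\<lambda>_. 0)" for n
  proof (cases "\<nu> n = 0")
    case False
    have "y n t * z n t = G \<bar>z n t\<bar>" for t
      using orlicz_zero[OF G] by (simp add: y_def)
    then have "(\<integral>t. y n t * z n t \<partial>I01) = enn2real (\<integral>\<^sup>+ t. ennreal (G \<bar>z n t\<bar>) \<partial>I01)"
      using orlicz_measurable[OF G zm, of n] orlicz_nonneg[OF G]
      by (simp add: integral_eq_nn_integral)
    then show ?thesis using zone[OF False] by (simp add: modular_def)
  qed (simp add: zzero)
  have cross: "AE t in I01. y i t * z j t = 0" if "i \<noteq> j" for i j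
    using pair[OF that] by eventually_elim (auto simp: y_def z_def)
  have xz: "AE t in I01. x n t = \<nu> n * z n t" for n
  proof (cases "\<nu> n = 0")
    case True
    then show ?thesis using lux_norm_eq_0_AE[OF G x, of n] by (simp add: \<nu>_def)
  qed (simp add: z_def)
  define Q where "Q k n \<longleftrightarrow> (\<forall>s\<in>{0..1}. dilated F (y n) s \<le> ennreal (K * 2 powr p * s powr p + (1/2) ^ (k + 1)))
      \<and> (\<forall>s\<in>{0..1}. dilated G (z n) s \<le> ennreal (K * 2 powr q * s powr q + (1/2) ^ (k + 1)))" for k n
  have "\<forall>\<^sub>F n in sequentially. Q k n" for k
    unfolding Q_def
    using K pq q(1) yle zle by (intro eventually_conj eventually_dilated_le[OF F UF _ _ ym dy]
        eventually_dilated_le[OF G UG _ _ zm dz]) auto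
  from eventually_diagonal_subseq[of Q, OF this] obtain \<phi> where \<phi>: "strict_mono \<phi>" "\<And>k. Q k (\<phi> k)"
    by blast
  have inj: "inj \<phi>" using strict_mono_imp_inj_on[OF \<phi>(1)] .
  define C where "C = max (K * 2 powr p) (K * 2 powr q)"
  have "complemented G (closed_span G (x \<circ> \<phi>))"
  proof (rule complemented_of_biorthogonal[OF F G FG pq, where C = C and y = "y \<circ> \<phi>" and z = "z \<circ> \<phi>" and \<nu> = "\<nu> \<circ> \<phi>"])
    show "1 \<le> C" using power_constant_ge_one[OF K, of p] pq by (simp add: C_def)
    show "disjoint_seq (y \<circ> \<phi>)" "disjoint_seq (z \<circ> \<phi>)"
      using dy dz inj by (auto intro: disjoint_seq_subseq)
    fix i
    show "AE t in I01. (x \<circ> \<phi>) i t = (\<nu> \<circ> \<phi>) i * (z \<circ> \<phi>) i t" using xz by simp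
    show "(\<integral>t. (y \<circ> \<phi>) i t * (z \<circ> \<phi>) i t \<partial>I01) = 1 \<or> (z \<circ> \<phi>) i = (\<lambda>_. 0)" using bi by simp
    show "AE t in I01. (y \<circ> \<phi>) i t * (z \<circ> \<phi>) j t = 0" if "i \<noteq> j" for j
      using cross[of "\<phi> i" "\<phi> j"] that injD[OF inj, of i j] by auto
    show "(y \<circ> \<phi>) i \<in> borel_measurable I01" "modular F ((y \<circ> \<phi>) i) 1 \<le> 1"
      "(z \<circ> \<phi>) i \<in> orlicz_space G" "(x \<circ> \<phi>) i \<in> orlicz_space G"
      using ym yle zs x by simp_all
    show "(z \<circ> \<phi>) i t = (x \<circ> \<phi>) i t / (\<nu> \<circ> \<phi>) i" for t by (simp add: z_def)
    fix s :: real assume s: "s \<in> {0..1}"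
    have le: "ennreal (A * s powr r + (1/2) ^ (i + 1)) \<le> ennreal (C * s powr r + (1/2) ^ (i + 1))" if "A \<le> C" for A r
      using that by (intro ennreal_leI add_right_mono mult_right_mono) auto
    show "dilated F ((y \<circ> \<phi>) i) s \<le> ennreal (C * s powr p + (1/2) ^ (i + 1))"
    proof -
      have "dilated F (y (\<phi> i)) s \<le> ennreal (K * 2 powr p * s powr p + (1/2) ^ (i + 1))"
        using \<phi>(2)[of i] s unfolding Q_def by blast
      also have "\<dots> \<le> ennreal (C * s powr p + (1/2) ^ (i + 1))" by (rule le) (simp add: C_def)
      finally show ?thesis by simp
    qed
    show "dilated G ((z \<circ> \<phi>) i) s \<le> ennreal (C * s powr q + (1/2) ^ (i + 1))"
    proof -
      have "dilated G (z (\<phi> i)) s \<le> ennreal (K * 2 powr q * s powr q + (1/2) ^ (i + 1))"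
        using \<phi>(2)[of i] s unfolding Q_def by blast
      also have "\<dots> \<le> ennreal (C * s powr q + (1/2) ^ (i + 1))" by (rule le) (simp add: C_def)
      finally show ?thesis by simp
    qed
  qed
  then show "\<exists>\<phi>. strict_mono \<phi> \<and> complemented G (closed_span G (x \<circ> \<phi>))"
    using \<phi>(1) by blast
qed

section \<open>Step functions on disjoint intervals\<close>

text \<open>A left-anchored piece of the dyadic interval from \<open>(1/2) ^ (k + 1)\<close> to
  \<open>(1/2) ^ k\<close>. Any lengths \<open>l k \<le> (1/2) ^ (k + 1)\<close> can thus be
  realized simultaneously by disjoint sets.\<close>

definition slot :: "(nat \<Rightarrow> real) \<Rightarrow> nat \<Rightarrow> real set" where
  "slot l k = {(1/2) ^ (k + 1) <.. (1/2) ^ (k + 1) + l k}"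

definition step :: "(nat \<Rightarrow> real) \<Rightarrow> nat set \<Rightarrow> (nat \<Rightarrow> real) \<Rightarrow> real \<Rightarrow> real" where
  "step l T c t = (\<Sum>k\<in>T. c k * indicator (slot l k) t)"

definition slot_lengths :: "(nat \<Rightarrow> real) \<Rightarrow> bool" where
  "slot_lengths l \<longleftrightarrow> (\<forall>k. 0 < l k \<and> l k \<le> (1/2) ^ (k + 1))"

lemma slot_lengths_pos: "slot_lengths l \<Longrightarrow> 0 < l k"
  by (simp add: slot_lengths_def)

lemma slot_subset_dyadic:
  assumes "slot_lengths l" shows "slot l k \<subseteq> {(1/2) ^ Suc k <.. (1/2) ^ k}"
proof -
  have "l k \<le> (1/2) ^ (k + 1)" using assms by (simp add: slot_lengths_def)
  then show ?thesis by (auto simp: slot_def)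
qed

lemma slot_subset: 
  assumes "slot_lengths l" shows "slot l k \<subseteq> {0..1}"
proof
  fix t assume "t \<in> slot l k"
  then have "(1/2) ^ Suc k < t" "t \<le> (1/2) ^ k" using slot_subset_dyadic[OF assms, of k] by auto
  moreover have "(1/2::real) ^ k \<le> 1" by (simp add: power_le_one)
  moreover have "(0::real) \<le> (1/2) ^ Suc k" by simp
  ultimately show "t \<in> {0..1}" by auto
qed

lemma slot_disjoint:
  assumes "slot_lengths l" "j \<noteq> k" "t \<in> slot l j" shows "t \<notin> slot l k"
proof -
  have less: False if "i < n" "t \<in> slot l i" "t \<in> slot l n" for i n
  proof -
    have "(1/2) ^ Suc i < t" "t \<le> (1/2) ^ n" 
      using subsetD[OF slot_subset_dyadic[OF assms(1)], of t i] subsetD[OF slot_subset_dyadic[OF assms(1)], of t n] that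
      by auto
    moreover have "(1/2::real) ^ n \<le> (1/2) ^ Suc i" using that(1) by (intro power_decreasing) auto
    ultimately show False by simp
  qed
  show ?thesis using less[of j k] less[of k j] assms(2,3) by (meson linorder_neqE_nat)
qed

lemma slot_sets [measurable]: "slot_lengths l \<Longrightarrow> slot l k \<in> sets I01"
  using slot_subset[of l k] by (subst sets_restrict_space_iff) (auto simp: slot_def)

lemma emeasure_slot:
  assumes "slot_lengths l" shows "emeasure I01 (slot l k) = ennreal (l k)"
proof -
  have "emeasure I01 (slot l k) = emeasure lebesgue (slot l k)"
    using slot_subset[OF assms] by (intro emeasure_restrict_space) auto
  also have "\<dots> = emeasure lborel (slot l k)" by (simp add: slot_def)
  also have "\<dots> = ennreal (l k)"
    using slot_lengths_pos[OF assms, of k] by (simp add: slot_def)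
  finally show ?thesis .
qed

lemma measure_slot:
  assumes "slot_lengths l" shows "measure I01 (slot l k) = l k"
  using slot_lengths_pos[OF assms, of k] by (simp add: measure_def emeasure_slot[OF assms])

lemma step_eq:
  assumes "slot_lengths l" "finite T" "t \<in> slot l k"
  shows "step l T c t = (if k \<in> T then c k else 0)"
proof -
  have "step l T c t = (\<Sum>j\<in>T. if j = k then c j else 0)"
    unfolding step_def
    using slot_disjoint[OF assms(1) _ assms(3)] assms(3) by (intro sum.cong) (auto simp: indicator_def)
  then show ?thesis using assms(2) by simp
qed

lemma step_eq_0: "\<forall>k\<in>T. t \<notin> slot l k \<Longrightarrow> step l T c t = 0"
  unfolding step_def by (intro sum.neutral) (auto simp: indicator_def)

lemma step_measurable:
  assumes "slot_lengths l" shows "step l T c \<in> borel_measurable I01"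
proof -
  have "(\<lambda>t. \<Sum>k\<in>T. c k * indicator (slot l k) t) \<in> borel_measurable I01"
    using slot_sets[OF assms] by (intro borel_measurable_sum borel_measurable_times) auto
  then show ?thesis by (simp add: step_def[abs_def])
qed

lemma dilated_step:
  assumes F: "orlicz_function F" and l: "slot_lengths l" and T: "finite T" and s: "0 \<le> s"
  shows "dilated F (step l T c) s = ennreal (\<Sum>k\<in>T. F (s * \<bar>c k\<bar>) * l k)"
proof -
  have "dilated F (step l T c) s = modular F (\<lambda>t. \<Sum>k\<in>T. (s * c k) * indicator (slot l k) t) 1"
    unfolding dilated_def modular_def
    using s by (simp add: step_def abs_mult sum_distrib_left[symmetric] mult.assoc)
  also have "\<dots> = (\<Sum>k\<in>T. dilated F (indicator (slot l k)) (\<bar>s * c k\<bar> / 1))"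
  proof (rule modular_disjoint_sum[OF F _ T])
    show "disjoint_seq (\<lambda>k. indicator (slot l k))"
      using slot_disjoint[OF l] by (auto simp: disjoint_seq_def indicator_def)
  qed (use slot_sets[OF l] in auto)
  also have "\<dots> = (\<Sum>k\<in>T. ennreal (F (s * \<bar>c k\<bar>) * l k))"
  proof (rule sum.cong[OF refl])
    fix k
    have "dilated F (indicator (slot l k)) r = (\<integral>\<^sup>+ t. ennreal (F r) * indicator (slot l k) t \<partial>I01)" for r
      unfolding dilated_def by (intro nn_integral_cong) (auto simp: indicator_def orlicz_zero[OF F])
    then show "dilated F (indicator (slot l k)) (\<bar>s * c k\<bar> / 1) = ennreal (F (s * \<bar>c k\<bar>) * l k)"
      using slot_sets[OF l] slot_lengths_pos[OF l, of k] s orlicz_nonneg[OF F, of "s * \<bar>c k\<bar>"]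
      by (simp add: nn_integral_cmult emeasure_slot[OF l] ennreal_mult abs_mult less_imp_le)
  qed
  also have "\<dots> = ennreal (\<Sum>k\<in>T. F (s * \<bar>c k\<bar>) * l k)"
    using s slot_lengths_pos[OF l] orlicz_nonneg[OF F] by (intro sum_ennreal) (simp add: less_imp_le)
  finally show ?thesis .
qed

lemma modular_step:
  assumes "orlicz_function F" "slot_lengths l" "finite T" "0 < e"
  shows "modular F (step l T c) e = ennreal (\<Sum>k\<in>T. F (\<bar>c k\<bar> / e) * l k)"
  unfolding modular_eq_dilated using dilated_step[OF assms(1,2,3), of "1 / e"] assms(4) by simp

lemma step_in_orlicz_space:
  assumes "orlicz_function F" "slot_lengths l" "finite T"
  shows "step l T c \<in> orlicz_space F"
  unfolding orlicz_space_def
  using step_measurable[OF assms(2)] modular_step[OF assms, of 1] by (auto intro!: exI[of _ 1])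

lemma step_mult:
  assumes "slot_lengths l" "finite T" "finite T'"
  shows "step l T c t * step l T' d t = step l (T \<inter> T') (\<lambda>k. c k * d k) t"
proof (cases "\<exists>k. t \<in> slot l k")
  case True
  then obtain k where "t \<in> slot l k" by blast
  then show ?thesis using assms by (simp add: step_eq)
qed (simp add: step_eq_0)

lemma integral_step:
  assumes "slot_lengths l"
  shows "(\<integral>t. step l T c t \<partial>I01) = (\<Sum>k\<in>T. c k * l k)" "integrable I01 (step l T c)"
proof -
  have int: "integrable I01 (\<lambda>t. c k * indicator (slot l k) t :: real)" for k
    using slot_sets[OF assms, of k] emeasure_slot[OF assms, of k] 
    by (intro integrable_mult_right integrable_real_indicator) auto
  show "integrable I01 (step l T c)"
    unfolding step_def[abs_def] using int by (intro Bochner_Integration.integrable_sum)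
  have "(\<integral>t. step l T c t \<partial>I01) = (\<Sum>k\<in>T. \<integral>t. c k * indicator (slot l k) t \<partial>I01)"
    unfolding step_def using int by (intro Bochner_Integration.integral_sum)
  also have "\<dots> = (\<Sum>k\<in>T. c k * l k)"
    using measure_slot[OF assms] slot_subset[OF assms] by (simp add: Int_absorb2)
  finally show "(\<integral>t. step l T c t \<partial>I01) = (\<Sum>k\<in>T. c k * l k)" .
qed

lemma disjoint_seq_step:
  assumes l: "slot_lengths l" and B: "\<And>i. finite (B i)" "\<And>i j. i \<noteq> j \<Longrightarrow> B i \<inter> B j = {}"
  shows "disjoint_seq (\<lambda>i. step l (B i) (c i))"
  unfolding disjoint_seq_def
proof (intro allI impI AE_I2)
  fix i j :: nat and t assume "i \<noteq> j"
  show "step l (B i) (c i) t = 0 \<or> step l (B j) (c j) t = 0"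
  proof (cases "\<exists>k. t \<in> slot l k")
    case True
    then obtain k where k: "t \<in> slot l k" by blast
    have "k \<notin> B i \<or> k \<notin> B j" using B(2)[OF \<open>i \<noteq> j\<close>] by blast
    then show ?thesis using step_eq[OF l B(1) k] by auto
  qed (simp add: step_eq_0)
qed

lemma modular_step_combination:
  fixes B :: "nat \<Rightarrow> nat set"
  assumes F: "orlicz_function F" and l: "slot_lengths l"
    and B: "\<And>i. finite (B i)" "\<And>i j. i \<noteq> j \<Longrightarrow> B i \<inter> B j = {}" and S: "finite S" and e: "e > 0"
  shows "modular F (\<lambda>t. \<Sum>i\<in>S. a i * step l (B i) (c i) t) e
    = ennreal (\<Sum>i\<in>S. \<Sum>k\<in>B i. F (\<bar>a i\<bar> / e * \<bar>c i k\<bar>) * l k)"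
proof -
  have s: "0 \<le> \<bar>a i\<bar> / e" for i using e by simp
  have nn: "0 \<le> (\<Sum>k\<in>B i. F (\<bar>a i\<bar> / e * \<bar>c i k\<bar>) * l k)" for i
    by (intro sum_nonneg mult_nonneg_nonneg orlicz_nonneg[OF F] s abs_ge_zero
        less_imp_le[OF slot_lengths_pos[OF l]])
  have "modular F (\<lambda>t. \<Sum>i\<in>S. a i * step l (B i) (c i) t) e
      = (\<Sum>i\<in>S. dilated F (step l (B i) (c i)) (\<bar>a i\<bar> / e))"
    by (rule modular_disjoint_sum[OF F step_measurable[OF l] S disjoint_seq_step[where B = B, OF l B] e])
  then show ?thesis by (simp only: dilated_step[OF F l B(1) s] sum_ennreal[OF nn])
qed

text \<open>A scale \<open>c < 1\<close> with modular at most 1 would, by contraction with factor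
  \<open>c\<close>, leave modular at most \<open>c\<close> at scale 1.\<close>

lemma lux_norm_eq_1:
  assumes F: "orlicz_function F" and f: "f \<in> borel_measurable I01" and m: "modular F f 1 = 1"
  shows "f \<in> orlicz_space F" "lux_norm F f = 1"
proof -
  show fs: "f \<in> orlicz_space F" using m f by (intro orlicz_spaceI[of _ 1]) auto
  show "lux_norm F f = 1"
  proof (rule antisym)
    show "lux_norm F f \<le> 1" using m by (intro lux_norm_le) auto
    show "1 \<le> lux_norm F f"
    proof (rule lux_norm_ge[OF F fs])
      fix c :: real assume c: "c > 0" "modular F f c \<le> 1"
      show "1 \<le> c"
      proof (rule ccontr)
        assume "\<not> 1 \<le> c"
        then have "c < 1" by simp
        have "1 = dilated F f (c * (1 / c))" using c m by (simp add: modular_eq_dilated)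
        also have "\<dots> \<le> ennreal c * dilated F f (1 / c)"
          using c \<open>c < 1\<close> by (intro dilated_contract[OF F f]) auto
        also have "\<dots> \<le> ennreal c * 1"
          using c by (intro mult_left_mono) (auto simp: modular_eq_dilated)
        also have "\<dots> < 1" using \<open>c < 1\<close> by simp
        finally show False by simp
      qed
    qed
  qed
qed

lemma normed_disjoint_step:
  assumes F: "orlicz_function F" and l: "slot_lengths l"
    and B: "\<And>i. finite (B i)" "\<And>i j. i \<noteq> j \<Longrightarrow> B i \<inter> B j = {}"
    and one: "\<And>i. (\<Sum>k\<in>B i. F \<bar>v k\<bar> * l k) = 1"
  shows "normed_disjoint_seq F (\<lambda>i. step l (B i) v)"
proof -
  have "modular F (step l (B i) v) 1 = 1" for i
    using modular_step[OF F l B(1), of 1 i v] one by simp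
  then show ?thesis
    unfolding normed_disjoint_seq_def
    using lux_norm_eq_1[OF F step_measurable[OF l], of "B i" v for i] disjoint_seq_step[OF l B, where c = "\<lambda>_. v"]
    by simp
qed

section \<open>Consequences of disjoint homogeneity\<close>

lemma lr_norm_const_block:
  assumes "r > 0" "s > 0"
  shows "lr_norm r (\<lambda>i. if N \<le> i then s else 0) (N + m) = s * real m powr (1 / r)"
proof -
  have "(\<Sum>i<N + m. \<bar>if N \<le> i then s else 0\<bar> powr r) = (\<Sum>i\<in>{N..<N + m}. s powr r)"
    using assms by (intro sum.mono_neutral_cong_right) auto
  then show ?thesis
    using assms by (simp add: lr_norm_def powr_mult powr_powr)
qed

lemma modular_const_block:
  assumes F: "orlicz_function F" and y: "\<And>i. y i \<in> borel_measurable I01" and d: "disjoint_seq y"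
    and s: "s > 0"
  shows "modular F (\<lambda>t. \<Sum>i<N + m. (if N \<le> i then s else 0) * y i t) 1
    = (\<Sum>i\<in>{N..<N + m}. dilated F (y i) s)"
proof -
  have "modular F (\<lambda>t. \<Sum>i<N + m. (if N \<le> i then s else 0) * y i t) 1
      = (\<Sum>i<N + m. dilated F (y i) (\<bar>if N \<le> i then s else 0\<bar> / 1))"
    using y d by (intro modular_disjoint_sum[OF F]) auto
  also have "\<dots> = (\<Sum>i\<in>{N..<N + m}. dilated F (y i) s)"
    using s dilated_zero[OF F] by (intro sum.mono_neutral_cong_right) auto
  finally show ?thesis .
qed

lemma normed_disjoint_subseq:
  assumes "normed_disjoint_seq F x" "strict_mono \<phi>"
  shows "normed_disjoint_seq F (x \<circ> \<phi>)"
  using assms disjoint_seq_subseq[OF _ strict_mono_imp_inj_on[OF assms(2)]]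
  by (simp add: normed_disjoint_seq_def)

text \<open>A block of \<open>m\<close> coefficients \<open>s\<close> after \<open>N\<close> zeros
  has r-norm \<open>s * m powr (1 / r)\<close>, so an equivalence with constant \<open>C\<close> can
  decide on which side of 1 its modular lies. The contradictions in this section compare a computed
  modular of a block with this growth.\<close>

lemma equiv_lr_block:
  assumes F: "orlicz_function F" and n: "normed_disjoint_seq F y"
    and r: "r > 0" and s: "s > 0" and e: "equiv_lr F r C y"
  shows "C * (s * real m powr (1 / r)) < 1 \<Longrightarrow> (\<Sum>i\<in>{N..<N + m}. dilated F (y i) s) \<le> 1"
    and "s * real m powr (1 / r) / C > 1 \<Longrightarrow> \<not> (\<Sum>i\<in>{N..<N + m}. dilated F (y i) s) \<le> 1"
proof -
  have y: "\<And>i. y i \<in> orlicz_space F" and d: "disjoint_seq y"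
    using n by (simp_all add: normed_disjoint_seq_def)
  define a where "a i = (if N \<le> i then s else 0)" for i
  define S where "S = (\<lambda>t. \<Sum>i<N + m. a i * y i t)"
  have lr: "lr_norm r a (N + m) = s * real m powr (1 / r)"
    using lr_norm_const_block[OF r s] by (simp add: a_def[abs_def])
  have S: "S \<in> orlicz_space F" unfolding S_def using y by (intro orlicz_space_sum[OF F]) auto
  have mod: "modular F S 1 = (\<Sum>i\<in>{N..<N + m}. dilated F (y i) s)"
    using modular_const_block[OF F orlicz_space_measurable[OF y] d s] by (simp add: S_def a_def)
  have "lux_norm F S \<le> C * lr_norm r a (N + m)" "lr_norm r a (N + m) / C \<le> lux_norm F S"
    using e unfolding equiv_lr_def S_def by blast+
  then have b: "lux_norm F S \<le> C * (s * real m powr (1 / r))" "s * real m powr (1 / r) / C \<le> lux_norm F S"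
    unfolding lr by auto
  show "(\<Sum>i\<in>{N..<N + m}. dilated F (y i) s) \<le> 1" if "C * (s * real m powr (1 / r)) < 1"
    using modular_le_one[OF F S, of 1] b(1) that mod by simp
  show "\<not> (\<Sum>i\<in>{N..<N + m}. dilated F (y i) s) \<le> 1" if "s * real m powr (1 / r) / C > 1"
    using lux_norm_le[of 1 F S] b(2) that mod by auto
qed

text \<open>The growth condition makes a set of measure \<open>1 / F z\<close> fit into the k-th
  dyadic interval. It is recorded for all \<open>z \<ge> y k\<close> because peaks may be placed at
  a multiple of \<open>y k\<close>.\<close>

lemma choose_large:
  assumes F: "orlicz_function F" and Q: "\<And>(k::nat) Y. \<exists>y\<ge>Y. Q k y"
  obtains y where "\<And>k. y k \<ge> 1" "\<And>k z. z \<ge> y k \<Longrightarrow> F z \<ge> 2 ^ (k + 1)" "\<And>k. Q k (y k)"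
proof -
  have "\<exists>y\<ge>1. (\<forall>z\<ge>y. F z \<ge> 2 ^ (k + 1)) \<and> Q k y" for k
  proof -
    obtain Y where Y: "\<And>y. y \<ge> Y \<Longrightarrow> F y > 2 ^ (k + 1)"
      using orlicz_eventually_gt[OF F, of "2 ^ (k + 1)"] by blast
    obtain y where "y \<ge> max 1 Y" "Q k y" using Q by blast
    then show ?thesis using less_imp_le[OF Y] by (intro exI[of _ y]) auto
  qed
  then show ?thesis using that by metis
qed

text \<open>Height \<open>v i\<close> on length \<open>1 / F (v i)\<close> has modular 1, and
  dilating it produces exactly a quotient of values of \<open>F\<close>: asymptotics of
  \<open>F\<close> become statements on disjoint sequences.\<close>

lemma peak_sequence:
  assumes F: "orlicz_function F" and v: "\<And>i. v i > 0" "\<And>i. F (v i) \<ge> 2 ^ (i + 1)"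
  obtains x where "normed_disjoint_seq F x"
    "\<And>i s. 0 \<le> s \<Longrightarrow> dilated F (x i) s = ennreal (F (s * v i) / F (v i))"
proof -
  define l where "l i = 1 / F (v i)" for i
  have Fv: "F (v i) > 0" for i using v(2)[of i] by (smt (verit) zero_less_power)
  have l: "slot_lengths l"
    unfolding slot_lengths_def
  proof
    fix k
    have "1 / F (v k) \<le> 1 / 2 ^ (k + 1)" using v(2) by (intro divide_left_mono) (auto simp: Fv)
    then show "0 < l k \<and> l k \<le> (1/2) ^ (k + 1)" using Fv[of k] by (simp add: l_def power_one_over)
  qed
  show ?thesis
  proof (rule that[of "\<lambda>i. step l {i} v"])
    show "normed_disjoint_seq F (\<lambda>i. step l {i} v)"
    proof (rule normed_disjoint_step[OF F l])
      show "(\<Sum>k\<in>{i}. F \<bar>v k\<bar> * l k) = 1" for i using v(1)[of i] Fv[of i] by (simp add: l_def)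
    qed auto
    show "dilated F (step l {i} v) s = ennreal (F (s * v i) / F (v i))" if "0 \<le> s" for i s
      using dilated_step[OF F l _ that, of "{i}" v] v(1)[of i] by (simp add: l_def)
  qed
qed

text \<open>Without doubling there are peaks of heights \<open>2 * y i\<close> whose halves have
  modular at most \<open>(1/2) ^ (i + 1)\<close>. Sums of arbitrarily many halves then keep modular
  at most 1, against the growth \<open>m powr (1 / r)\<close>.\<close>

theorem DH_imp_doubling:
  assumes F: "orlicz_function F" and DH: "DH F r" and r: "r > 0"
  shows "\<exists>B. \<exists>Y>0. \<forall>y\<ge>Y. F (2 * y) \<le> B * F y"
proof (rule ccontr)
  assume neg: "\<not> ?thesis"
  have ex: "\<exists>y\<ge>Y. F (2 * y) > 2 ^ (i + 1) * F y" for i :: nat and Y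
  proof -
    have "max 1 Y > 0" by simp
    then obtain y where "y \<ge> max 1 Y" "F (2 * y) > 2 ^ (i + 1) * F y" using neg by (meson not_le)
    then show ?thesis by auto
  qed
  obtain y where y: "\<And>i. y i \<ge> 1" "\<And>i. F (2 * y i) > 2 ^ (i + 1) * F (y i)"
    and large: "\<And>i z. z \<ge> y i \<Longrightarrow> F z \<ge> 2 ^ (i + 1)"
    by (rule choose_large[where Q = "\<lambda>i y. F (2 * y) > 2 ^ (i + 1) * F y", OF F ex]) (rule that; assumption)
  have y3: "F (2 * y i) \<ge> 2 ^ (i + 1)" for i by (rule large) (use y(1)[of i] in simp)
  have pos: "2 * y i > 0" for i using y(1)[of i] by simp
  obtain x where x: "normed_disjoint_seq F x"
    "\<And>i s. 0 \<le> s \<Longrightarrow> dilated F (x i) s = ennreal (F (s * (2 * y i)) / F (2 * y i))"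
    using peak_sequence[OF F, of "\<lambda>i. 2 * y i", OF pos y3] by blast
  obtain \<phi> C where \<phi>: "strict_mono \<phi>" "equiv_lr F r C (x \<circ> \<phi>)"
    using DH x(1) unfolding DH_def by blast
  have C: "C > 0" using \<phi>(2) by (simp add: equiv_lr_def)
  have small: "dilated F (x i) (1/2) \<le> ennreal ((1/2) ^ (i + 1))" for i
  proof -
    have "F (y i) * 2 ^ (i + 1) \<le> F (2 * y i)" using y(2)[of i] by (simp add: mult.commute)
    moreover have "0 < F (2 * y i)" using y3[of i] by (smt (verit) zero_less_power)
    ultimately have "F (y i) / F (2 * y i) \<le> (1/2) ^ (i + 1)" by (simp add: field_simps power_one_over)
    then show ?thesis using x(2)[of "1/2" i] by (simp add: ennreal_leI)
  qed
  \<comment> \<open>Makes the r-norm of \<open>m\<close> coefficients 1/2 exceed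
    \<open>C\<close>.\<close>
  obtain m :: nat where m: "(2 * C) powr r < real m" using reals_Archimedean2 by blast
  have "((2 * C) powr r) powr (1 / r) < real m powr (1 / r)"
    using m r by (intro powr_less_mono2) auto
  then have gt: "1/2 * real m powr (1 / r) / C > 1" using C r by (simp add: powr_powr field_simps)
  have "\<not> (\<Sum>i\<in>{0..<0 + m}. dilated F ((x \<circ> \<phi>) i) (1/2)) \<le> 1"
    using equiv_lr_block(2)[OF F normed_disjoint_subseq[OF x(1) \<phi>(1)] r _ \<phi>(2) gt, where N = 0] by simp
  moreover have "(\<Sum>i\<in>{0..<0 + m}. dilated F ((x \<circ> \<phi>) i) (1/2)) \<le> (\<Sum>i<m. ennreal ((1/2) ^ (i + 1)))"
    unfolding atLeast0LessThan add_0
  proof (rule sum_mono)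
    fix i
    have "dilated F (x (\<phi> i)) (1/2) \<le> ennreal ((1/2) ^ (\<phi> i + 1))" by (rule small)
    also have "\<dots> \<le> ennreal ((1/2) ^ (i + 1))"
      using strict_mono_imp_increasing[OF \<phi>(1), of i] by (intro ennreal_leI power_decreasing) auto
    finally show "dilated F ((x \<circ> \<phi>) i) (1/2) \<le> ennreal ((1/2) ^ (i + 1))" by simp
  qed
  moreover have "(\<Sum>i<m. ennreal ((1/2) ^ (i + 1))) \<le> 1"
    using sum_half_powers_le[of m] by (subst sum_ennreal) auto
  ultimately show False by (meson order_trans)
qed

text \<open>Peaks that all violate the bound at one level \<open>t\<close> form a sequence whose
  \<open>t\<close>-multiples are too small. The constant \<open>K\<close> to be violated is fixed in
  terms of \<open>C\<close> before the sequence exists, and this is where uniformity enters.\<close>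

theorem uniform_DH_imp_power_lower:
  assumes F: "orlicz_function F" and DH: "uniform_DH F p" and p: "p > 0"
  shows "\<exists>K\<ge>1. power_lower F p K"
proof -
  obtain C where C: "\<And>x. normed_disjoint_seq F x \<Longrightarrow> \<exists>\<phi>. strict_mono \<phi> \<and> equiv_lr F p C (x \<circ> \<phi>)"
    using DH unfolding uniform_DH_def by blast
  define D where "D = max 1 C"
  \<comment> \<open>About \<open>(D / t) powr p\<close> terms suffice for a norm above
    \<open>C\<close>; the 2 covers rounding their number \<open>m\<close> to an integer, so that
    \<open>m * t powr p / K \<le> 1\<close>.\<close>
  define K where "K = 2 * D powr p"
  have D1: "D \<ge> 1" by (simp add: D_def)
  then have Dp: "D powr p \<ge> 1" using p by (intro ge_one_powr_ge_zero) auto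
  have "power_lower F p K"
  proof (rule ccontr)
    assume "\<not> power_lower F p K"
    then obtain t where t: "t \<in> {0<..1}" "\<And>Y. \<exists>y\<ge>Y. t powr p * F y > K * F (t * y)"
      unfolding power_lower_def by (meson not_le)
    obtain y where y: "\<And>i. y i \<ge> 1" "\<And>i. t powr p * F (y i) > K * F (t * y i)"
      and large: "\<And>i z. z \<ge> y i \<Longrightarrow> F z \<ge> 2 ^ (i + 1)"
      by (rule choose_large[where Q = "\<lambda>_ y. t powr p * F y > K * F (t * y)", OF F t(2)])
        (rule that; assumption)
    note y3 = large[OF order_refl]
    have pos: "y i > 0" for i using y(1)[of i] by simp
    obtain x where x: "normed_disjoint_seq F x"
      "\<And>i s. 0 \<le> s \<Longrightarrow> dilated F (x i) s = ennreal (F (s * y i) / F (y i))"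
      using peak_sequence[OF F, of y, OF pos y3] by blast
    obtain \<phi> where \<phi>: "strict_mono \<phi>" "equiv_lr F p C (x \<circ> \<phi>)" using C[OF x(1)] by blast
    have Cpos: "C > 0" using \<phi>(2) by (simp add: equiv_lr_def)
    have t0: "0 < t" "t \<le> 1" using t by auto
    define m where "m = nat \<lfloor>(D / t) powr p\<rfloor> + 1"
    have m: "(D / t) powr p < real m" "real m \<le> (D / t) powr p + 1"
      unfolding m_def by (simp_all, linarith)
    have "1 \<le> (D / t) powr p" using D1 t0 p by (intro ge_one_powr_ge_zero) auto
    then have m2: "real m \<le> 2 * (D / t) powr p" using m by simp
    have "((D / t) powr p) powr (1 / p) < real m powr (1 / p)"
      using m p by (intro powr_less_mono2) auto
    then have "D / t < real m powr (1 / p)" using p D1 t0 by (simp add: powr_powr)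
    then have "D < t * real m powr (1 / p)" using t0 by (simp add: field_simps)
    then have "C < t * real m powr (1 / p)" by (simp add: D_def)
    then have gt: "t * real m powr (1 / p) / C > 1" using Cpos by simp
    have "\<not> (\<Sum>i\<in>{0..<0 + m}. dilated F ((x \<circ> \<phi>) i) t) \<le> 1"
      using equiv_lr_block(2)[OF F normed_disjoint_subseq[OF x(1) \<phi>(1)] p t0(1) \<phi>(2) gt, where N = 0] by simp
    moreover have "dilated F ((x \<circ> \<phi>) i) t \<le> ennreal (t powr p / K)" for i
    proof -
      have "0 < F (y (\<phi> i))" using y3[of "\<phi> i"] by (smt (verit) zero_less_power)
      moreover have "K > 0" unfolding K_def using Dp by linarith
      ultimately have "F (t * y (\<phi> i)) / F (y (\<phi> i)) \<le> t powr p / K"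
        using y(2)[of "\<phi> i"] by (simp add: field_simps)
      then show ?thesis using x(2)[of t "\<phi> i"] t0 by (simp add: ennreal_leI)
    qed
    then have "(\<Sum>i\<in>{0..<0 + m}. dilated F ((x \<circ> \<phi>) i) t) \<le> (\<Sum>i\<in>{0..<0 + m}. ennreal (t powr p / K))"
      by (intro sum_mono)
    moreover have "(\<Sum>i\<in>{0..<0 + m}. ennreal (t powr p / K)) \<le> 1"
    proof -
      have "(\<Sum>i\<in>{0..<0 + m}. ennreal (t powr p / K)) = ennreal (real m * (t powr p / K))"
        using Dp by (subst sum_ennreal) (auto simp: K_def)
      also have "\<dots> \<le> ennreal (2 * (D / t) powr p * (t powr p / K))"
        using m2 Dp by (intro ennreal_leI mult_right_mono) (auto simp: K_def)
      also have "2 * (D / t) powr p * (t powr p / K) = 1"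
      proof -
        have "D > 0" using D1 by simp
        then show ?thesis using t0 by (simp add: K_def powr_divide)
      qed
      finally show ?thesis by simp
    qed
    ultimately show False by (meson order_trans)
  qed
  moreover have "K \<ge> 1" using Dp by (simp add: K_def)
  ultimately show ?thesis by blast
qed

text \<open>If no power upper bound holds, pick for every \<open>n\<close> a level \<open>t\<^sub>n\<close> violating it with constant
  \<open>4\<^sup>n\<close>. The \<open>i\<close>-th function mixes peaks violating the bounds for all \<open>n \<le> i\<close>, with modular weights
  about \<open>2\<^sup>-\<^sup>n\<close>; the index \<open>k\<close> encodes the pair \<open>(n, i)\<close>. One such sequence then contradicts every
  upper estimate at once.\<close>

lemma no_power_upper_blocks:
  assumes F: "orlicz_function F" and no: "\<And>K. \<not> power_upper F r K"
  obtains l v B where "slot_lengths l" "\<And>k. v k > 0" "\<And>i::nat. finite (B i)"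
    "\<And>i j. i \<noteq> j \<Longrightarrow> B i \<inter> B j = {}" "\<And>i. B i \<noteq> {}" "\<And>i. (\<Sum>k\<in>B i. F \<bar>v k\<bar> * l k) = 1"
    "\<And>\<phi> D. strict_mono \<phi> \<Longrightarrow> D > 0 \<Longrightarrow> \<exists>s>0. \<exists>m N. s powr r * real m < D \<and>
      (\<Sum>i\<in>{N..<N + m}. \<Sum>k\<in>B (\<phi> i). F (s * \<bar>v k\<bar>) * l k) > 1"
proof -
  have "\<exists>t\<in>{0<..1}. \<forall>Y. \<exists>y\<ge>Y. F (t * y) > 4 ^ n * t powr r * F y" for n :: nat
    using no[of "4 ^ n"] unfolding power_upper_def by (meson not_le)
  then obtain \<tau> where \<tau>: "\<And>n. \<tau> n \<in> {0<..1}"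
    "\<And>n Y. \<exists>y\<ge>Y. F (\<tau> n * y) > 4 ^ n * \<tau> n powr r * F y" by metis
  \<comment> \<open>The level at which the k-th peak violates the bound. A level recurs for
    infinitely many peaks, one for each function that uses it.\<close>
  define \<nu> where "\<nu> k = fst (prod_decode k)" for k
  obtain v where v1: "\<And>k. v k \<ge> 1" and large: "\<And>k z. z \<ge> v k \<Longrightarrow> F z \<ge> 2 ^ (k + 1)"
    and v3: "\<And>k. F (\<tau> (\<nu> k) * v k) > 4 ^ \<nu> k * \<tau> (\<nu> k) powr r * F (v k)"
    by (rule choose_large[where Q = "\<lambda>k y. F (\<tau> (\<nu> k) * y) > 4 ^ \<nu> k * \<tau> (\<nu> k) powr r * F y", OF F \<tau>(2)])
      (rule that; assumption)
  note v2 = large[OF order_refl]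
  have Fv: "F (v k) > 0" for k using v2[of k] by (smt (verit) zero_less_power)
  have vpos: "v k > 0" for k using v1[of k] by simp
  \<comment> \<open>Weights \<open>(1/2) ^ (n + 1)\<close>, except that the last one, for
    \<open>n = i\<close>, is doubled so that they sum to exactly 1.\<close>
  define w where "w n i = (if n < i then (1/2) ^ (n + 1) else (1/2 :: real) ^ i)" for n i :: nat
  have w: "0 < w n i" "w n i \<le> 1" for n i
    using power_le_one[of "1/2::real" "n + 1"] power_le_one[of "1/2::real" i] by (auto simp: w_def)
  define l where "l k = w (fst (prod_decode k)) (snd (prod_decode k)) / F (v k)" for k
  define B where "B i = (\<lambda>n. prod_encode (n, i)) ` {..i}" for i
  have inj: "inj_on (\<lambda>n. prod_encode (n, i)) A" for i A by (auto simp: inj_on_def)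
  have lB: "F (v (prod_encode (n, i))) * l (prod_encode (n, i)) = w n i" for n i
    using Fv[of "prod_encode (n, i)"] by (simp add: l_def)
  have l: "slot_lengths l"
    unfolding slot_lengths_def
  proof
    fix k
    have "l k \<le> 1 / 2 ^ (k + 1)"
      unfolding l_def using v2 w by (intro frac_le) (auto simp: less_imp_le)
    then show "0 < l k \<and> l k \<le> (1/2) ^ (k + 1)"
      using Fv[of k] w(1) by (simp add: l_def power_one_over)
  qed
  have sumw: "(\<Sum>n\<le>i. w n i) = 1" for i
  proof -
    have "(\<Sum>n\<le>i. w n i) = (\<Sum>n<i. w n i) + w i i" by (simp add: lessThan_Suc_atMost[symmetric])
    also have "(\<Sum>n<i. w n i) = (\<Sum>n<i. (1/2) ^ (n + 1))" by (intro sum.cong) (auto simp: w_def)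
    also have "\<dots> = 1 - (1/2) ^ i" by (induction i) auto
    finally show ?thesis by (simp add: w_def)
  qed
  show ?thesis
  proof (rule that[of l v B])
    show "(\<Sum>k\<in>B i. F \<bar>v k\<bar> * l k) = 1" for i
    proof -
      have "(\<Sum>k\<in>B i. F \<bar>v k\<bar> * l k) = (\<Sum>n\<le>i. w n i)"
        unfolding B_def using vpos lB by (simp add: sum.reindex[OF inj] less_imp_le)
      then show ?thesis using sumw by simp
    qed
    fix \<phi> :: "nat \<Rightarrow> nat" and D :: real assume \<phi>: "strict_mono \<phi>" and D: "D > 0"
    obtain n where n: "(1/2::real) ^ n < D / 3" using real_arch_pow_inv[of "D / 3" "1/2"] D by auto
    define s where "s = \<tau> n"
    have s: "0 < s" "s \<le> 1" using \<tau>(1)[of n] by (auto simp: s_def)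
    have srpos: "0 < s powr r" using s by simp
    \<comment> \<open>\<open>4 ^ n * s powr r\<close> times the weight
      \<open>(1/2) ^ (n + 1)\<close>: a lower bound for what the peak of level \<open>n\<close>
      alone contributes at scale \<open>s\<close>.\<close>
    define \<theta> where "\<theta> = 2 ^ n * s powr r / 2"
    have \<theta>: "\<theta> > 0" using s by (simp add: \<theta>_def)
    \<comment> \<open>Monotonicity of \<open>F\<close> limits how far the bound can be violated at a
      level in (0,1]. This makes \<open>s powr r\<close> small and controls the error of rounding
      \<open>1 / \<theta>\<close> up to \<open>m\<close>.\<close>
    have s4: "4 ^ n * s powr r < 1"
    proof -
      define k where "k = prod_encode (n, 0)"
      have "4 ^ n * s powr r * F (v k) < F (s * v k)" using v3[of k] by (simp add: k_def s_def \<nu>_def)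
      also have "\<dots> \<le> 1 * F (v k)"
        using s vpos[of k] orlicz_mono[OF F, of "s * v k" "v k"] by (simp add: mult_left_le_one_le)
      finally show ?thesis using Fv[of k] by (simp only: mult_less_cancel_right_pos)
    qed
    define m where "m = nat \<lceil>1 / \<theta>\<rceil>"
    have m: "1 / \<theta> \<le> real m" "real m < 1 / \<theta> + 1" "m > 0"
    proof -
      have "0 < 1 / \<theta>" using \<theta> by simp
      then show "1 / \<theta> \<le> real m" "real m < 1 / \<theta> + 1" "m > 0" unfolding m_def by linarith+
    qed
    \<comment> \<open>From index \<open>n\<close> on every mixed function contains a peak of level
      \<open>n\<close>, also along a subsequence, because \<open>\<phi> i \<ge> i\<close>.\<close>
    have peak: "\<theta> < (\<Sum>k\<in>B (\<phi> i). F (s * \<bar>v k\<bar>) * l k)" if "n \<le> i" for i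
    proof -
      define k where "k = prod_encode (n, \<phi> i)"
      have ni: "n \<le> \<phi> i" using that strict_mono_imp_increasing[OF \<phi>, of i] by simp
      then have kB: "k \<in> B (\<phi> i)" by (auto simp: B_def k_def)
      have wn: "w n (\<phi> i) \<ge> (1/2) ^ (n + 1)" using ni by (auto simp: w_def)
      have "\<theta> = 4 ^ n * s powr r * (1/2) ^ (n + 1)"
      proof -
        have "(4::real) ^ n * (1/2) ^ n = 2 ^ n" by (simp flip: power_mult_distrib)
        then show ?thesis by (simp add: \<theta>_def)
      qed
      also have "\<dots> \<le> 4 ^ n * s powr r * w n (\<phi> i)" using wn by (intro mult_left_mono) auto
      also have "\<dots> = 4 ^ n * s powr r * F (v k) * l k" using lB[of n "\<phi> i"] by (simp add: k_def)
      also have "\<dots> < F (s * v k) * l k"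
        using v3[of k] slot_lengths_pos[OF l, of k] by (intro mult_strict_right_mono) (auto simp: k_def s_def \<nu>_def)
      also have "\<dots> = F (s * \<bar>v k\<bar>) * l k" using vpos[of k] by simp
      also have "\<dots> \<le> (\<Sum>k\<in>B (\<phi> i). F (s * \<bar>v k\<bar>) * l k)"
      proof (rule member_le_sum[OF kB])
        fix j
        show "0 \<le> F (s * \<bar>v j\<bar>) * l j"
          using s slot_lengths_pos[OF l, of j] by (intro mult_nonneg_nonneg orlicz_nonneg[OF F]) auto
      qed (simp add: B_def)
      finally show ?thesis .
    qed
    have "1 \<le> real m * \<theta>" using m \<theta> by (simp add: field_simps)
    also have "\<dots> = (\<Sum>i\<in>{n..<n + m}. \<theta>)" by simp
    also have "\<dots> < (\<Sum>i\<in>{n..<n + m}. \<Sum>k\<in>B (\<phi> i). F (s * \<bar>v k\<bar>) * l k)"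
      using peak m by (intro sum_strict_mono) auto
    finally have big: "1 < (\<Sum>i\<in>{n..<n + m}. \<Sum>k\<in>B (\<phi> i). F (s * \<bar>v k\<bar>) * l k)" .
    \<comment> \<open>Up to rounding, \<open>s powr r * m\<close> is
      \<open>s powr r / \<theta> = 2 * (1/2) ^ n\<close>, whatever the level is; \<open>n\<close>
      was chosen so that three times \<open>(1/2) ^ n\<close> is below \<open>D\<close>.\<close>
    have "s powr r * real m < s powr r * (1 / \<theta> + 1)"
      using m srpos by (intro mult_strict_left_mono) auto
    also have "\<dots> = 2 * (1/2) ^ n + s powr r"
      using srpos by (simp add: \<theta>_def distrib_left power_one_over)
    also have "\<dots> \<le> 2 * (1/2) ^ n + (1/2) ^ n"
    proof -
      have "2 ^ n * s powr r \<le> 4 ^ n * s powr r"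
        using srpos by (intro mult_right_mono power_mono) auto
      then have "2 ^ n * s powr r \<le> 1" using s4 by simp
      then show ?thesis by (simp add: power_one_over field_simps)
    qed
    also have "\<dots> < D" using n by simp
    finally show "\<exists>s>0. \<exists>m N. s powr r * real m < D \<and>
        (\<Sum>i\<in>{N..<N + m}. \<Sum>k\<in>B (\<phi> i). F (s * \<bar>v k\<bar>) * l k) > 1"
      using big s by blast
  qed (use l vpos in \<open>auto simp: B_def\<close>)
qed

text \<open>With \<open>D = (1 / C) powr p\<close> the block has p-norm below \<open>1 / C\<close>
  but modular above 1, against the upper estimate with the constant \<open>C\<close> that belongs to
  this very sequence.\<close>

theorem DH_imp_power_upper:
  assumes F: "orlicz_function F" and DH: "DH F p" and p: "p > 0"
  shows "\<exists>K. power_upper F p K"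
proof (rule ccontr)
  assume "\<not> ?thesis"
  then have no: "\<And>K. \<not> power_upper F p K" by blast
  obtain l v B where l: "slot_lengths l" and v: "\<And>k. v k > 0" and B: "\<And>i::nat. finite (B i)"
    "\<And>i j. i \<noteq> j \<Longrightarrow> B i \<inter> B j = {}" and "\<And>i. B i \<noteq> {}"
    and one: "\<And>i. (\<Sum>k\<in>B i. F \<bar>v k\<bar> * l k) = 1"
    and blocks: "\<And>\<phi> D. strict_mono \<phi> \<Longrightarrow> D > 0 \<Longrightarrow> \<exists>s>0. \<exists>m N. s powr p * real m < D \<and>
      (\<Sum>i\<in>{N..<N + m}. \<Sum>k\<in>B (\<phi> i). F (s * \<bar>v k\<bar>) * l k) > 1"
    by (rule no_power_upper_blocks[OF F no]) (rule that; assumption)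
  define x where "x i = step l (B i) v" for i
  have x: "normed_disjoint_seq F x"
    unfolding x_def[abs_def] by (rule normed_disjoint_step[OF F l B one])
  obtain \<phi> C where \<phi>: "strict_mono \<phi>" "equiv_lr F p C (x \<circ> \<phi>)"
    using DH x unfolding DH_def by blast
  have C: "C > 0" using \<phi>(2) by (simp add: equiv_lr_def)
  have "(1 / C) powr p > 0" using C by simp
  from blocks[OF \<phi>(1) this] obtain s m N where s: "s > 0" "s powr p * real m < (1 / C) powr p"
    and big: "(\<Sum>i\<in>{N..<N + m}. \<Sum>k\<in>B (\<phi> i). F (s * \<bar>v k\<bar>) * l k) > 1" by blast
  have lt: "C * (s * real m powr (1 / p)) < 1"
  proof -
    have "(s powr p * real m) powr (1 / p) < ((1 / C) powr p) powr (1 / p)"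
      using s p by (intro powr_less_mono2) auto
    then have "s * real m powr (1 / p) < 1 / C" using s p C by (simp add: powr_mult powr_powr)
    then show ?thesis using C by (simp add: field_simps)
  qed
  have "(\<Sum>i\<in>{N..<N + m}. dilated F ((x \<circ> \<phi>) i) s) \<le> 1"
    by (rule equiv_lr_block(1)[OF F normed_disjoint_subseq[OF x \<phi>(1)] p s(1) \<phi>(2) lt])
  moreover have "(\<Sum>i\<in>{N..<N + m}. dilated F ((x \<circ> \<phi>) i) s)
      = ennreal (\<Sum>i\<in>{N..<N + m}. \<Sum>k\<in>B (\<phi> i). F (s * \<bar>v k\<bar>) * l k)"
  proof -
    have "0 \<le> (\<Sum>k\<in>B (\<phi> i). F (s * \<bar>v k\<bar>) * l k)" for i
      using s slot_lengths_pos[OF l]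
      by (intro sum_nonneg mult_nonneg_nonneg orlicz_nonneg[OF F]) (auto simp: less_imp_le)
    then show ?thesis
      using s by (simp add: x_def dilated_step[OF F l B(1)] sum_ennreal)
  qed
  ultimately show False using big by (simp add: ennreal_le_1)
qed

section \<open>Complemented subspaces and the dual sequence\<close>

text \<open>Averaging over all signs would cancel the off-diagonal terms. The induction picks the
  signs one at a time so that the cross terms of the new index have a nonnegative sum.\<close>

lemma sign_choice_diagonal:
  fixes b :: "'a \<Rightarrow> 'a \<Rightarrow> real"
  assumes "finite S"
  shows "\<exists>\<epsilon>. (\<forall>i. \<bar>\<epsilon> i\<bar> = 1) \<and> (\<Sum>i\<in>S. b i i) \<le> (\<Sum>i\<in>S. \<Sum>j\<in>S. \<epsilon> i * \<epsilon> j * b i j)"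
  using assms
proof (induction S)
  case empty
  show ?case by (intro exI[of _ "\<lambda>_. 1"]) simp
next
  case (insert k S)
  then obtain \<epsilon> where \<epsilon>: "\<And>i. \<bar>\<epsilon> i\<bar> = 1" "(\<Sum>i\<in>S. b i i) \<le> (\<Sum>i\<in>S. \<Sum>j\<in>S. \<epsilon> i * \<epsilon> j * b i j)"
    by blast
  define X where "X = (\<Sum>j\<in>S. \<epsilon> j * b k j) + (\<Sum>i\<in>S. \<epsilon> i * b i k)"
  define e :: real where "e = (if X \<ge> 0 then 1 else -1)"
  define \<epsilon>' where "\<epsilon>' = \<epsilon>(k := e)"
  have eX: "0 \<le> e * X" "e * e = 1" "\<bar>e\<bar> = 1" by (auto simp: e_def)
  have same: "\<epsilon>' i = \<epsilon> i" if "i \<in> S" for i using that insert.hyps by (auto simp: \<epsilon>'_def)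
  have "(\<Sum>i\<in>insert k S. \<Sum>j\<in>insert k S. \<epsilon>' i * \<epsilon>' j * b i j)
      = (e * e * b k k + (\<Sum>j\<in>S. e * \<epsilon>' j * b k j)) + (\<Sum>i\<in>S. \<epsilon>' i * e * b i k + (\<Sum>j\<in>S. \<epsilon>' i * \<epsilon>' j * b i j))"
    using insert.hyps by (simp add: \<epsilon>'_def)
  also have "\<dots> = b k k + e * X + (\<Sum>i\<in>S. \<Sum>j\<in>S. \<epsilon> i * \<epsilon> j * b i j)"
    by (simp add: same eX(2) X_def sum.distrib sum_distrib_left distrib_left mult_ac)
  finally have "(\<Sum>i\<in>insert k S. b i i) \<le> (\<Sum>i\<in>insert k S. \<Sum>j\<in>insert k S. \<epsilon>' i * \<epsilon>' j * b i j)"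
    using eX(1) \<epsilon>(2) insert.hyps by simp
  moreover have "\<forall>i. \<bar>\<epsilon>' i\<bar> = 1" using \<epsilon>(1) eX(3) by (simp add: \<epsilon>'_def)
  ultimately show ?case by blast
qed

text \<open>By Hoelder's inequality the pairing with \<open>w\<close> is continuous in the norm of
  the second factor, so it vanishes on the closure as well.\<close>

lemma integral_closed_span_eq_0:
  assumes F: "orlicz_function F" and G: "orlicz_function G" and FG: "young_conjugate F G"
    and w: "w \<in> orlicz_space F" and g: "\<And>i. g i \<in> orlicz_space G"
    and z: "\<And>i. (\<integral>t. w t * g i t \<partial>I01) = 0" and u: "u \<in> closed_span G g"
  shows "(\<integral>t. w t * u t \<partial>I01) = 0"
proof -
  have us: "u \<in> orlicz_space G" using u by (simp add: closed_span_def)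
  obtain c where c: "c > 0" "modular F w c \<le> 1" using orlicz_spaceE[OF F w] .
  note wm = orlicz_space_measurable[OF w]
  note int = orlicz_product_integrable[OF F G FG w]
  have "\<bar>\<integral>t. w t * u t \<partial>I01\<bar> \<le> 0 + e" if e: "e > 0" for e
  proof -
    have e2: "e / (2 * c) > 0" using e c by simp
    then obtain n a where na: "lux_norm G (\<lambda>t. u t - (\<Sum>i<n. a i * g i t)) < e / (2 * c)"
      using u unfolding closed_span_def by blast
    define s where "s = (\<lambda>t. \<Sum>i<n. a i * g i t)"
    have ss: "s \<in> orlicz_space G" unfolding s_def using g by (intro orlicz_space_sum[OF G]) auto
    have ds: "(\<lambda>t. u t - s t) \<in> orlicz_space G" by (intro orlicz_space_diff[OF G] us ss)
    have "(\<integral>t. w t * s t \<partial>I01) = (\<integral>t. (\<Sum>i<n. a i * (w t * g i t)) \<partial>I01)"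
      by (simp add: s_def sum_distrib_left mult_ac)
    also have "\<dots> = 0" using int[OF g] z by (subst Bochner_Integration.integral_sum) auto
    finally have ws: "(\<integral>t. w t * s t \<partial>I01) = 0" .
    have "(\<integral>t. w t * (u t - s t) \<partial>I01) = (\<integral>t. w t * u t - w t * s t \<partial>I01)"
      by (simp add: right_diff_distrib)
    also have "\<dots> = (\<integral>t. w t * u t \<partial>I01)"
      using int[OF us] int[OF ss] ws by simp
    finally have eq: "(\<integral>t. w t * u t \<partial>I01) = (\<integral>t. w t * (u t - s t) \<partial>I01)" by simp
    have "modular G (\<lambda>t. u t - s t) (e / (2 * c)) \<le> 1"
      using na by (intro modular_le_one[OF G ds]) (simp add: s_def)
    then have "\<bar>\<integral>t. w t * (u t - s t) \<partial>I01\<bar> \<le> 2 * c * (e / (2 * c))"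
      by (rule orlicz_holder(2)[OF F G FG wm orlicz_space_measurable[OF ds] c(1) e2 c(2)])
    then show ?thesis using c eq by simp
  qed
  then have "\<bar>\<integral>t. w t * u t \<partial>I01\<bar> \<le> 0" by (rule field_le_epsilon)
  then show ?thesis by simp
qed

lemma step_eq_sum: "step l T c = (\<lambda>t. \<Sum>k\<in>T. c k * step l {k} (\<lambda>_. 1) t)"
  by (simp add: step_def fun_eq_iff)

text \<open>The weights \<open>\<gamma> i k\<close> describe the functionals of a bounded projection onto the span on the
  functions supported where the \<open>i\<close>-th generator lives; the last claim is the boundedness of the
  diagonal part of the projection, obtained by choosing signs.\<close>

lemma complemented_step_span_dual:
  fixes A :: "nat \<Rightarrow> nat set"
  assumes F: "orlicz_function F" and G: "orlicz_function G" and FG: "young_conjugate F G"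
    and l: "slot_lengths l" and v: "\<And>k. v k > 0"
    and A: "\<And>i. finite (A i)" "\<And>i j. i \<noteq> j \<Longrightarrow> A i \<inter> A j = {}" "\<And>i. A i \<noteq> {}"
    and com: "complemented G (closed_span G (\<lambda>i. step l (A i) v))"
  obtains \<gamma> M where "M \<ge> 0" "\<And>i. (\<Sum>k\<in>A i. v k * \<gamma> i k) = 1"
    "\<And>S c d. finite S \<Longrightarrow> (\<Sum>i\<in>S. \<Sum>k\<in>A i. F \<bar>c i k\<bar> * l k) \<le> 1 \<Longrightarrow>
      (\<Sum>i\<in>S. \<Sum>k\<in>A i. G \<bar>d i k\<bar> * l k) \<le> 1 \<Longrightarrow>
      (\<Sum>i\<in>S. (\<Sum>k\<in>A i. d i k * \<gamma> i k) * (\<Sum>k\<in>A i. c i k * v k * l k)) \<le> M"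
proof -
  define g where "g i = step l (A i) v" for i
  define e where "e k = step l {k} (\<lambda>_. 1)" for k
  have com: "complemented G (closed_span G g)" using com by (simp add: g_def[abs_def])
  obtain P K where K: "K \<ge> 0" and Pspan: "\<And>f. f \<in> orlicz_space G \<Longrightarrow> P f \<in> closed_span G g"
    and Pb: "\<And>f. f \<in> orlicz_space G \<Longrightarrow> lux_norm G (P f) \<le> K * lux_norm G f"
    and Pl: "\<And>f h a b. f \<in> orlicz_space G \<Longrightarrow> h \<in> orlicz_space G \<Longrightarrow>
      lux_norm G (\<lambda>t. P (\<lambda>s. a * f s + b * h s) t - (a * P f t + b * P h t)) = 0"
    and Pid: "\<And>f. f \<in> closed_span G g \<Longrightarrow> lux_norm G (\<lambda>t. P f t - f t) = 0"
    using com unfolding complemented_def by blast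
  have Ps: "P f \<in> orlicz_space G" if "f \<in> orlicz_space G" for f
    using Pspan[OF that] by (simp add: closed_span_def)
  have gs: "g i \<in> orlicz_space G" for i unfolding g_def using step_in_orlicz_space[OF G l A(1)] .
  have es: "e k \<in> orlicz_space G" for k unfolding e_def by (rule step_in_orlicz_space[OF G l]) simp
  note int = orlicz_product_integrable[OF F G FG]
  \<comment> \<open>\<open>P\<close> is linear only up to null functions; integrating against
    \<open>w\<close> removes this ambiguity and gives exactly linear functionals.\<close>
  define \<Lambda> where "\<Lambda> w f = (\<integral>t. w t * P f t \<partial>I01)" for w f
  have \<Lambda>_lin: "\<Lambda> w (\<lambda>s. a * f s + b * h s) = a * \<Lambda> w f + b * \<Lambda> w h"
    if w: "w \<in> orlicz_space F" and f: "f \<in> orlicz_space G" and h: "h \<in> orlicz_space G" for w f h a b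
  proof -
    have fh: "(\<lambda>s. a * f s + b * h s) \<in> orlicz_space G"
      using orlicz_space_add[OF G orlicz_space_scale[OF G f, of a] orlicz_space_scale[OF G h, of b]] .
    have ph: "(\<lambda>t. a * P f t + b * P h t) \<in> orlicz_space G"
      using orlicz_space_add[OF G orlicz_space_scale[OF G Ps[OF f], of a] orlicz_space_scale[OF G Ps[OF h], of b]] .
    have "AE t in I01. P (\<lambda>s. a * f s + b * h s) t - (a * P f t + b * P h t) = 0"
      by (rule lux_norm_eq_0_AE[OF G orlicz_space_diff[OF G Ps[OF fh] ph] Pl[OF f h]])
    then have "AE t in I01. w t * P (\<lambda>s. a * f s + b * h s) t = w t * (a * P f t + b * P h t)"
      by eventually_elim simp
    then have "\<Lambda> w (\<lambda>s. a * f s + b * h s) = (\<integral>t. w t * (a * P f t + b * P h t) \<partial>I01)"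
      unfolding \<Lambda>_def
      by (rule integral_cong_AE[rotated 2])
        (rule borel_measurable_times[OF orlicz_space_measurable[OF w] orlicz_space_measurable[OF Ps[OF fh]]],
         rule borel_measurable_times[OF orlicz_space_measurable[OF w] orlicz_space_measurable[OF ph]])
    also have "\<dots> = (\<integral>t. a * (w t * P f t) + b * (w t * P h t) \<partial>I01)"
      by (simp add: distrib_left mult_ac)
    also have "\<dots> = a * \<Lambda> w f + b * \<Lambda> w h"
      unfolding \<Lambda>_def using int[OF w Ps[OF f]] int[OF w Ps[OF h]] by simp
    finally show ?thesis .
  qed
  have \<Lambda>_sum: "\<Lambda> w (\<lambda>t. \<Sum>k\<in>T. a k * f k t) = (\<Sum>k\<in>T. a k * \<Lambda> w (f k))"
    if w: "w \<in> orlicz_space F" and T: "finite T" and f: "\<And>k. f k \<in> orlicz_space G" for w T and a :: "nat \<Rightarrow> real" and f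
    using T
  proof (induction T)
    case empty
    show ?case using \<Lambda>_lin[OF w f f, where a = 0 and b = 0] by simp
  next
    case (insert k T)
    have s: "(\<lambda>t. \<Sum>k\<in>T. a k * f k t) \<in> orlicz_space G"
      using insert.hyps f by (intro orlicz_space_sum[OF G]) auto
    show ?case using \<Lambda>_lin[OF w f s, where a = "a k" and b = 1 and k1 = k] insert by simp
  qed
  define k0 where "k0 i = (SOME k. k \<in> A i)" for i
  have k0: "k0 i \<in> A i" for i unfolding k0_def using A(3)[of i] by (simp add: some_in_eq)
  define h where "h i = step l {k0 i} (\<lambda>k. 1 / (v k * l k))" for i
  have hs: "h i \<in> orlicz_space F" for i unfolding h_def by (rule step_in_orlicz_space[OF F l]) simp
  have hg: "(\<integral>t. h i t * g j t \<partial>I01) = (if i = j then 1 else 0)" for i j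
  proof -
    have "(\<integral>t. h i t * g j t \<partial>I01) = (\<Sum>k\<in>{k0 i} \<inter> A j. 1 / (v k * l k) * v k * l k)"
      unfolding h_def g_def using integral_step(1)[OF l] by (simp add: step_mult[OF l _ A(1)])
    also have "{k0 i} \<inter> A j = (if i = j then {k0 i} else {})"
      using k0[of i] A(2)[of i j] by auto
    finally show ?thesis
      using v[of "k0 i"] slot_lengths_pos[OF l, of "k0 i"] by auto
  qed
  define \<gamma> where "\<gamma> i k = \<Lambda> (h i) (e k)" for i k
  have g_sum: "g i = (\<lambda>t. \<Sum>k\<in>A i. v k * e k t)" for i
    unfolding g_def e_def by (rule step_eq_sum)
  have gspan: "g i \<in> closed_span G g" for i
    unfolding closed_span_def
  proof (intro CollectI conjI allI impI gs)
    fix \<epsilon> :: real assume "\<epsilon> > 0"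
    moreover have "(\<lambda>t. g i t - (\<Sum>j<Suc i. (if j = i then 1 else 0) * g j t)) = (\<lambda>_. 0)"
      by (simp add: fun_eq_iff)
    ultimately have "lux_norm G (\<lambda>t. g i t - (\<Sum>j<Suc i. (if j = i then 1 else 0) * g j t)) < \<epsilon>"
      by (simp only: lux_norm_zero[OF G])
    then show "\<exists>n a. lux_norm G (\<lambda>t. g i t - (\<Sum>j<n. a j * g j t)) < \<epsilon>"
      by (intro exI[of _ "Suc i"] exI[of _ "\<lambda>j. if j = i then 1 else 0"])
  qed
  have norm1: "(\<Sum>k\<in>A i. v k * \<gamma> i k) = 1" for i
  proof -
    have "\<Lambda> (h i) (\<lambda>t. \<Sum>k\<in>A i. v k * e k t) = (\<Sum>k\<in>A i. v k * \<Lambda> (h i) (e k))"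
      by (rule \<Lambda>_sum[OF hs A(1) es])
    then have "(\<Sum>k\<in>A i. v k * \<gamma> i k) = \<Lambda> (h i) (g i)" by (simp only: \<gamma>_def g_sum[symmetric])
    also have "\<dots> = (\<integral>t. h i t * g i t \<partial>I01)"
    proof -
      have "AE t in I01. P (g i) t - g i t = 0"
        by (rule lux_norm_eq_0_AE[OF G orlicz_space_diff[OF G Ps[OF gs] gs] Pid[OF gspan]])
      then have "AE t in I01. h i t * P (g i) t = h i t * g i t" by eventually_elim simp
      then show ?thesis
        unfolding \<Lambda>_def
        by (rule integral_cong_AE[rotated 2])
          (rule borel_measurable_times[OF orlicz_space_measurable[OF hs] orlicz_space_measurable[OF Ps[OF gs]]],
           rule borel_measurable_times[OF orlicz_space_measurable[OF hs] orlicz_space_measurable[OF gs]])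
    qed
    finally show ?thesis using hg[of i i] by simp
  qed
  \<comment> \<open>On the span, pairing with a function supported in the i-th block is a multiple
    of pairing with \<open>h i\<close>: the difference annihilates every generator, hence the closed
    span.\<close>
  have factor: "\<Lambda> (step l (A i) c) (e k) = \<gamma> i k * (\<Sum>k\<in>A i. c k * v k * l k)" for i c k
  proof -
    define \<beta> where "\<beta> = (\<Sum>k\<in>A i. c k * v k * l k)"
    define f where "f = step l (A i) c"
    have fs: "f \<in> orlicz_space F" unfolding f_def by (rule step_in_orlicz_space[OF F l A(1)])
    have fg: "(\<integral>t. f t * g j t \<partial>I01) = (if i = j then \<beta> else 0)" for j
    proof -
      have "(\<integral>t. f t * g j t \<partial>I01) = (\<Sum>k\<in>A i \<inter> A j. c k * v k * l k)"
        unfolding f_def g_def using integral_step(1)[OF l] by (simp add: step_mult[OF l A(1) A(1)])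
      then show ?thesis using A(2)[of i j] by (auto simp: \<beta>_def)
    qed
    have ws: "(\<lambda>t. f t - \<beta> * h i t) \<in> orlicz_space F"
      by (rule orlicz_space_diff[OF F fs orlicz_space_scale[OF F hs]])
    have diff: "(\<integral>t. (f t - \<beta> * h i t) * u t \<partial>I01) = (\<integral>t. f t * u t \<partial>I01) - \<beta> * (\<integral>t. h i t * u t \<partial>I01)"
      if u: "u \<in> orlicz_space G" for u
    proof -
      have "(\<integral>t. (f t - \<beta> * h i t) * u t \<partial>I01) = (\<integral>t. f t * u t - \<beta> * (h i t * u t) \<partial>I01)"
        by (simp add: left_diff_distrib mult.assoc)
      then show ?thesis using int[OF fs u] int[OF hs u] by simp
    qed
    have "(\<integral>t. (f t - \<beta> * h i t) * P (e k) t \<partial>I01) = 0"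
      by (rule integral_closed_span_eq_0[OF F G FG ws gs _ Pspan[OF es]]) (simp add: diff[OF gs] fg hg)
    then show ?thesis
      unfolding diff[OF Ps[OF es]] by (simp add: \<Lambda>_def \<gamma>_def \<beta>_def f_def mult.commute)
  qed
  show ?thesis
  proof (rule that[of "2 * (K + 1)" \<gamma>])
    show "0 \<le> 2 * (K + 1)" using K by simp
    show "(\<Sum>k\<in>A i. v k * \<gamma> i k) = 1" for i by (rule norm1)
    fix S :: "nat set" and c d :: "nat \<Rightarrow> nat \<Rightarrow> real"
    assume S: "finite S" and cS: "(\<Sum>i\<in>S. \<Sum>k\<in>A i. F \<bar>c i k\<bar> * l k) \<le> 1"
      and dS: "(\<Sum>i\<in>S. \<Sum>k\<in>A i. G \<bar>d i k\<bar> * l k) \<le> 1"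
    define f where "f i = step l (A i) (c i)" for i
    define u where "u i = step l (A i) (d i)" for i
    have fs: "f i \<in> orlicz_space F" for i unfolding f_def by (rule step_in_orlicz_space[OF F l A(1)])
    have us: "u i \<in> orlicz_space G" for i unfolding u_def by (rule step_in_orlicz_space[OF G l A(1)])
    define b where "b i j = \<Lambda> (f j) (u i)" for i j
    obtain \<epsilon> :: "nat \<Rightarrow> real" where \<epsilon>: "\<And>i. \<bar>\<epsilon> i\<bar> = 1"
      "(\<Sum>i\<in>S. b i i) \<le> (\<Sum>i\<in>S. \<Sum>j\<in>S. \<epsilon> i * \<epsilon> j * b i j)"
      using sign_choice_diagonal[OF S, of b] by blast
    \<comment> \<open>Signs do not change modulars, and equal signs in \<open>W\<close> and
      \<open>U\<close> turn \<open>\<Lambda> W U\<close> into the signed double sum.\<close>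
    define W where "W = (\<lambda>t. \<Sum>j\<in>S. \<epsilon> j * f j t)"
    define U where "U = (\<lambda>t. \<Sum>i\<in>S. \<epsilon> i * u i t)"
    have Ws: "W \<in> orlicz_space F" unfolding W_def by (rule orlicz_space_sum[OF F S fs])
    have Us: "U \<in> orlicz_space G" unfolding U_def by (rule orlicz_space_sum[OF G S us])
    have modular_signed: "modular H (\<lambda>t. \<Sum>j\<in>S. \<epsilon> j * step l (A j) (a j) t) 1 \<le> 1"
      if H: "orlicz_function H" and a: "(\<Sum>i\<in>S. \<Sum>k\<in>A i. H \<bar>a i k\<bar> * l k) \<le> 1"
      for H and a :: "nat \<Rightarrow> nat \<Rightarrow> real"
      using modular_step_combination[OF H l A(1,2) S zero_less_one, where a = \<epsilon> and c = a] a \<epsilon>(1) by simp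
    have Wmod: "modular F W 1 \<le> 1" unfolding W_def f_def by (rule modular_signed[OF F cS])
    have "modular G U 1 \<le> 1" unfolding U_def u_def by (rule modular_signed[OF G dS])
    then have "lux_norm G U \<le> 1" by (rule lux_norm_le[OF zero_less_one])
    then have "K * lux_norm G U \<le> K * 1" using K by (rule mult_left_mono)
    then have "lux_norm G (P U) < K + 1" using Pb[OF Us] by simp
    then have PUmod: "modular G (P U) (K + 1) \<le> 1" by (rule modular_le_one[OF G Ps[OF Us]])
    have "(\<Sum>i\<in>S. \<Sum>j\<in>S. \<epsilon> i * \<epsilon> j * b i j) = \<Lambda> W U"
    proof -
      have "\<Lambda> W U = (\<integral>t. (\<Sum>j\<in>S. \<epsilon> j * (f j t * P U t)) \<partial>I01)"
        by (simp add: \<Lambda>_def W_def sum_distrib_right mult.assoc)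
      also have "\<dots> = (\<Sum>j\<in>S. \<epsilon> j * \<Lambda> (f j) U)"
        unfolding \<Lambda>_def using int[OF fs Ps[OF Us]] by (subst Bochner_Integration.integral_sum) auto
      also have "\<dots> = (\<Sum>j\<in>S. \<epsilon> j * (\<Sum>i\<in>S. \<epsilon> i * b i j))"
        unfolding b_def U_def using \<Lambda>_sum[OF fs S us] by simp
      also have "\<dots> = (\<Sum>i\<in>S. \<Sum>j\<in>S. \<epsilon> i * \<epsilon> j * b i j)"
        by (subst sum.swap) (simp add: sum_distrib_left mult_ac)
      finally show ?thesis by simp
    qed
    also have "\<dots> \<le> 2 * 1 * (K + 1)"
    proof -
      have "\<bar>\<Lambda> W U\<bar> \<le> 2 * 1 * (K + 1)"
        unfolding \<Lambda>_def
        by (rule orlicz_holder(2)[OF F G FG orlicz_space_measurable[OF Ws] orlicz_space_measurable[OF Ps[OF Us]]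
              _ _ Wmod PUmod]) (use K in auto)
      then show ?thesis by simp
    qed
    finally have le: "(\<Sum>i\<in>S. b i i) \<le> 2 * (K + 1)" using \<epsilon>(2) by simp
    have bii: "b i i = (\<Sum>k\<in>A i. d i k * \<gamma> i k) * (\<Sum>k\<in>A i. c i k * v k * l k)" for i
    proof -
      have "u i = (\<lambda>t. \<Sum>k\<in>A i. d i k * e k t)" unfolding u_def e_def by (rule step_eq_sum)
      moreover have "\<Lambda> (f i) (\<lambda>t. \<Sum>k\<in>A i. d i k * e k t) = (\<Sum>k\<in>A i. d i k * \<Lambda> (f i) (e k))"
        by (rule \<Lambda>_sum[OF fs A(1) es])
      ultimately have "b i i = (\<Sum>k\<in>A i. d i k * \<Lambda> (f i) (e k))"
        by (simp only: b_def)
      then show ?thesis by (simp add: f_def factor sum_distrib_right mult.assoc)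
    qed
    show "(\<Sum>i\<in>S. (\<Sum>k\<in>A i. d i k * \<gamma> i k) * (\<Sum>k\<in>A i. c i k * v k * l k)) \<le> 2 * (K + 1)"
      using le by (simp only: bii)
  qed
qed

text \<open>A norming argument: if the modular \<open>\<tau>\<close> on the left exceeded 1, the
  test values \<open>F r / r\<close>, divided by \<open>\<tau>\<close> and given the right signs,
  would have modular at most 1 by \<open>conjugate_ratio_le\<close> and pairing exactly
  \<open>M + 1\<close>. The added 1 yields the contradiction and a nonzero denominator also for
  \<open>M = 0\<close>.\<close>

lemma dual_combination_bound:
  fixes A :: "nat \<Rightarrow> nat set"
  assumes F: "orlicz_function F" and G: "orlicz_function G" and FG: "young_conjugate F G"
    and l: "slot_lengths l" and M: "M \<ge> 0"
    and bound: "\<And>d. (\<Sum>i\<in>S. \<Sum>k\<in>A i. G \<bar>d i k\<bar> * l k) \<le> 1 \<Longrightarrow>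
      (\<Sum>i\<in>S. (\<Sum>k\<in>A i. d i k * \<gamma> i k) * \<beta> i) \<le> M"
  shows "(\<Sum>i\<in>S. \<Sum>k\<in>A i. F (\<bar>\<beta> i\<bar> / (M + 1) * \<bar>\<gamma> i k / l k\<bar>) * l k) \<le> 1"
proof (rule ccontr)
  define r where "r i k = \<bar>\<beta> i\<bar> / (M + 1) * \<bar>\<gamma> i k / l k\<bar>" for i k
  define \<tau> where "\<tau> = (\<Sum>i\<in>S. \<Sum>k\<in>A i. F (r i k) * l k)"
  assume "\<not> ?thesis"
  then have \<tau>: "\<tau> > 1" by (simp add: \<tau>_def r_def)
  have lp: "l k > 0" for k using slot_lengths_pos[OF l] .
  have r0: "r i k \<ge> 0" for i k using M by (simp add: r_def)
  have Fr: "F (r i k) \<ge> 0" for i k using r0 by (rule orlicz_nonneg[OF F])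
  define d where "d i k = sgn (\<beta> i * \<gamma> i k) * (1 / \<tau> * (F (r i k) / r i k))" for i k
  have Gd: "G \<bar>d i k\<bar> \<le> 1 / \<tau> * F (r i k)" for i k
  proof (cases "r i k = 0")
    case True
    then have "d i k = 0" by (simp add: d_def)
    then show ?thesis using Fr[of i k] \<tau> by (simp add: orlicz_zero[OF G])
  next
    case False
    then have rpos: "r i k > 0" using r0[of i k] by simp
    have q0: "0 \<le> F (r i k) / r i k" using Fr[of i k] r0[of i k] by simp
    have q1: "0 \<le> 1 / \<tau> * (F (r i k) / r i k)" by (rule mult_nonneg_nonneg[OF _ q0]) (use \<tau> in simp)
    have "\<bar>d i k\<bar> = \<bar>sgn (\<beta> i * \<gamma> i k)\<bar> * (1 / \<tau> * (F (r i k) / r i k))"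
      unfolding d_def abs_mult[of "sgn (\<beta> i * \<gamma> i k)"] using q1 by (simp only: abs_of_nonneg)
    also have "\<dots> \<le> 1 * (1 / \<tau> * (F (r i k) / r i k))"
      by (rule mult_right_mono[OF _ q1]) (simp add: sgn_if)
    finally have "\<bar>d i k\<bar> \<le> 1 / \<tau> * (F (r i k) / r i k)" by simp
    then have "G \<bar>d i k\<bar> \<le> G (1 / \<tau> * (F (r i k) / r i k))" by (rule orlicz_mono[OF G abs_ge_zero])
    also have "\<dots> \<le> 1 / \<tau> * G (F (r i k) / r i k)"
      using \<tau> by (intro orlicz_contract[OF G q0]) auto
    also have "\<dots> \<le> 1 / \<tau> * F (r i k)"
      using \<tau> conjugate_ratio_le[OF F FG rpos] by (intro mult_left_mono) auto
    finally show ?thesis .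
  qed
  have "(\<Sum>i\<in>S. \<Sum>k\<in>A i. G \<bar>d i k\<bar> * l k) \<le> (\<Sum>i\<in>S. \<Sum>k\<in>A i. 1 / \<tau> * F (r i k) * l k)"
    by (intro sum_mono mult_right_mono Gd less_imp_le[OF lp])
  also have "\<dots> = 1 / \<tau> * \<tau>" unfolding \<tau>_def by (simp only: sum_distrib_left mult.assoc)
  also have "\<dots> = 1" using \<tau> by simp
  finally have le: "(\<Sum>i\<in>S. (\<Sum>k\<in>A i. d i k * \<gamma> i k) * \<beta> i) \<le> M" by (rule bound)
  have "d i k * \<gamma> i k * \<beta> i = (M + 1) / \<tau> * (F (r i k) * l k)" for i k
  proof (cases "r i k = 0")
    case True
    then show ?thesis by (simp add: d_def orlicz_zero[OF F])
  next
    case False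
    have "d i k * \<gamma> i k * \<beta> i = (sgn (\<beta> i * \<gamma> i k) * (\<beta> i * \<gamma> i k)) * (1 / \<tau> * (F (r i k) / r i k))"
      by (simp only: d_def mult_ac)
    also have "sgn (\<beta> i * \<gamma> i k) * (\<beta> i * \<gamma> i k) = \<bar>\<beta> i * \<gamma> i k\<bar>"
      by (simp only: abs_sgn mult.commute)
    also have "\<bar>\<beta> i * \<gamma> i k\<bar> = r i k * (l k * (M + 1))"
    proof -
      have "M + 1 \<noteq> 0" "l k \<noteq> 0" using M lp[of k] by auto
      then show ?thesis using lp[of k] by (simp add: r_def abs_mult)
    qed
    finally show ?thesis using False by simp
  qed
  then have "(\<Sum>i\<in>S. (\<Sum>k\<in>A i. d i k * \<gamma> i k) * \<beta> i) = (M + 1) / \<tau> * \<tau>"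
    by (simp only: sum_distrib_right sum_distrib_left \<tau>_def)
  then show False using \<tau> le by simp
qed

text \<open>Hoelder's inequality against a constant vector, from Young's inequality for each
  normalized term and the constant \<open>z\<close> with \<open>m * z powr q = 1\<close>.\<close>

lemma sum_le_card_powr:
  fixes \<beta> :: "'a \<Rightarrow> real"
  assumes pq: "1 < p" "1 / p + 1 / q = 1" and I: "finite I" "I \<noteq> {}" and \<beta>: "\<And>i. i \<in> I \<Longrightarrow> 0 \<le> \<beta> i"
    and E: "E > 0" "(\<Sum>i\<in>I. \<beta> i powr p) \<le> E powr p"
  shows "(\<Sum>i\<in>I. \<beta> i) \<le> E * real (card I) powr (1 / q)"
proof -
  have q: "1 < q" using conjugate_exponent(1)[OF pq] .
  define m where "m = real (card I)"
  have m: "m > 0" using I by (simp add: m_def card_gt_0_iff)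
  define z where "z = m powr (- (1 / q))"
  have "z powr q = m powr - 1" unfolding z_def powr_powr using q by simp
  then have zq: "z powr q = 1 / m" using m by (simp add: powr_minus_divide)
  have "(\<Sum>i\<in>I. \<beta> i / E * z) \<le> (\<Sum>i\<in>I. (\<beta> i / E) powr p / p + z powr q / q)"
    using \<beta> E pq q by (intro sum_mono Youngs_inequality) (auto simp: z_def)
  also have "\<dots> = (\<Sum>i\<in>I. (\<beta> i / E) powr p) / p + m * (z powr q / q)"
    by (simp add: sum.distrib sum_divide_distrib m_def)
  also have "m * (z powr q / q) = 1 / q" using m zq by simp
  also have "(\<Sum>i\<in>I. (\<beta> i / E) powr p) = (\<Sum>i\<in>I. \<beta> i powr p) / E powr p"
    unfolding sum_divide_distrib using E \<beta> by (intro sum.cong) (auto simp: powr_divide)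
  also have "(\<Sum>i\<in>I. \<beta> i powr p) / E powr p / p + 1 / q \<le> 1 / p + 1 / q"
  proof -
    have "(\<Sum>i\<in>I. \<beta> i powr p) \<le> 1 * E powr p" "0 < E powr p" using E by auto
    then have "(\<Sum>i\<in>I. \<beta> i powr p) / E powr p \<le> 1" by (simp only: pos_divide_le_eq)
    then have "(\<Sum>i\<in>I. \<beta> i powr p) / E powr p / p \<le> 1 / p"
      by (rule divide_right_mono) (use pq(1) in simp)
    then show ?thesis by simp
  qed
  finally have le: "(\<Sum>i\<in>I. \<beta> i / E * z) \<le> 1" using pq(2) by simp
  have "(\<Sum>i\<in>I. \<beta> i / E * z) = (\<Sum>i\<in>I. \<beta> i) / (E * m powr (1 / q))"
    by (simp add: z_def powr_minus_divide sum_divide_distrib)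
  then have "(\<Sum>i\<in>I. \<beta> i) / (E * m powr (1 / q)) \<le> 1" using le by simp
  moreover have "0 < E * m powr (1 / q)" using E m by simp
  ultimately have "(\<Sum>i\<in>I. \<beta> i) \<le> 1 * (E * m powr (1 / q))" by (simp only: pos_divide_le_eq)
  then show ?thesis by (simp add: m_def)
qed

text \<open>A function \<open>c\<close> nearly norms \<open>s\<close> times a block of generators,
  with total pairing 1 split into the parts \<open>s * \<beta> i\<close>. The projection bounds the
  combination of the dual functions \<open>h i\<close> with coefficients \<open>\<beta> i\<close>,
  homogeneity of \<open>F\<close> then bounds the p-norm of \<open>\<beta>\<close>, and so its sum
  is at most a multiple of \<open>m powr (1 / q)\<close>. Hence \<open>s * m powr (1 / q)\<close>
  stays away from 0, which the mixed sequence contradicts.\<close>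

theorem DC_imp_power_upper:
  assumes F: "orlicz_function F" and G: "orlicz_function G"
    and FG: "young_conjugate F G" and GF: "young_conjugate G F"
    and pq: "1 < p" "1 / p + 1 / q = 1" and DH: "DH F p" and DC: "DC G"
  shows "\<exists>K. power_upper G q K"
proof (rule ccontr)
  have q: "1 < q" using conjugate_exponent(1)[OF pq] .
  assume "\<not> ?thesis"
  then have no: "\<And>K. \<not> power_upper G q K" by blast
  obtain l v B where l: "slot_lengths l" and v: "\<And>k. v k > 0" and B: "\<And>i::nat. finite (B i)"
    "\<And>i j. i \<noteq> j \<Longrightarrow> B i \<inter> B j = {}" "\<And>i. B i \<noteq> {}"
    and one: "\<And>i. (\<Sum>k\<in>B i. G \<bar>v k\<bar> * l k) = 1"
    and blocks: "\<And>\<phi> D. strict_mono \<phi> \<Longrightarrow> D > 0 \<Longrightarrow> \<exists>s>0. \<exists>m N. s powr q * real m < D \<and>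
      (\<Sum>i\<in>{N..<N + m}. \<Sum>k\<in>B (\<phi> i). G (s * \<bar>v k\<bar>) * l k) > 1"
    by (rule no_power_upper_blocks[OF G no]) (rule that; assumption)
  have lp: "l k > 0" for k using slot_lengths_pos[OF l] .
  have "normed_disjoint_seq G (\<lambda>i. step l (B i) v)" by (rule normed_disjoint_step[OF G l B(1,2) one])
  then have "(\<forall>n. step l (B n) v \<in> orlicz_space G) \<and> disjoint_seq (\<lambda>i. step l (B i) v)"
    by (simp add: normed_disjoint_seq_def)
  with DC[unfolded DC_def, rule_format, of "\<lambda>i. step l (B i) v"]
  obtain \<phi>1 where \<phi>1: "strict_mono \<phi>1"
    and com: "complemented G (closed_span G ((\<lambda>i. step l (B i) v) \<circ> \<phi>1))"
    by blast
  define A where "A i = B (\<phi>1 i)" for i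
  have A: "finite (A i)" "A i \<noteq> {}" "(\<Sum>k\<in>A i. G \<bar>v k\<bar> * l k) = 1" for i
    unfolding A_def by (rule B(1), rule B(3), rule one)
  have Adis: "A i \<inter> A j = {}" if "i \<noteq> j" for i j
    unfolding A_def using that strict_mono_eq[OF \<phi>1, of i j] by (intro B(2)) simp
  have com: "complemented G (closed_span G (\<lambda>i. step l (A i) v))"
    using com by (simp add: A_def comp_def)
  obtain \<gamma> M where M: "M \<ge> 0"
    and \<gamma>: "\<And>i. (\<Sum>k\<in>A i. v k * \<gamma> i k) = 1"
    and diag: "\<And>S c d. finite S \<Longrightarrow> (\<Sum>i\<in>S. \<Sum>k\<in>A i. F \<bar>c i k\<bar> * l k) \<le> 1 \<Longrightarrow>
      (\<Sum>i\<in>S. \<Sum>k\<in>A i. G \<bar>d i k\<bar> * l k) \<le> 1 \<Longrightarrow>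
      (\<Sum>i\<in>S. (\<Sum>k\<in>A i. d i k * \<gamma> i k) * (\<Sum>k\<in>A i. c i k * v k * l k)) \<le> M"
    by (rule complemented_step_span_dual[OF F G FG l v A(1) Adis A(2) com]) (assumption | (rule that; assumption))+
  \<comment> \<open>Dividing by \<open>l k\<close> turns the weights \<open>\<gamma> i k\<close>
    into a density whose pairing with the i-th generator is 1. Hoelder's inequality then bounds the
    norm of \<open>h i\<close> below by 1/2.\<close>
  define h where "h i = step l (A i) (\<lambda>k. \<gamma> i k / l k)" for i
  have hs: "h i \<in> orlicz_space F" for i unfolding h_def by (rule step_in_orlicz_space[OF F l A(1)])
  define \<nu> where "\<nu> i = lux_norm F (h i)" for i
  have \<nu>: "\<nu> i \<ge> 1/2" for i
    unfolding \<nu>_def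
  proof (rule lux_norm_ge[OF F hs])
    fix c :: real assume c: "c > 0" "modular F (h i) c \<le> 1"
    have "modular G (step l (A i) v) 1 \<le> 1"
      using modular_step[OF G l A(1), of 1 i v] A(3) by simp
    then have "\<bar>\<integral>t. h i t * step l (A i) v t \<partial>I01\<bar> \<le> 2 * c * 1"
      by (rule orlicz_holder(2)[OF F G FG orlicz_space_measurable[OF hs] step_measurable[OF l] c(1) zero_less_one c(2)])
    moreover have "(\<integral>t. h i t * step l (A i) v t \<partial>I01) = (\<Sum>k\<in>A i. \<gamma> i k / l k * v k * l k)"
      unfolding h_def using integral_step(1)[OF l] by (simp add: step_mult[OF l A(1) A(1)])
    moreover have "(\<Sum>k\<in>A i. \<gamma> i k / l k * v k * l k) = (\<Sum>k\<in>A i. v k * \<gamma> i k)"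
    proof (rule sum.cong[OF refl])
      fix k
      have "l k \<noteq> 0" using lp[of k] by simp
      then show "\<gamma> i k / l k * v k * l k = v k * \<gamma> i k" by simp
    qed
    ultimately show "1/2 \<le> c" using \<gamma>[of i] by simp
  qed
  have \<nu>pos: "\<nu> i > 0" for i using \<nu>[of i] by simp
  then have \<nu>ne: "\<nu> i \<noteq> 0" for i by (simp add: less_imp_neq[symmetric])
  define y where "y i = (\<lambda>t. 1 / \<nu> i * h i t)" for i
  have dh: "disjoint_seq h" unfolding h_def[abs_def] by (rule disjoint_seq_step[OF l A(1) Adis])
  have "normed_disjoint_seq F y"
    unfolding normed_disjoint_seq_def
  proof (intro conjI allI)
    show "y i \<in> orlicz_space F" for i unfolding y_def by (rule orlicz_space_scale[OF F hs])
    show "lux_norm F (y i) = 1" for i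
      using lux_norm_scale[OF F hs, of "1 / \<nu> i" i] \<nu>pos[of i] by (simp add: y_def \<nu>_def)
    show "disjoint_seq y"
      using dh \<nu>ne unfolding disjoint_seq_def y_def by simp
  qed
  then obtain \<phi>2 C where \<phi>2: "strict_mono \<phi>2" and eq: "equiv_lr F p C (y \<circ> \<phi>2)"
    using DH unfolding DH_def by blast
  have C: "C > 0" using eq by (simp add: equiv_lr_def)
  \<comment> \<open>\<open>C\<close> from the equivalence, \<open>M + 1\<close> from the norm of the
    combination, 2 from the lower bound 1/2 on \<open>\<nu>\<close>.\<close>
  define E where "E = 2 * (C * (M + 1))"
  have E: "E > 0" using C M by (simp add: E_def)
  \<comment> \<open>The generators were thinned twice, by \<open>DC\<close> and by homogeneity; the
    block estimate holds along every subsequence and so along the composition.\<close>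
  have "strict_mono (\<phi>1 \<circ> \<phi>2)" using \<phi>1 \<phi>2 by (rule strict_mono_o)
  moreover have "(1 / E) powr q > 0" using E by simp
  ultimately obtain s m N where s: "s > 0" "s powr q * real m < (1 / E) powr q"
    and big: "(\<Sum>i\<in>{N..<N + m}. \<Sum>k\<in>B ((\<phi>1 \<circ> \<phi>2) i). G (s * \<bar>v k\<bar>) * l k) > 1"
    using blocks by blast
  define I where "I = {N..<N + m}"
  define S where "S = \<phi>2 ` I"
  have inj: "inj_on \<phi>2 I" using strict_mono_imp_inj_on[OF \<phi>2] .
  define \<tau> where "\<tau> = (\<Sum>i\<in>S. \<Sum>k\<in>A i. G (s * v k) * l k)"
  have vabs: "\<bar>v k\<bar> = v k" for k using v[of k] by simp
  have \<tau>: "\<tau> > 1"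
  proof -
    have "\<tau> = (\<Sum>i\<in>I. \<Sum>k\<in>A (\<phi>2 i). G (s * v k) * l k)"
      by (simp add: \<tau>_def S_def sum.reindex[OF inj])
    then show ?thesis using big by (simp add: A_def I_def vabs)
  qed
  have sv: "s * v k > 0" for k using s v[of k] by simp
  have Gsv: "0 \<le> G (s * v k)" for k by (rule orlicz_nonneg[OF G less_imp_le[OF sv]])
  \<comment> \<open>The near-subgradient \<open>G x / x\<close> at \<open>x = s * v k\<close>,
    divided by \<open>\<tau>\<close>: \<open>conjugate_ratio_le\<close> keeps its modular at most 1,
    and its pairing with \<open>s\<close> times the block is exactly 1.\<close>
  define c where "c k = 1 / \<tau> * (G (s * v k) / (s * v k))" for k
  have c0: "c k \<ge> 0" for k
    unfolding c_def using \<tau> Gsv[of k] sv[of k] by (intro mult_nonneg_nonneg divide_nonneg_pos) auto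
  define \<beta> where "\<beta> i = (\<Sum>k\<in>A i. c k * v k * l k)" for i
  have \<beta>0: "\<beta> i \<ge> 0" for i
    unfolding \<beta>_def by (intro sum_nonneg mult_nonneg_nonneg c0 less_imp_le[OF v] less_imp_le[OF lp])
  have S: "finite S" by (simp add: S_def I_def)
  have cF: "(\<Sum>i\<in>S. \<Sum>k\<in>A i. F \<bar>c k\<bar> * l k) \<le> 1"
  proof -
    have Fc: "F \<bar>c k\<bar> \<le> 1 / \<tau> * G (s * v k)" for k
    proof -
      have "F (c k) \<le> 1 / \<tau> * F (G (s * v k) / (s * v k))"
        unfolding c_def using \<tau> Gsv[of k] sv[of k] by (intro orlicz_contract[OF F]) auto
      also have "\<dots> \<le> 1 / \<tau> * G (s * v k)"
        using \<tau> conjugate_ratio_le[OF G GF sv] by (intro mult_left_mono) auto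
      finally show ?thesis using c0[of k] by simp
    qed
    have "(\<Sum>i\<in>S. \<Sum>k\<in>A i. F \<bar>c k\<bar> * l k) \<le> (\<Sum>i\<in>S. \<Sum>k\<in>A i. 1 / \<tau> * G (s * v k) * l k)"
      by (intro sum_mono mult_right_mono Fc less_imp_le[OF lp])
    also have "\<dots> = 1 / \<tau> * \<tau>" unfolding \<tau>_def by (simp only: sum_distrib_left mult.assoc)
    finally show ?thesis using \<tau> by simp
  qed
  have sum\<beta>: "s * (\<Sum>i\<in>S. \<beta> i) = 1"
  proof -
    have cvl: "c k * v k * l k = 1 / (s * \<tau>) * (G (s * v k) * l k)" for k
      using s(1) v[of k] by (simp add: c_def)
    have "(\<Sum>i\<in>S. \<beta> i) = 1 / (s * \<tau>) * \<tau>"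
      unfolding \<beta>_def cvl sum_distrib_left[symmetric] by (simp only: \<tau>_def)
    then show ?thesis using s(1) \<tau> by simp
  qed
  have le1: "(\<Sum>i\<in>S. \<Sum>k\<in>A i. F (\<bar>\<beta> i\<bar> / (M + 1) * \<bar>\<gamma> i k / l k\<bar>) * l k) \<le> 1"
  proof (rule dual_combination_bound[OF F G FG l M])
    fix d :: "nat \<Rightarrow> nat \<Rightarrow> real"
    assume "(\<Sum>i\<in>S. \<Sum>k\<in>A i. G \<bar>d i k\<bar> * l k) \<le> 1"
    from diag[where c = "\<lambda>_. c", OF S cF this]
    show "(\<Sum>i\<in>S. (\<Sum>k\<in>A i. d i k * \<gamma> i k) * \<beta> i) \<le> M" by (simp only: \<beta>_def)
  qed
  have modS: "modular F (\<lambda>t. \<Sum>i\<in>S. \<beta> i * h i t) (M + 1) \<le> 1"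
  proof -
    have M1: "M + 1 > 0" using M by simp
    show ?thesis
      unfolding h_def using le1 modular_step_combination[OF F l A(1) Adis S M1,
        where a = \<beta> and c = "\<lambda>i k. \<gamma> i k / l k"] by simp
  qed
  \<comment> \<open>The factor \<open>\<nu>\<close> undoes the normalization in
    \<open>y\<close>.\<close>
  define a where "a i = (if N \<le> i then \<beta> (\<phi>2 i) * \<nu> (\<phi>2 i) else 0)" for i
  have comb: "(\<lambda>t. \<Sum>i\<in>S. \<beta> i * h i t) = (\<lambda>t. \<Sum>i<N + m. a i * (y \<circ> \<phi>2) i t)"
  proof
    fix t
    have "(\<Sum>i<N + m. a i * (y \<circ> \<phi>2) i t) = (\<Sum>i\<in>I. \<beta> (\<phi>2 i) * h (\<phi>2 i) t)"
      using \<nu>ne by (intro sum.mono_neutral_cong_right) (auto simp: I_def a_def y_def)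
    then show "(\<Sum>i\<in>S. \<beta> i * h i t) = (\<Sum>i<N + m. a i * (y \<circ> \<phi>2) i t)"
      by (simp add: S_def sum.reindex[OF inj])
  qed
  have "lr_norm p a (N + m) / C \<le> lux_norm F (\<lambda>t. \<Sum>i\<in>S. \<beta> i * h i t)"
    using eq unfolding equiv_lr_def comb by blast
  also have "\<dots> \<le> M + 1" by (rule lux_norm_le[OF _ modS]) (use M in simp)
  finally have "lr_norm p a (N + m) \<le> C * (M + 1)" using C by (simp add: field_simps)
  then have "lr_norm p a (N + m) powr p \<le> (C * (M + 1)) powr p"
    using pq(1) by (intro powr_mono2 lr_norm_nonneg) auto
  then have ap: "(\<Sum>i<N + m. \<bar>a i\<bar> powr p) \<le> (C * (M + 1)) powr p"
    using lr_norm_powr[of p a "N + m"] pq(1) by simp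
  have "(\<Sum>i\<in>I. \<beta> (\<phi>2 i) powr p) \<le> (\<Sum>i\<in>I. 2 powr p * \<bar>a i\<bar> powr p)"
  proof (rule sum_mono)
    fix i assume "i \<in> I"
    then have ai: "\<bar>a i\<bar> = \<beta> (\<phi>2 i) * \<nu> (\<phi>2 i)"
      using \<beta>0[of "\<phi>2 i"] \<nu>pos[of "\<phi>2 i"] by (simp add: a_def I_def abs_mult)
    have "\<beta> (\<phi>2 i) * (1/2) \<le> \<beta> (\<phi>2 i) * \<nu> (\<phi>2 i)" by (rule mult_left_mono[OF \<nu> \<beta>0])
    then have "\<beta> (\<phi>2 i) powr p \<le> (2 * \<bar>a i\<bar>) powr p"
      using \<beta>0[of "\<phi>2 i"] pq(1) unfolding ai by (intro powr_mono2) auto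
    then show "\<beta> (\<phi>2 i) powr p \<le> 2 powr p * \<bar>a i\<bar> powr p" by (simp add: powr_mult)
  qed
  also have "\<dots> \<le> 2 powr p * (\<Sum>i<N + m. \<bar>a i\<bar> powr p)"
    unfolding sum_distrib_left[symmetric] by (intro mult_left_mono sum_mono2) (auto simp: I_def)
  also have "\<dots> \<le> 2 powr p * (C * (M + 1)) powr p" by (rule mult_left_mono[OF ap]) simp
  also have "\<dots> = E powr p" using C M by (simp add: E_def powr_mult)
  finally have bp: "(\<Sum>i\<in>I. \<beta> (\<phi>2 i) powr p) \<le> E powr p" .
  have "I \<noteq> {}" using \<tau> by (auto simp: \<tau>_def S_def)
  moreover have "finite I" by (simp add: I_def)
  ultimately have "(\<Sum>i\<in>I. \<beta> (\<phi>2 i)) \<le> E * real (card I) powr (1 / q)"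
    by (intro sum_le_card_powr[OF pq _ _ \<beta>0 E bp])
  moreover have "(\<Sum>i\<in>I. \<beta> (\<phi>2 i)) = (\<Sum>i\<in>S. \<beta> i)" by (simp add: S_def sum.reindex[OF inj])
  moreover have "card I = m" by (simp add: I_def)
  ultimately have "s * (\<Sum>i\<in>S. \<beta> i) \<le> s * (E * real m powr (1 / q))"
    using s(1) by simp
  then have "1 / E \<le> s * real m powr (1 / q)" using E by (simp add: sum\<beta> field_simps)
  then have "(1 / E) powr q \<le> (s * real m powr (1 / q)) powr q"
    using E q by (intro powr_mono2) auto
  also have "\<dots> = s powr q * real m" using s(1) q by (simp add: powr_mult powr_powr)
  finally show False using s by simp
qed

section \<open>The functions \<open>E\<^sub>F\<^sup>\<infinity>\<close>\<close>

text \<open>For fixed \<open>t\<close> both bounds hold at all large \<open>y\<close>, and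
  membership for every \<open>A\<close> supplies an approximating quotient at such a
  \<open>y\<close>.\<close>

theorem power_bounds_imp_E_inf_equiv_power:
  assumes F: "orlicz_function F" and U: "power_upper F p K" and L: "power_lower F p K" and K: "1 \<le> K"
  shows "E_inf_equiv_power F p"
  unfolding E_inf_equiv_power_def
proof (intro exI[of _ K] conjI ballI)
  show "0 < K" using K by simp
  fix H t assume H: "H \<in> E_inf F" and t: "t \<in> {0<..1::real}"
  obtain Y1 where Y1: "\<And>y. y \<ge> Y1 \<Longrightarrow> F (t * y) \<le> K * t powr p * F y"
    using U t unfolding power_upper_def by blast
  obtain Y2 where Y2: "\<And>y. y \<ge> Y2 \<Longrightarrow> t powr p * F y \<le> K * F (t * y)"
    using L t unfolding power_lower_def by blast
  obtain Y3 where Y3: "\<And>y. y \<ge> Y3 \<Longrightarrow> F y > 0" using orlicz_eventually_gt[OF F, of 0] by blast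
  have near: "H t \<le> K * t powr p + e \<and> t powr p / K \<le> H t + e" if e: "e > 0" for e
  proof -
    have "max 1 (max Y1 (max Y2 Y3)) > 0" by simp
    then obtain y where y: "y > max 1 (max Y1 (max Y2 Y3))" "\<forall>t\<in>{0..1}. \<bar>H t - F (t * y) / F y\<bar> < e"
      using H e unfolding E_inf_def by blast
    have Fy: "F y > 0" using Y3 y(1) by simp
    have "\<bar>H t - F (t * y) / F y\<bar> < e" using y(2) t by auto
    moreover have "F (t * y) / F y \<le> K * t powr p" using Y1[of y] y(1) Fy by (simp add: pos_divide_le_eq)
    moreover have "t powr p / K \<le> F (t * y) / F y" using Y2[of y] y(1) Fy K by (simp add: field_simps)
    ultimately show ?thesis by linarith
  qed
  show "t powr p / K \<le> H t" by (rule field_le_epsilon) (use near in blast)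
  show "H t \<le> K * t powr p" by (rule field_le_epsilon) (use near in blast)
qed

text \<open>Convexity bounds the slope on [0,y] by that of a chord reaching to \<open>2 * y\<close>,
  where doubling applies. The constant is independent of \<open>y\<close>, which makes the quotients
  equicontinuous.\<close>

lemma orlicz_quotient_lipschitz:
  assumes F: "orlicz_function F" and y: "0 < y" "0 < F y" "F (2 * y) \<le> B * F y"
    and s: "0 \<le> s" "s \<le> s'" "s' \<le> 1"
  shows "\<bar>F (s' * y) / F y - F (s * y) / F y\<bar> \<le> B * (s' - s)"
proof -
  \<comment> \<open>The weight that places \<open>s' * y\<close> between \<open>s * y\<close> and
    \<open>2 * y\<close>; it is at most \<open>s' - s\<close> because
    \<open>2 - s \<ge> 1\<close>.\<close>
  define u where "u = (s' - s) / (2 - s)"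
  have u: "0 \<le> u" "u \<le> 1" "u \<le> s' - s"
  proof -
    have "s' - s \<le> (s' - s) * (2 - s)" using s mult_left_mono[of 1 "2 - s" "s' - s"] by simp
    then show "u \<le> s' - s" using s by (simp add: u_def pos_divide_le_eq)
  qed (use s in \<open>auto simp: u_def field_simps\<close>)
  have us: "u * (2 - s) = s' - s" using s by (simp add: u_def)
  have "(1 - u) * (s * y) + u * (2 * y) = (s + u * (2 - s)) * y" by (simp add: algebra_simps)
  then have "s' * y = (1 - u) * (s * y) + u * (2 * y)" unfolding us by simp
  then have "F (s' * y) \<le> (1 - u) * F (s * y) + u * F (2 * y)"
    using orlicz_convex[OF F, of "s * y" "2 * y" u] u s y by simp
  moreover have "u * F (2 * y) \<le> u * (B * F y)" using u y by (intro mult_left_mono) auto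
  moreover have "0 \<le> u * F (s * y)" using u s y by (intro mult_nonneg_nonneg orlicz_nonneg[OF F]) auto
  moreover have BF: "0 \<le> B * F y" using y orlicz_nonneg[OF F, of "2 * y"] by simp
  then have "u * (B * F y) \<le> (s' - s) * (B * F y)" using u by (intro mult_right_mono) auto
  ultimately have "F (s' * y) - F (s * y) \<le> B * (s' - s) * F y" by (simp add: algebra_simps)
  then have "(F (s' * y) - F (s * y)) / F y \<le> B * (s' - s)" using y by (simp add: pos_divide_le_eq)
  moreover have "F (s * y) \<le> F (s' * y)" using s y by (intro orlicz_mono[OF F] mult_right_mono) auto
  then have "0 \<le> (F (s' * y) - F (s * y)) / F y" using y by simp
  ultimately show ?thesis by (simp add: diff_divide_distrib)
qed

text \<open>The hypothesis speaks only about uniform limits of quotients, so a violation must be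
  carried to a limit. Doubling gives equicontinuity, and by Arzela-Ascoli the quotients at violating
  points have a uniform limit in \<open>E_inf F\<close>, which is too small at
  \<open>t\<close>.\<close>

theorem E_inf_equiv_power_imp_power_lower:
  assumes F: "orlicz_function F" and dbl: "Y > 0" "\<And>y. y \<ge> Y \<Longrightarrow> F (2 * y) \<le> B * F y"
    and E: "E_inf_equiv_power F p"
  shows "\<exists>K. power_lower F p K"
proof -
  obtain C where C: "C > 0" "\<And>H t. H \<in> E_inf F \<Longrightarrow> t \<in> {0<..1} \<Longrightarrow> t powr p / C \<le> H t"
    using E unfolding E_inf_equiv_power_def by blast
  have "power_lower F p (2 * C)"
  proof (rule ccontr)
    assume "\<not> power_lower F p (2 * C)"
    then obtain t where t: "t \<in> {0<..1}" "\<And>Y. \<exists>y\<ge>Y. t powr p * F y > 2 * C * F (t * y)"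
      unfolding power_lower_def by (meson not_le)
    obtain Z where Z: "\<And>y. y \<ge> Z \<Longrightarrow> F y > 0" using orlicz_eventually_gt[OF F, of 0] by blast
    have "\<exists>y. y \<ge> max (real n) (max Y Z) \<and> t powr p * F y > 2 * C * F (t * y)" for n :: nat
      using t(2)[of "max (real n) (max Y Z)"] by blast
    then have "\<forall>n. \<exists>y. y \<ge> max (real n) (max Y Z) \<and> t powr p * F y > 2 * C * F (t * y)" by blast
    from choice[OF this] obtain y where y: "\<And>n. y n \<ge> max (real n) (max Y Z)"
      "\<And>n. t powr p * F (y n) > 2 * C * F (t * y n)" by blast
    have yn: "y n \<ge> real n" and yY: "y n \<ge> Y" and yZ: "y n \<ge> Z" for n using y(1)[of n] by simp_all
    have ypos: "y n > 0" for n using yY[of n] dbl(1) by linarith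
    have Fy: "F (y n) > 0" for n by (rule Z[OF yZ])
    have y2: "F (2 * y n) \<le> B * F (y n)" for n by (rule dbl(2)[OF yY])
    have "F (y 0) \<le> F (2 * y 0)" using ypos[of 0] by (intro orlicz_mono[OF F]) auto
    then have "1 * F (y 0) \<le> B * F (y 0)" using y2[of 0] by simp
    then have B1: "B \<ge> 1" using Fy[of 0] by (simp only: mult_le_cancel_right_pos)
    define h where "h n s = F (s * y n) / F (y n)" for n and s :: real
    have lip: "\<bar>h n s - h n s'\<bar> \<le> B * \<bar>s - s'\<bar>" if "s \<in> {0..1}" "s' \<in> {0..1}" for n s s'
    proof (cases "s \<le> s'")
      case True
      have "\<bar>h n s' - h n s\<bar> \<le> B * (s' - s)"
        unfolding h_def using that True by (intro orlicz_quotient_lipschitz[OF F ypos Fy y2]) auto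
      then show ?thesis using True by (simp add: abs_minus_commute)
    next
      case False
      have "\<bar>h n s - h n s'\<bar> \<le> B * (s - s')"
        unfolding h_def using that False by (intro orlicz_quotient_lipschitz[OF F ypos Fy y2]) auto
      then show ?thesis using False by simp
    qed
    have bound: "norm (h n s) \<le> 1" if "s \<in> {0..1}" for n s
    proof -
      have "F (s * y n) \<le> F (y n)"
        using that ypos[of n] by (intro orlicz_mono[OF F]) (auto simp: mult_left_le_one_le)
      moreover have "0 \<le> F (s * y n)" using that ypos[of n] by (intro orlicz_nonneg[OF F]) auto
      ultimately show ?thesis using Fy[of n] by (simp add: h_def)
    qed
    have equicont: "\<exists>d>0. \<forall>n s'. s' \<in> {0..1} \<and> norm (s - s') < d \<longrightarrow> norm (h n s - h n s') < e"
      if s: "s \<in> {0..1}" and e: "0 < e" for s e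
    proof (intro exI[of _ "e / B"] conjI allI impI)
      show "0 < e / B" using e B1 by simp
      fix n s' assume s': "s' \<in> {0..1} \<and> norm (s - s') < e / B"
      then have "\<bar>h n s - h n s'\<bar> \<le> B * \<bar>s - s'\<bar>" using lip[OF s] by blast
      also have "\<dots> < B * (e / B)" using s' B1 by (intro mult_strict_left_mono) auto
      also have "\<dots> = e" using B1 by simp
      finally show "norm (h n s - h n s') < e" by simp
    qed
    obtain g k where g: "continuous_on {0..1} g" and k: "strict_mono (k :: nat \<Rightarrow> nat)"
      and conv: "\<And>e. 0 < e \<Longrightarrow> \<exists>N. \<forall>n x. n \<ge> N \<and> x \<in> {0..1} \<longrightarrow> norm (h (k n) x - g x) < e"
      by (rule Arzela_Ascoli[of "{0..1::real}" h 1, OF compact_Icc bound equicont])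
        (assumption | (rule that; assumption))+
    have kn: "k n \<ge> n" for n using strict_mono_imp_increasing[OF k] .
    have "g \<in> E_inf F"
      unfolding E_inf_def
    proof (intro CollectI conjI g allI impI)
      fix A e :: real assume "A > 0" "e > 0"
      obtain N where N: "\<And>n x. n \<ge> N \<Longrightarrow> x \<in> {0..1} \<Longrightarrow> norm (h (k n) x - g x) < e"
        using conv[OF \<open>e > 0\<close>] by blast
      obtain m :: nat where m: "A < real m" using reals_Archimedean2 by blast
      \<comment> \<open>\<open>N\<close> gives closeness to \<open>g\<close>, and \<open>m\<close>
        pushes \<open>y (k n) \<ge> n\<close> beyond \<open>A\<close>.\<close>
      define n where "n = max N m"
      have "real m \<le> y (k n)" using yn[of "k n"] kn[of n] by (simp add: n_def)
      then have "y (k n) > A" using m by simp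
      moreover have "\<bar>g x - F (x * y (k n)) / F (y (k n))\<bar> < e" if "x \<in> {0..1}" for x
        using N[of n x] that by (simp add: n_def h_def abs_minus_commute)
      ultimately show "\<exists>y>A. \<forall>t\<in>{0..1}. \<bar>g t - F (t * y) / F y\<bar> < e" by blast
    qed
    then have gt: "t powr p / C \<le> g t" using C(2) t(1) by blast
    \<comment> \<open>At \<open>t\<close> the limit is at least \<open>2 * e\<close> and the
      violating quotients are below \<open>e\<close>, so they cannot come within \<open>e\<close> of
      the limit.\<close>
    define e where "e = t powr p / (2 * C)"
    have "e > 0" using t(1) C(1) by (simp add: e_def)
    from conv[OF this] obtain N where "\<And>n x. n \<ge> N \<Longrightarrow> x \<in> {0..1} \<Longrightarrow> norm (h (k n) x - g x) < e" by blast
    from this[of N t] have "norm (h (k N) t - g t) < e" using t(1) by simp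
    moreover have "h (k N) t < e"
      using y(2)[of "k N"] Fy[of "k N"] C(1) by (simp add: h_def e_def field_simps)
    moreover have "t powr p / C = e + e" using C(1) by (simp add: e_def)
    ultimately show False using gt by (simp add: abs_less_iff)
  qed
  then show ?thesis by blast
qed

section \<open>Equivalence of the four conditions\<close>

theorem mainTheorem14:
  fixes F G :: "real \<Rightarrow> real" and p q :: real
  assumes "1 < p" and "1 / p + 1 / q = 1"
    and "orlicz_function F" and "orlicz_function G"
    and "young_conjugate F G" and "young_conjugate G F"
    and "DH F p"
  shows "(DH G q \<longleftrightarrow> DC G) \<and> (DC G \<longleftrightarrow> uniform_DH F p)
         \<and> (uniform_DH F p \<longleftrightarrow> E_inf_equiv_power F p)"
proof -
  note pq = assms(1,2) and F = assms(3) and G = assms(4) and FG = assms(5) and GF = assms(6)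
  have q1: "1 < q" using conjugate_exponent(1)[OF pq] .
  have qp: "1 / q + 1 / p = 1" using pq(2) by simp
  have p0: "p > 0" and p1: "1 \<le> p" using pq(1) by auto
  define R where "R \<longleftrightarrow> (\<exists>K\<ge>1. power_upper F p K \<and> power_lower F p K)"
  obtain KU where KU: "power_upper F p KU" using DH_imp_power_upper[OF F assms(7) p0] by blast
  have R_lower: R if "power_lower F p K" for K
    unfolding R_def
  proof (intro exI[of _ "max 1 (max K KU)"] conjI)
    show "power_upper F p (max 1 (max K KU))" by (rule power_upper_mono[OF F KU]) simp
    show "power_lower F p (max 1 (max K KU))" by (rule power_lower_mono[OF F that]) simp
  qed simp
  \<comment> \<open>Conjugation is used in the direction from \<open>G\<close> to \<open>F\<close>,
    with \<open>p\<close> and \<open>q\<close> exchanged, so an upper bound for \<open>G\<close>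
    supplies the missing lower bound for \<open>F\<close>.\<close>
  have R_dual: R if "power_upper G q K" for K
  proof -
    have "power_upper G q (max 1 K)" by (rule power_upper_mono[OF G that]) simp
    then have "power_lower F p (max 1 K powr (p - 1))"
      using power_upper_imp_conjugate_lower[OF G F GF q1 qp, of "max 1 K"] by simp
    then show R by (rule R_lower)
  qed
  have dual: "\<exists>K\<ge>1. power_upper F p K \<and> power_upper G q K \<and> power_lower G q K" if R
  proof -
    obtain K where K: "1 \<le> K" "power_upper F p K" "power_lower F p K" using \<open>R\<close> by (auto simp: R_def)
    have U: "power_upper G q (K powr q)" by (rule power_lower_imp_conjugate_upper[OF F G FG pq K(1,3)])
    have L: "power_lower G q (K powr (q - 1))" by (rule power_upper_imp_conjugate_lower[OF F G FG pq K(1,2)])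
    define K' where "K' = max K (max (K powr q) (K powr (q - 1)))"
    have "power_upper F p K'" by (rule power_upper_mono[OF F K(2)]) (simp add: K'_def)
    moreover have "power_upper G q K'" by (rule power_upper_mono[OF G U]) (simp add: K'_def)
    moreover have "power_lower G q K'" by (rule power_lower_mono[OF G L]) (simp add: K'_def)
    moreover have "1 \<le> K'" using K(1) by (simp add: K'_def)
    ultimately show ?thesis by blast
  qed
  have "DH G q \<longleftrightarrow> R"
  proof
    assume "DH G q"
    then obtain K where "power_upper G q K" using DH_imp_power_upper[OF G] q1 by force
    then show R by (rule R_dual)
  next
    assume R
    from dual[OF this] obtain K where "1 \<le> K" "power_upper G q K" "power_lower G q K" by blast
    then have "uniform_DH G q" using q1 by (intro power_bounds_imp_uniform_DH[OF G]) auto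
    then show "DH G q" unfolding uniform_DH_def DH_def by blast
  qed
  moreover have "DC G \<longleftrightarrow> R"
  proof
    assume "DC G"
    then obtain K where "power_upper G q K" using DC_imp_power_upper[OF F G FG GF pq assms(7)] by blast
    then show R by (rule R_dual)
  next
    assume R
    from dual[OF this] show "DC G" using power_bounds_imp_DC[OF F G FG GF pq] by blast
  qed
  moreover have "uniform_DH F p \<longleftrightarrow> R"
  proof
    assume "uniform_DH F p"
    then show R using uniform_DH_imp_power_lower[OF F _ p0] R_lower by blast
  next
    assume R
    then show "uniform_DH F p" unfolding R_def using power_bounds_imp_uniform_DH[OF F _ _ _ p1] by blast
  qed
  moreover have "E_inf_equiv_power F p \<longleftrightarrow> R"
  proof
    assume E: "E_inf_equiv_power F p"
    \<comment> \<open>The compactness argument rests on doubling, which homogeneity of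
      \<open>F\<close> supplies before any lower power bound is known.\<close>
    obtain B Y where "Y > 0" "\<And>y. y \<ge> Y \<Longrightarrow> F (2 * y) \<le> B * F y"
      using DH_imp_doubling[OF F assms(7) p0] by blast
    from E_inf_equiv_power_imp_power_lower[OF F this E] R_lower show R by blast
  next
    assume R
    then show "E_inf_equiv_power F p" unfolding R_def using power_bounds_imp_E_inf_equiv_power[OF F] by blast
  qed
  ultimately show ?thesis by blast
qed

end
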